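(* Let $\delta\in\mathbb C$ with $\Re\,\delta>-1/2$, let $\beta>0$ and set $\beta'=\beta/2$. Let $U$ be a random matrix with law $\mathrm{CJ}^{(n)}_{\delta,\beta}$, and let $(\gamma_0,\dots,\gamma_{n-1})$ be the deformed Verblunsky coefficients of the spectral measure of $(U,e_1)$. Then the distribution of $(\gamma_0,\dots,\gamma_{n-1})$, denoted $\eta^{(n)}_{\delta,\beta}$, is the following: (1) the variables $\gamma_0,\dots,\gamma_{n-2},\gamma_{n-1}$ are independent; (2) for $k=0,\dots,n-2$ the density of $\gamma_k$ with respect to the Lebesgue measure $d^2z$ on $\mathbb C$ is $$c_{k,n}(\delta)\,(1-|z|^2)^{\beta'(n-k-1)-1}(1-z)^{\bar\delta}(1-\bar z)^{\delta}\,\mathbf 1_{\mathbb D}(z),$$ where $$c_{k,n}(\delta)=\frac{\Gamma\big(\beta'(n-k-1)+1+\delta\big)\,\Gamma\big(\beta'(n-k-1)+1+\bar\delta\big)}{\pi\,\Gamma\big(\beta'(n-k-1)\big)\,\Gamma\big(\beta'(n-k-1)+1+\delta+\bar\delta\big)};$$ (3) the density of $\gamma_{n-1}$ with respect to the (normalized) Haar measure on $\mathbb T$ is $$\lambda^{(\delta)}(\zeta)=\frac{\Gamma(1+\delta)\Gamma(1+\bar\delta)}{\Gamma(1+\delta+\bar\delta)}(1-\zeta)^{\bar\delta}(1-\bar\zeta)^{\delta},\qquad\zeta\in\mathbb T.$$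
   Context: $\mathbb D=\{|z|<1\}$, $\mathbb T=\{|z|=1\}$; complex powers of $1-z$, $|z|\le1$, $z\neq 1$, use the principal logarithm. $e_1$ is the first canonical basis vector. Verblunsky coefficients: for a probability measure $\mu$ on $\mathbb T$ supported at $n$ points $e^{\mathrm i\theta_1},\dots,e^{\mathrm i\theta_n}$, let $\Phi_0,\dots,\Phi_{n-1}$ be its monic orthogonal polynomials, $\Phi_n(z)=\prod_{j}(z-e^{\mathrm i\theta_j})$, $\Phi_j^*(z)=z^j\overline{\Phi_j(1/\bar z)}$. The Verblunsky coefficients $\alpha_0,\dots,\alpha_{n-2}\in\mathbb D$, $\alpha_{n-1}\in\mathbb T$ are given by $\Phi_{j+1}(z)=z\Phi_j(z)-\bar\alpha_j\Phi_j^*(z)$; the map $\mu\mapsto(\alpha_k)$ is a bijection onto $\mathbb D^{n-1}\times\mathbb T$. The deformed Verblunsky coefficients are $\gamma_k=1-\Phi_{k+1}(1)/\Phi_k(1)$, $0\le k\le n-1$. The spectral measure of $(U,e)$, $U$ unitary and $e$ a unit cyclic vector, is the probability measure $\mu$ on $\mathbb T$ with $\langle e,U^ke\rangle=\int z^kd\mu$ for all $k\in\mathbb Z$. GGT matrix: $\mathcal G(\alpha_0,\dots,\alpha_{n-1})$ is the matrix of $f(z)\mapsto zf(z)$ on $L^2(\mathbb T,\mu)$ in the basis of orthonormal polynomials $\Phi_j/\|\Phi_j\|$, $0\le j\le n-1$, where $\mu$ has Verblunsky coefficients $(\alpha_k)$; the spectral measure of $(\mathcal G(\alpha_0,\dots,\alpha_{n-1}),e_1)$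 is $\mu$. For $s>1$, $\nu_s$ is the probability measure on $\mathbb D$ with density $\frac{s-1}{2\pi}(1-|z|^2)^{(s-3)/2}$, and $\nu_1$ is the uniform distribution on $\mathbb T$. $\mathrm{CJ}^{(n)}_{0,\beta}$ is the law of $\mathcal G(\alpha_0,\dots,\alpha_{n-1})$ when the $\alpha_k$ are independent and $\alpha_k$ has law $\nu_{\beta(n-k-1)+1}$, $0\le k\le n-1$. $\mathrm{CJ}^{(n)}_{\delta,\beta}$ is the $\det_\delta$-sampling of $\mathrm{CJ}^{(n)}_{0,\beta}$: its density with respect to $\mathrm{CJ}^{(n)}_{0,\beta}$ is $\det_\delta(U)/\mathbb E[\det_\delta]$ (expectation under $\mathrm{CJ}^{(n)}_{0,\beta}$), where $\det_\delta(U)=\det(\mathrm{Id}-U)^{\bar\delta}\det(\mathrm{Id}-\overline U)^{\delta}$, i.e. the product over the eigenvalues $\zeta$ of $U$ of $(1-\zeta)^{\bar\delta}(1-\bar\zeta)^{\delta}$. *)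

theory Defs
  imports
    "HOL-Probability.Probability"
    "Jordan_Normal_Form.Char_Poly"
    "Jordan_Normal_Form.Schur_Decomposition"
begin

section \<open>Verblunsky coefficients of finitely supported measures on the circle\<close>

definition atoms :: "complex measure \<Rightarrow> complex set" where
  "atoms \<mu> = {z. measure \<mu> {z} > 0}"

definition circle_measure_pts :: "nat \<Rightarrow> complex measure \<Rightarrow> bool" where
  "circle_measure_pts n \<mu> \<longleftrightarrow>
     prob_space \<mu> \<and> sets \<mu> = sets borel \<and>
     finite (atoms \<mu>) \<and> card (atoms \<mu>) = n \<and> atoms \<mu> \<subseteq> sphere 0 1 \<and>
     measure \<mu> (atoms \<mu>) = 1"

text \<open>
  For \<open>\<mu>\<close> supported at \<open>n\<close> points, the orthogonality condition characterises the polynomial of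
  degree \<open>j\<close> only for \<open>j < n\<close>; the last one is the nodal polynomial of the support.
\<close>

definition monic_op :: "complex measure \<Rightarrow> nat \<Rightarrow> complex poly" where
  "monic_op \<mu> j =
     (if j < card (atoms \<mu>)
      then (THE P. degree P = j \<and> lead_coeff P = 1 \<and>
                   (\<forall>Q. degree Q < j \<longrightarrow> (LINT z|\<mu>. cnj (poly Q z) * poly P z) = 0))
      else (\<Prod>\<zeta>\<in>atoms \<mu>. [:- \<zeta>, 1:]))"

text \<open>
  On a polynomial \<open>P\<close> of degree \<open>j\<close>, this is the reversal
  \<open>P\<^sup>*(z) = z^j * cnj (P (1 / cnj z))\<close>.
\<close>

definition poly_star :: "complex poly \<Rightarrow> complex poly" where
  "poly_star P = reflect_poly (map_poly cnj P)"

definition verblunsky :: "complex measure \<Rightarrow> nat \<Rightarrow> complex" where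
  "verblunsky \<mu> j =
     (THE a. monic_op \<mu> (Suc j) =
             pCons 0 (monic_op \<mu> j) - Polynomial.smult (cnj a) (poly_star (monic_op \<mu> j)))"

definition deformed_verblunsky :: "complex measure \<Rightarrow> nat \<Rightarrow> complex" where
  "deformed_verblunsky \<mu> k = 1 - poly (monic_op \<mu> (Suc k)) 1 / poly (monic_op \<mu> k) 1"

definition verblunsky_measure :: "nat \<Rightarrow> (nat \<Rightarrow> complex) \<Rightarrow> complex measure" where
  "verblunsky_measure n \<alpha> =
     (THE \<mu>. circle_measure_pts n \<mu> \<and> (\<forall>k<n. verblunsky \<mu> k = \<alpha> k))"

section \<open>GGT matrices and spectral measures\<close>

definition orthonormal_op :: "complex measure \<Rightarrow> nat \<Rightarrow> complex poly" where
  "orthonormal_op \<mu> j =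
     Polynomial.smult (of_real (1 / sqrt (LINT z|\<mu>. (cmod (poly (monic_op \<mu> j) z))\<^sup>2))) (monic_op \<mu> j)"

definition ggt :: "nat \<Rightarrow> (nat \<Rightarrow> complex) \<Rightarrow> complex Matrix.mat" where
  "ggt n \<alpha> =
     (let \<mu> = verblunsky_measure n \<alpha> in
      Matrix.mat n n (\<lambda>(i, j).
        LINT z|\<mu>. cnj (poly (orthonormal_op \<mu> i) z) * (z * poly (orthonormal_op \<mu> j) z)))"

definition unitary_mat :: "nat \<Rightarrow> complex Matrix.mat \<Rightarrow> bool" where
  "unitary_mat n U \<longleftrightarrow>
     U \<in> carrier_mat n n \<and> U * mat_adjoint U = 1\<^sub>m n \<and> mat_adjoint U * U = 1\<^sub>m n"

definition cyclic_vec :: "nat \<Rightarrow> complex Matrix.mat \<Rightarrow> complex Matrix.vec \<Rightarrow> bool" where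
  "cyclic_vec n U e \<longleftrightarrow>
     LinearCombinations.module.span class_ring (module_vec TYPE(complex) n)
       (range (\<lambda>k. (U ^\<^sub>m k) *\<^sub>v e)) = carrier_vec n"

text \<open>Integer powers of a unitary matrix, whose inverse is its adjoint.\<close>

definition unitary_powi :: "complex Matrix.mat \<Rightarrow> int \<Rightarrow> complex Matrix.mat" where
  "unitary_powi U k = (if k \<ge> 0 then U ^\<^sub>m nat k else mat_adjoint U ^\<^sub>m nat (- k))"

text \<open>
  The operation \<open>\<bullet>c\<close> conjugates its second argument, so \<open>(U\<^sup>k e) \<bullet>c e\<close> is \<open>\<langle>e, U\<^sup>k e\<rangle>\<close> for the
  inner product that is linear in its second argument, as in \<open>ggt\<close>.
\<close>

definition spectral_measure :: "nat \<Rightarrow> complex Matrix.mat \<Rightarrow> complex Matrix.vec \<Rightarrow> complex measure" where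
  "spectral_measure n U e =
     (if unitary_mat n U \<and> e \<in> carrier_vec n \<and> e \<bullet>c e = 1 \<and> cyclic_vec n U e
      then (THE \<mu>. prob_space \<mu> \<and> sets \<mu> = sets borel \<and> measure \<mu> (sphere 0 1) = 1 \<and>
                   (\<forall>k::int. (unitary_powi U k *\<^sub>v e) \<bullet>c e = (LINT z|\<mu>. z powi k)))
      else undefined)"

section \<open>Circular Jacobi ensembles\<close>

definition circle_haar :: "complex measure" where
  "circle_haar = distr (uniform_measure lborel {0..2 * pi}) borel cis"

definition nu :: "real \<Rightarrow> complex measure" where
  "nu s =
     (if s = 1 then circle_haar
      else density lborel (\<lambda>z.
             ennreal ((s - 1) / (2 * pi) * (1 - (cmod z)\<^sup>2) powr ((s - 3) / 2)) *
             indicator (ball 0 1) z))"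

text \<open>
  The Borel structure on complex \<open>n \<times> n\<close> matrices, transported from the product of the entries.
\<close>

definition mat_borel :: "nat \<Rightarrow> complex Matrix.mat measure" where
  "mat_borel n =
     vimage_algebra (carrier_mat n n) (\<lambda>A. \<lambda>ij\<in>{..<n} \<times> {..<n}. A $$ ij)
       (\<Pi>\<^sub>M ij\<in>{..<n} \<times> {..<n}. borel)"

definition CJ0 :: "nat \<Rightarrow> real \<Rightarrow> complex Matrix.mat measure" where
  "CJ0 n \<beta> =
     distr (\<Pi>\<^sub>M k\<in>{..<n}. nu (\<beta> * real (n - k - 1) + 1)) (mat_borel n) (ggt n)"

text \<open>
  The eigenvalues are taken with multiplicity. On unitary matrices each factor is the product of a
  complex number and its conjugate (and \<open>0\<close> if \<open>\<zeta> = 1\<close>), hence a nonnegative real, so that \<open>Re\<close> below only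
  changes the type.
\<close>

definition det_delta :: "complex \<Rightarrow> complex Matrix.mat \<Rightarrow> complex" where
  "det_delta \<delta> U =
     (\<Prod>\<zeta>\<in>#proots (char_poly U). (1 - \<zeta>) powr cnj \<delta> * (1 - cnj \<zeta>) powr \<delta>)"

definition CJ :: "nat \<Rightarrow> complex \<Rightarrow> real \<Rightarrow> complex Matrix.mat measure" where
  "CJ n \<delta> \<beta> =
     density (CJ0 n \<beta>) (\<lambda>U. ennreal (Re (det_delta \<delta> U)) /
       (\<integral>\<^sup>+V. ennreal (Re (det_delta \<delta> V)) \<partial>CJ0 n \<beta>))"

text \<open>
  A random variable with a density given by a complex formula; that its values are nonnegative
  reals (almost everywhere) is part of the claim.
\<close>

definition has_density ::
  "'a measure \<Rightarrow> 'b measure \<Rightarrow> ('a \<Rightarrow> 'b) \<Rightarrow> ('b \<Rightarrow> complex) \<Rightarrow> bool" where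
  "has_density M N X f \<longleftrightarrow>
     (AE z in N. f z \<in> \<real>\<^sub>\<ge>\<^sub>0) \<and> distributed M N X (\<lambda>z. ennreal (Re (f z)))"

definition jacobi_const :: "nat \<Rightarrow> nat \<Rightarrow> real \<Rightarrow> complex \<Rightarrow> complex" where
  "jacobi_const k n \<beta>' \<delta> =
     (let a = of_real (\<beta>' * real (n - k - 1)) in
      Gamma (a + 1 + \<delta>) * Gamma (a + 1 + cnj \<delta>) /
      (of_real pi * Gamma a * Gamma (a + 1 + \<delta> + cnj \<delta>)))"

end

theory Submission
  imports Defs
begin

text \<open>
  The orthogonal polynomials of the spectral measure of \<open>(U, e\<^sub>1)\<close> follow the Szego recursion, whence
  \<open>\<gamma>\<^sub>k = u\<^sub>k(\<alpha>\<^sub>0, \<dots>, \<alpha>\<^bsub>k-1\<^esub>) * cnj \<alpha>\<^sub>k\<close> with \<open>\<bar>u\<^sub>k\<bar> = 1\<close>. The laws \<open>\<nu>\<^sub>s\<close> are invariant under rotations and conjugation,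
  so under \<open>\<delta> = 0\<close> the \<open>\<gamma>\<^sub>k\<close> are independent with the same laws as the \<open>\<alpha>\<^sub>k\<close>. Moreover the
  characteristic polynomial at 1 is \<open>\<Phi>\<^sub>n(1) = \<Prod>(1 - \<gamma>\<^sub>k)\<close>, and the principal logarithms of both
  factorisations agree, so that \<open>det\<^sub>\<delta>\<close> is the product of the \<open>(1 - \<gamma>\<^sub>k) powr cnj \<delta> * (1 - cnj \<gamma>\<^sub>k) powr \<delta>\<close>:
  sampling keeps independence and reweights each \<open>\<gamma>\<^sub>k\<close> separately. The normalising constants come
  from the Parseval identity for \<open>(1 - z) powr cnj \<delta>\<close> and Gauss's summation theorem.

  Verblunsky's theorem for finitely many points is proved along the way: the measure with
  coefficients \<open>\<alpha>\<close> sits at the zeros of \<open>\<Phi>\<^sub>n\<close>, with the inverse Christoffel--Darboux kernel on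
  the diagonal as weights.
\<close>

section \<open>The Szego recursion\<close>

text \<open>The measure of a coefficient sequence and the spectral measure of a matrix are definite
  descriptions over all measures, so neither \<open>ggt n\<close> nor the map from a matrix to its
  deformed coefficients is measurable on its face. Each is replaced by finite recursions: the
  entries of the GGT matrix by \<open>ggt_rec\<close> in the coefficients, the coefficients of a
  matrix by \<open>galph\<close> in its entries. These hold on the measurable sets
  \<open>verb_range\<close> and \<open>good_mats\<close>, off which the descriptions collapse to one
  fixed value. No matrix is diagonalised: the recursion reads only inner products of polynomials,
  and the eigenvalues enter through \<open>char_poly_good\<close>, as the atoms. For delta = 0 the
  map from alpha to gamma is triangular, so integrating out the last coordinate first meets a fixed
  reflection z -> u * cnj z. The circle coefficient needs a limit argument of its own, because its
  integral sits on the boundary of the disc, where the weight is unbounded if Re delta < 0.\<close>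

definition rev_poly :: "nat \<Rightarrow> complex poly \<Rightarrow> complex poly" where
  "rev_poly k p = (\<Sum>i\<le>k. monom (cnj (coeff p (k - i))) i)"

lemma coeff_rev_poly: "coeff (rev_poly k p) i = (if i \<le> k then cnj (coeff p (k - i)) else 0)"
proof -
  have "coeff (rev_poly k p) i = (\<Sum>j\<le>k. if j = i then cnj (coeff p (k - i)) else 0)"
    unfolding rev_poly_def coeff_sum by (intro sum.cong) auto
  then show ?thesis by simp
qed

lemma degree_rev_poly: "degree (rev_poly k p) \<le> k"
  by (rule degree_le) (simp add: coeff_rev_poly)

lemma rev_poly_rev_poly: "degree p \<le> k \<Longrightarrow> rev_poly k (rev_poly k p) = p"
  by (rule poly_eqI) (auto simp: coeff_rev_poly coeff_eq_0)

lemma coeff_poly_star: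
  "coeff (poly_star p) i = (if i \<le> degree p then cnj (coeff p (degree p - i)) else 0)"
proof -
  have "degree (map_poly cnj p) = degree p" by (rule degree_map_poly) auto
  then show ?thesis by (simp add: poly_star_def coeff_reflect_poly coeff_map_poly)
qed

text \<open>\<open>poly_star\<close> reverses at the actual degree. \<open>rev_poly k\<close> fixes
  the length, so that polynomials of lower degree are reversed inside the same space and reversal is
  an involution there, which is what the orthogonality proof needs.\<close>

lemma poly_star_eq_rev_poly: "poly_star p = rev_poly (degree p) p"
  by (rule poly_eqI) (simp add: coeff_poly_star coeff_rev_poly)

lemma poly_poly_star:
  assumes "z \<noteq> 0"
  shows "poly (poly_star p) z = z ^ degree p * cnj (poly p (1 / cnj z))"
proof -
  have d: "degree (map_poly cnj p) = degree p" by (rule degree_map_poly) auto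
  have "poly (poly_star p) z = z ^ degree p * poly (map_poly cnj p) (inverse z)"
    using assms d by (simp add: poly_star_def poly_reflect_poly_nz)
  also have "poly (map_poly cnj p) (inverse z) = cnj (poly p (cnj (inverse z)))"
    using poly_cnj[of p "cnj (inverse z)"] by simp
  finally show ?thesis by (simp add: field_simps)
qed

lemma poly_star_on_circle:
  assumes "cmod z = 1"
  shows "poly (poly_star p) z = z ^ degree p * cnj (poly p z)"
proof -
  have "z \<noteq> 0" using assms by auto
  have "z * cnj z = 1" using assms complex_norm_square[of z] by simp
  then have "1 / cnj z = z" using \<open>z \<noteq> 0\<close> by (simp add: field_simps)
  then show ?thesis using poly_poly_star[OF \<open>z \<noteq> 0\<close>] by simp
qed

text \<open>Defined for an arbitrary sequence: it describes the orthogonal polynomials of a given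
  measure, and also supplies the candidates when the measure has yet to be constructed.\<close>

primrec szego :: "(nat \<Rightarrow> complex) \<Rightarrow> nat \<Rightarrow> complex poly" where
  "szego \<alpha> 0 = 1"
| "szego \<alpha> (Suc k) = pCons 0 (szego \<alpha> k) - Polynomial.smult (cnj (\<alpha> k)) (poly_star (szego \<alpha> k))"

declare szego.simps(2) [simp del]

lemma monic_szego_step:
  assumes "degree p = k" "lead_coeff p = 1"
  shows "degree (pCons 0 p - Polynomial.smult c (poly_star p)) = Suc k \<and>
         lead_coeff (pCons 0 p - Polynomial.smult c (poly_star p)) = 1"
proof -
  have p0: "p \<noteq> 0" using assms by auto
  have ds: "degree (Polynomial.smult c (poly_star p)) < Suc k"
    using degree_rev_poly[of k p] assms(1) degree_smult_le[of c "poly_star p"] by (simp add: poly_star_eq_rev_poly)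
  have dp: "degree (pCons 0 p) = Suc k" using p0 assms by simp
  have "degree (pCons 0 p - Polynomial.smult c (poly_star p)) = Suc k"
    using degree_add_eq_left[of "- Polynomial.smult c (poly_star p)" "pCons 0 p"] ds dp by simp
  moreover have "coeff (pCons 0 p - Polynomial.smult c (poly_star p)) (Suc k) = 1"
    using assms coeff_eq_0[OF ds] by simp
  ultimately show ?thesis by simp
qed

lemma degree_szego [simp]: "degree (szego \<alpha> k) = k"
  and lead_coeff_szego: "lead_coeff (szego \<alpha> k) = 1"
proof -
  have "degree (szego \<alpha> k) = k \<and> lead_coeff (szego \<alpha> k) = 1"
  proof (induction k)
    case (Suc k)
    then show ?case unfolding szego.simps by (intro monic_szego_step) auto
  qed simp
  then show "degree (szego \<alpha> k) = k" "lead_coeff (szego \<alpha> k) = 1" by auto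
qed

lemma coeff_szego_self [simp]: "coeff (szego \<alpha> k) k = 1"
  using lead_coeff_szego[of \<alpha> k] by simp

lemma szego_nonzero [simp]: "szego \<alpha> k \<noteq> 0"
  using lead_coeff_szego[of \<alpha> k] by (metis leading_coeff_0_iff zero_neq_one)

lemma szego_cong: "(\<And>j. j < k \<Longrightarrow> \<alpha> j = \<alpha>' j) \<Longrightarrow> szego \<alpha> k = szego \<alpha>' k"
  by (induction k) (auto simp: szego.simps(2))

lemma poly_star_szego_0 [simp]: "poly_star (szego \<alpha> 0) = 1"
  by (rule poly_eqI) (auto simp: coeff_poly_star)

text \<open>The recursion reversed at length \<open>Suc k\<close>: there z * Phi_k turns into
  Phi_k^*, Phi_k^* turns into z * Phi_k, and the scalar is conjugated.\<close>

lemma poly_star_szego_Suc: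
  "poly_star (szego \<alpha> (Suc k)) =
     poly_star (szego \<alpha> k) - Polynomial.smult (\<alpha> k) (pCons 0 (szego \<alpha> k))"
proof (rule poly_eqI)
  fix i
  have d: "degree (szego \<alpha> (Suc k)) = Suc k" by (rule degree_szego)
  have "coeff (poly_star (szego \<alpha> (Suc k))) i = (if i \<le> Suc k then
      cnj (coeff (pCons 0 (szego \<alpha> k)) (Suc k - i)) - \<alpha> k * cnj (coeff (poly_star (szego \<alpha> k)) (Suc k - i)) else 0)"
    unfolding coeff_poly_star[of "szego \<alpha> (Suc k)"] d by (simp add: szego.simps(2))
  also have "\<dots> = coeff (poly_star (szego \<alpha> k) - Polynomial.smult (\<alpha> k) (pCons 0 (szego \<alpha> k))) i"
  proof (cases "i \<le> Suc k")
    case True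
    show ?thesis
    proof (cases i)
      case 0
      then show ?thesis by (simp add: coeff_poly_star)
    next
      case (Suc j)
      then have "j \<le> k" using True by simp
      show ?thesis
      proof (cases "k - j")
        case 0
        then show ?thesis using Suc \<open>j \<le> k\<close> by (simp add: coeff_poly_star)
      next
        case (Suc m)
        then have "k - Suc m = j" "k - Suc j = m" "Suc m \<le> k" using \<open>j \<le> k\<close> by auto
        then show ?thesis using \<open>i = Suc j\<close> Suc \<open>j \<le> k\<close> by (simp add: coeff_poly_star)
      qed
    qed
  next
    case False
    then show ?thesis by (cases i) (auto simp: coeff_poly_star coeff_eq_0)
  qed
  finally show "coeff (poly_star (szego \<alpha> (Suc k))) i =
    coeff (poly_star (szego \<alpha> k) - Polynomial.smult (\<alpha> k) (pCons 0 (szego \<alpha> k))) i" .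
qed

lemma poly_szego_Suc:
  "poly (szego \<alpha> (Suc k)) z = z * poly (szego \<alpha> k) z - cnj (\<alpha> k) * poly (poly_star (szego \<alpha> k)) z"
  by (simp add: szego.simps(2))

lemma poly_poly_star_szego_Suc:
  "poly (poly_star (szego \<alpha> (Suc k))) z =
     poly (poly_star (szego \<alpha> k)) z - \<alpha> k * z * poly (szego \<alpha> k) z"
  unfolding poly_star_szego_Suc by simp

lemma poly_poly_star_0: "poly (poly_star (szego \<alpha> k)) 0 = 1"
  by (simp add: poly_0_coeff_0 coeff_poly_star)

text \<open>The disc automorphism w -> (w - cnj a) / (1 - a w) maps the closed disc into itself. The
  form without a quotient covers |a| = |w| = 1, where the denominator may vanish.\<close>

lemma cmod_diff_le_blaschke:
  assumes "cmod w \<le> 1" "cmod a \<le> 1"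
  shows "cmod (w - cnj a) \<le> cmod (1 - a * w)"
proof -
  have eq: "(cmod (1 - a * w))\<^sup>2 - (cmod (w - cnj a))\<^sup>2 = (1 - (cmod a)\<^sup>2) * (1 - (cmod w)\<^sup>2)"
    unfolding cmod_power2
    by (simp only: minus_complex.simps times_complex.simps complex_cnj one_complex.simps cnj.simps)
      (simp add: power2_eq_square algebra_simps)
  have "0 \<le> (1 - (cmod a)\<^sup>2) * (1 - (cmod w)\<^sup>2)"
    using assms by (intro mult_nonneg_nonneg) (auto simp: power_le_one)
  then have "(cmod (w - cnj a))\<^sup>2 \<le> (cmod (1 - a * w))\<^sup>2" unfolding eq[symmetric] by simp
  then show ?thesis by (rule power2_le_imp_le) simp
qed

text \<open>The two claims support each other in the induction: they put w = z Phi_k / Phi_k^* in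
  the closed disc, and one recursion step multiplies Phi_k^* by w - cnj alpha_k and by 1 - alpha_k w
  respectively.\<close>

lemma szego_star_bounds:
  assumes "\<And>j. j < k \<Longrightarrow> cmod (\<alpha> j) < 1" "cmod z \<le> 1"
  shows "poly (poly_star (szego \<alpha> k)) z \<noteq> 0 \<and>
         cmod (poly (szego \<alpha> k) z) \<le> cmod (poly (poly_star (szego \<alpha> k)) z)"
  using assms(1)
proof (induction k)
  case 0
  then show ?case using poly_star_szego_0 by simp
next
  case (Suc k)
  let ?P = "poly (szego \<alpha> k) z" and ?S = "poly (poly_star (szego \<alpha> k)) z"
  have IH: "?S \<noteq> 0" "cmod ?P \<le> cmod ?S" using Suc by auto
  have a: "cmod (\<alpha> k) < 1" using Suc.prems by simp
  define w where "w = z * ?P / ?S"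
  have w: "cmod w \<le> 1"
    using IH assms(2) mult_mono[of "cmod z" 1 "cmod ?P" "cmod ?S"]
    by (simp add: w_def norm_mult norm_divide divide_simps)
  have zP: "z * ?P = w * ?S" using IH by (simp add: w_def)
  have 1: "poly (szego \<alpha> (Suc k)) z = ?S * (w - cnj (\<alpha> k))"
    unfolding poly_szego_Suc zP by (simp add: algebra_simps)
  have "poly (poly_star (szego \<alpha> (Suc k))) z = ?S - \<alpha> k * (z * ?P)"
    unfolding poly_poly_star_szego_Suc by simp
  also have "\<dots> = ?S * (1 - \<alpha> k * w)" unfolding zP by (simp add: algebra_simps)
  finally have 2: "poly (poly_star (szego \<alpha> (Suc k))) z = ?S * (1 - \<alpha> k * w)" .
  have "cmod (\<alpha> k * w) < 1"
    using a w mult_mono[of "cmod (\<alpha> k)" "cmod (\<alpha> k)" "cmod w" 1] by (simp add: norm_mult)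
  then have "1 - \<alpha> k * w \<noteq> 0" by auto
  moreover have "cmod (w - cnj (\<alpha> k)) \<le> cmod (1 - \<alpha> k * w)"
    using cmod_diff_le_blaschke w a by simp
  ultimately show ?case unfolding 1 2 using IH(1) by (simp add: norm_mult mult_left_mono)
qed

definition blaschke :: "(nat \<Rightarrow> complex) \<Rightarrow> nat \<Rightarrow> complex \<Rightarrow> complex" where
  "blaschke \<alpha> k z = poly (szego \<alpha> k) z / poly (poly_star (szego \<alpha> k)) z"

lemma blaschke_le_1:
  assumes "\<And>j. j < k \<Longrightarrow> cmod (\<alpha> j) < 1" "cmod z \<le> 1"
  shows "cmod (blaschke \<alpha> k z) \<le> 1"
  using szego_star_bounds[OF assms] by (simp add: blaschke_def norm_divide)

text \<open>Each factor is 1 minus a point of the closed disc, hence has a principal logarithm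
  unless it is 0. The strict bound stops at \<open>k - 1\<close> because the last factor only
  divides by Phi_{k-1}^*; thus alpha_{n-1} on the circle is allowed when
  \<open>k = n\<close>.\<close>

lemma poly_star_szego_prod:
  assumes "\<And>j. j < k - 1 \<Longrightarrow> cmod (\<alpha> j) < 1" "cmod z \<le> 1"
  shows "poly (poly_star (szego \<alpha> k)) z = (\<Prod>j<k. 1 - \<alpha> j * z * blaschke \<alpha> j z)"
  using assms(1)
proof (induction k)
  case (Suc k)
  have "poly (poly_star (szego \<alpha> k)) z \<noteq> 0" using szego_star_bounds[of k \<alpha> z, OF _ assms(2)] Suc.prems by simp
  then have "poly (poly_star (szego \<alpha> (Suc k))) z =
      poly (poly_star (szego \<alpha> k)) z * (1 - \<alpha> k * z * blaschke \<alpha> k z)"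
    unfolding poly_poly_star_szego_Suc blaschke_def by (simp add: right_diff_distrib)
  moreover have "poly (poly_star (szego \<alpha> k)) z = (\<Prod>j<k. 1 - \<alpha> j * z * blaschke \<alpha> j z)"
    by (rule Suc.IH) (simp add: Suc.prems)
  ultimately show ?case by simp
qed (use poly_star_szego_0 in simp)

section \<open>Deformed coefficients of a sequence\<close>

definition deformed :: "(nat \<Rightarrow> complex) \<Rightarrow> nat \<Rightarrow> complex" where
  "deformed \<alpha> k = 1 - poly (szego \<alpha> (Suc k)) 1 / poly (szego \<alpha> k) 1"

lemma poly_star_at_1: "poly (poly_star p) 1 = cnj (poly p 1)"
  using poly_star_on_circle[of 1 p] by simp

lemma deformed_eq:
  assumes "poly (szego \<alpha> k) 1 \<noteq> 0"
  shows "deformed \<alpha> k = cnj (\<alpha> k) * (cnj (poly (szego \<alpha> k) 1) / poly (szego \<alpha> k) 1)"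
  unfolding deformed_def poly_szego_Suc poly_star_at_1 using assms by (simp add: diff_divide_distrib)

lemma szego_at_1_nonzero:
  assumes "\<And>j. j < k \<Longrightarrow> cmod (\<alpha> j) < 1"
  shows "poly (szego \<alpha> k) 1 \<noteq> 0"
  using szego_star_bounds[of k \<alpha> 1, OF assms] by (simp add: poly_star_at_1)

text \<open>Identifies the factors of \<open>poly_star_szego_prod\<close> at \<open>z = 1\<close>,
  which is how the deformed coefficients enter the factorisation of Phi_n^*(1).\<close>

lemma cnj_deformed_eq_blaschke:
  assumes "poly (szego \<alpha> k) 1 \<noteq> 0"
  shows "cnj (deformed \<alpha> k) = \<alpha> k * blaschke \<alpha> k 1"
  using deformed_eq[OF assms] by (simp add: blaschke_def poly_star_at_1)

text \<open>The Phi_j are monic of degree j, hence a basis: subtracting the multiple of Phi_l that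
  matches the top coefficient lowers the degree. Used to extend linear identities from the Phi_j to
  all polynomials of degree below \<open>m\<close>.\<close>

lemma szego_induct [consumes 1, case_names zero add]:
  assumes "degree q < m"
    and "P 0" "\<And>q c j. j < m \<Longrightarrow> P q \<Longrightarrow> P (q + Polynomial.smult c (szego \<alpha> j))"
  shows "P q"
proof -
  have "P q" if "degree q < l" "l \<le> m" for l
    using that
  proof (induction l arbitrary: q)
    case (Suc l)
    let ?q = "q - Polynomial.smult (coeff q l) (szego \<alpha> l)"
    have "degree ?q \<le> l" using Suc.prems by (intro degree_diff_le) (auto intro: order.trans[OF degree_smult_le])
    moreover have "coeff ?q l = 0" by simp
    ultimately have "?q = 0 \<or> degree ?q < l" by (metis leading_coeff_0_iff le_neq_implies_less)
    then have "P ?q" using Suc assms(2) by auto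
    then have "P (?q + Polynomial.smult (coeff q l) (szego \<alpha> l))" using Suc.prems by (intro assms(3)) auto
    then show ?case by simp
  qed simp
  then show ?thesis using assms(1) by blast
qed

section \<open>Shift-invariant forms on polynomials\<close>

text \<open>
  The common abstraction of \<open>L\<^sup>2(\<mu>)\<close> for a measure with \<open>n\<close> atoms on the circle and of
  \<open>\<langle>p(A) e\<^sub>1, q(A) e\<^sub>1\<rangle>\<close> for a unitary matrix with cyclic vector \<open>e\<^sub>1\<close>: the Szego recursion uses
  nothing else, and it determines the form.
\<close>

locale circle_form =
  fixes n :: nat and F :: "complex poly \<Rightarrow> complex poly \<Rightarrow> complex"
  assumes form_add: "F p (q + r) = F p q + F p r"
    and form_smult: "F p (Polynomial.smult c q) = c * F p q"
    and form_cnj: "F q p = cnj (F p q)"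
    and form_shift: "F (pCons 0 p) (pCons 0 q) = F p q"
    and form_nonneg: "0 \<le> Re (F p p)"
    and form_nondegenerate: "degree p < n \<Longrightarrow> F p p = 0 \<Longrightarrow> p = 0"
    and form_degenerate: "\<exists>Q. degree Q = n \<and> lead_coeff Q = 1 \<and> F Q Q = 0"
    and form_one: "F 1 1 = 1"
begin

lemma form_add_left: "F (p + q) r = F p r + F q r"
  by (metis complex_cnj_add form_add form_cnj)

lemma form_smult_left: "F (Polynomial.smult c p) q = cnj c * F p q"
  by (metis complex_cnj_mult form_smult form_cnj)

lemma form_zero [simp]: "F p 0 = 0" "F 0 p = 0"
  using form_smult[of p 0 0] form_smult_left[of 0 0 p] by simp_all

lemma form_minus: "F p (- q) = - F p q" "F (- p) q = - F p q"
  using form_smult[of p "-1" q] form_smult_left[of "-1" p q] by simp_all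

lemma form_diff: "F p (q - r) = F p q - F p r" "F (p - q) r = F p r - F q r"
  using form_add[of p q "- r"] form_add_left[of p "- q" r] by (simp_all add: form_minus)

lemma form_sum: "F p (sum f A) = (\<Sum>i\<in>A. F p (f i))"
  by (induction A rule: infinite_finite_induct) (simp_all add: form_add)

lemma form_sum_left: "F (sum f A) p = (\<Sum>i\<in>A. F (f i) p)"
  by (induction A rule: infinite_finite_induct) (simp_all add: form_add_left)

lemma form_self_real: "F p p = of_real (Re (F p p))"
  using form_cnj[of p p] by (simp add: complex_eq_iff)

text \<open>The degenerate case of Cauchy-Schwarz: if the pairing were nonzero, adding a large
  multiple of the null vector \<open>p\<close> to \<open>q\<close> would make the form
  negative.\<close>

lemma form_null:
  assumes "F p p = 0"
  shows "F q p = 0"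
proof (rule ccontr)
  assume nz: "F q p \<noteq> 0"
  define N where "N = Re (F q q)"
  \<comment> \<open>With this scale the cross term is \<open>- (1 + N)\<close>, so the perturbed
    vector would have squared norm \<open>N - 2 * (1 + N) < 0\<close>.\<close>
  define t where "t = (1 + N) / (cmod (F q p))\<^sup>2"
  have N: "0 \<le> N" using form_nonneg by (simp add: N_def)
  define d where "d = - of_real t * cnj (F q p)"
  have "F (q + Polynomial.smult d p) (q + Polynomial.smult d p) = F q q + d * F q p + cnj (d * F q p)"
    using assms form_cnj[of p q] by (simp add: form_add form_add_left form_smult form_smult_left algebra_simps)
  moreover have "d * F q p = - of_real t * (F q p * cnj (F q p))" by (simp add: d_def)
  moreover have "\<dots> = - of_real (1 + N)"
    using nz unfolding complex_norm_square[symmetric] t_def by simp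
  ultimately have "F (q + Polynomial.smult d p) (q + Polynomial.smult d p) =
      F q q + - of_real (1 + N) + cnj (- of_real (1 + N))"
    by (simp only:)
  then have "Re (F (q + Polynomial.smult d p) (q + Polynomial.smult d p)) = N - 2 * (1 + N)"
    by (simp add: N_def)
  then show False using form_nonneg[of "q + Polynomial.smult d p"] N by simp
qed

lemma form_null_left: "F p p = 0 \<Longrightarrow> F p q = 0"
  using form_null[of p q] form_cnj[of p q] by simp

text \<open>Multiplication by z preserves the form, so null polynomials form an ideal. Applied to
  the multiples of \<open>mop n\<close>, this reduces computations to polynomials of degree below
  \<open>n\<close>.\<close>

lemma form_null_mult:
  assumes "F p p = 0"
  shows "F (q * p) (q * p) = 0"
proof (induction q)
  case (pCons c q)
  have "pCons c q * p = Polynomial.smult c p + pCons 0 (q * p)" by (simp add: mult_pCons_left)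
  moreover have "F (pCons 0 (q * p)) (pCons 0 (q * p)) = 0" using pCons form_shift by simp
  ultimately have "F u (pCons c q * p) = 0" for u
    using form_null[OF assms] form_null by (simp only: form_add form_smult mult_zero_right add_0)
  then show ?case .
qed simp

lemma monom_shift: "F (monom 1 (i + l)) (monom 1 (j + l)) = F (monom 1 i) (monom 1 j)"
  by (induction l) (simp_all add: monom_Suc form_shift)

lemma form_monoms:
  assumes "degree p \<le> k" "degree q \<le> k"
  shows "F p q = (\<Sum>i\<le>k. \<Sum>j\<le>k. cnj (coeff p i) * coeff q j * F (monom 1 i) (monom 1 j))"
proof -
  have e: "r = (\<Sum>i\<le>k. Polynomial.smult (coeff r i) (monom 1 i))" if "degree r \<le> k" for r :: "complex poly"
    using poly_as_sum_of_monoms'[OF that, symmetric] by (simp add: smult_monom)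
  have "F p q = F (\<Sum>i\<le>k. Polynomial.smult (coeff p i) (monom 1 i)) (\<Sum>i\<le>k. Polynomial.smult (coeff q i) (monom 1 i))"
    using e[OF assms(1)] e[OF assms(2)] by simp
  then show ?thesis
    by (simp add: form_sum form_sum_left form_smult form_smult_left sum_distrib_left mult.assoc mult.left_commute) 
      (subst sum.swap, simp add: mult.left_commute)
qed

text \<open>Reversal is antiunitary on polynomials of degree at most \<open>k\<close>. By
  \<open>monom_shift\<close> the Gram matrix of the monomials is Toeplitz, so reflecting both
  indices transposes it.\<close>

lemma form_rev_poly:
  assumes "degree p \<le> k" "degree q \<le> k"
  shows "F (rev_poly k p) (rev_poly k q) = F q p"
proof -
  have m: "F (monom 1 (k - i)) (monom 1 (k - j)) = F (monom 1 j) (monom 1 i)" if "i \<le> k" "j \<le> k" for i j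
  proof (cases "i \<le> j")
    case True
    then show ?thesis using that monom_shift[of "j - i" "k - j" 0] monom_shift[of "j - i" i 0] by simp
  next
    case False
    then show ?thesis using that monom_shift[of 0 "k - i" "i - j"] monom_shift[of 0 j "i - j"] by simp
  qed
  have "F (rev_poly k p) (rev_poly k q) =
     (\<Sum>i\<le>k. \<Sum>j\<le>k. coeff p (k - i) * cnj (coeff q (k - j)) * F (monom 1 i) (monom 1 j))"
    using form_monoms[OF degree_rev_poly degree_rev_poly] by (simp add: coeff_rev_poly)
  also have "\<dots> = (\<Sum>i\<le>k. \<Sum>j\<le>k. coeff p i * cnj (coeff q j) * F (monom 1 (k - i)) (monom 1 (k - j)))"
    by (rule sum.reindex_bij_witness[of _ "\<lambda>i. k - i" "\<lambda>i. k - i"])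
      (auto intro!: sum.reindex_bij_witness[of _ "\<lambda>i. k - i" "\<lambda>i. k - i"])
  also have "\<dots> = (\<Sum>i\<le>k. \<Sum>j\<le>k. coeff p i * cnj (coeff q j) * F (monom 1 j) (monom 1 i))"
    using m by (intro sum.cong refl) auto
  also have "\<dots> = F q p"
    using form_monoms[OF assms(2,1)] by (subst sum.swap) (simp add: mult.commute)
  finally show ?thesis .
qed

text \<open>The scalar is the one that makes \<open>mop (Suc k)\<close> orthogonal to 1, since 1
  paired with Phi_k^* gives the squared norm of Phi_k. Starting from the recursion instead of
  Gram-Schmidt makes \<open>mop_eq_szego\<close> immediate and leaves orthogonality as the thing to
  prove.\<close>

primrec mop :: "nat \<Rightarrow> complex poly" where
  "mop 0 = 1"
| "mop (Suc k) = pCons 0 (mop k) -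
     Polynomial.smult (F 1 (pCons 0 (mop k)) / F (mop k) (mop k)) (poly_star (mop k))"

definition alph :: "nat \<Rightarrow> complex" where
  "alph k = cnj (F 1 (pCons 0 (mop k)) / F (mop k) (mop k))"

lemma mop_eq_szego: "mop k = szego alph k"
  by (induction k) (simp_all add: alph_def szego.simps(2))

declare mop.simps(2) [simp del]

lemma degree_mop [simp]: "degree (mop k) = k" and lead_coeff_mop [simp]: "coeff (mop k) k = 1"
  by (simp_all add: mop_eq_szego)

lemma degree_monic_diff:
  assumes "degree p = k" "coeff p k = 1" "degree q = k" "coeff q k = (1::complex)"
  shows "p - q = 0 \<or> degree (p - q) < k"
proof -
  have "degree (p - q) \<le> k" using assms by (intro degree_diff_le) auto
  moreover have "coeff (p - q) k = 0" using assms by simp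
  ultimately show ?thesis by (metis leading_coeff_0_iff le_neq_implies_less)
qed

text \<open>Write q = c + z q'. Against z q' both terms of the recursion vanish separately: z Phi_k
  by shift invariance, Phi_k^* because reversal moves the pairing onto Phi_k and a polynomial of
  degree below k. Against 1 they cancel by the choice of the scalar.\<close>

lemma form_orth:
  assumes "k \<le> n" "degree q < k"
  shows "F q (mop k) = 0"
  using assms
proof (induction k arbitrary: q)
  case (Suc k)
  have k: "k < n" using Suc.prems by simp
  have "mop k \<noteq> 0" using lead_coeff_mop[of k] by (metis coeff_0 zero_neq_one)
  then have N: "F (mop k) (mop k) \<noteq> 0" using form_nondegenerate[of "mop k"] k by auto
  have st: "poly_star (mop k) = rev_poly k (mop k)" by (simp add: poly_star_eq_rev_poly)
  obtain c q' where q: "q = pCons c q'" by (cases q)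
  have q': "q' = 0 \<or> degree q' < k"
    using Suc.prems q by (cases "q' = 0") auto
  have a: "F q' (mop k) = 0" using q' Suc.IH k by auto
  have deg: "degree (pCons 0 q') \<le> k" using q' by auto
  \<comment> \<open>The zero constant term of \<open>pCons 0 q'\<close> becomes the coefficient of
    z^k after reversal, so the degree drops below \<open>k\<close> and the induction hypothesis
    applies.\<close>
  have "coeff (rev_poly k (pCons 0 q')) k = 0" by (simp add: coeff_rev_poly)
  then have "rev_poly k (pCons 0 q') = 0 \<or> degree (rev_poly k (pCons 0 q')) < k"
    using degree_rev_poly[of k "pCons 0 q'"] by (metis leading_coeff_0_iff le_neq_implies_less)
  then have "F (rev_poly k (pCons 0 q')) (mop k) = 0" using Suc.IH k by auto
  moreover have "F (pCons 0 q') (rev_poly k (mop k)) = F (mop k) (rev_poly k (pCons 0 q'))"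
    using form_rev_poly[of "rev_poly k (pCons 0 q')" k "mop k"] deg
    by (simp add: degree_rev_poly rev_poly_rev_poly)
  ultimately have b: "F (pCons 0 q') (rev_poly k (mop k)) = 0"
    using form_cnj by (metis complex_cnj_zero)
  \<comment> \<open>Since 1 is the reversal of z^k, pairing 1 with Phi_k^* is pairing Phi_k with
    z^k; and z^k - Phi_k has degree below k, so only the squared norm of Phi_k survives.\<close>
  have "rev_poly k (monom 1 k) = 1"
    by (rule poly_eqI) (auto simp: coeff_rev_poly)
  then have "F 1 (rev_poly k (mop k)) = F (mop k) (monom 1 k)"
    using form_rev_poly[of "monom 1 k" k "mop k"] by (simp add: degree_monom_eq)
  also have "\<dots> = F (mop k) (mop k) + F (mop k) (monom 1 k - mop k)"
    by (simp add: form_diff)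
  also have "F (mop k) (monom 1 k - mop k) = 0"
  proof -
    have "monom 1 k - mop k = 0 \<or> degree (monom 1 k - mop k) < k"
      by (rule degree_monic_diff) (simp_all add: degree_monom_eq)
    then have "F (monom 1 k - mop k) (mop k) = 0" using Suc.IH k by auto
    then show ?thesis using form_cnj by (metis complex_cnj_zero)
  qed
  finally have d: "F 1 (rev_poly k (mop k)) = F (mop k) (mop k)" by simp
  have "q = Polynomial.smult c 1 + pCons 0 q'" by (simp add: q)
  then have "F q (mop (Suc k)) = cnj c * F 1 (mop (Suc k)) + F (pCons 0 q') (mop (Suc k))"
    by (simp only: form_add_left form_smult_left)
  also have "F 1 (mop (Suc k)) = 0"
    using N d by (simp add: mop.simps(2) st form_diff form_smult)
  also have "F (pCons 0 q') (mop (Suc k)) = 0"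
    using a b by (simp add: mop.simps(2) st form_diff form_smult form_shift)
  finally show ?case by simp
qed simp

lemma form_orth':
  assumes "k \<le> n" "degree q < k"
  shows "F (mop k) q = 0"
  using form_orth[OF assms] form_cnj by (metis complex_cnj_zero)

lemma mop_unique:
  assumes "k \<le> n" "degree p = k" "coeff p k = 1" "\<And>q. degree q < k \<Longrightarrow> F q p = 0" "k < n"
  shows "p = mop k"
proof -
  have d: "p - mop k = 0 \<or> degree (p - mop k) < k"
    by (rule degree_monic_diff) (use assms in simp_all)
  then have "F (p - mop k) (p - mop k) = 0"
    using form_orth[OF assms(1)] assms(4) by (auto simp: form_diff(1))
  then show ?thesis using form_nondegenerate[of "p - mop k"] d assms(5) by auto
qed

section \<open>Squared norms and the moduli of the coefficients\<close>

definition mnorm :: "nat \<Rightarrow> real" where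
  "mnorm k = Re (F (mop k) (mop k))"

lemma form_mop_self: "F (mop k) (mop k) = of_real (mnorm k)"
  unfolding mnorm_def by (rule form_self_real)

lemma mnorm_pos: "k < n \<Longrightarrow> 0 < mnorm k"
proof -
  assume k: "k < n"
  have "mop k \<noteq> 0" using lead_coeff_mop[of k] by (metis coeff_0 zero_neq_one)
  then have "F (mop k) (mop k) \<noteq> 0" using form_nondegenerate[of "mop k"] k by auto
  then have "mnorm k \<noteq> 0" by (simp add: form_mop_self)
  then show ?thesis using form_nonneg[of "mop k"] by (simp add: mnorm_def)
qed

lemma form_mop: "\<lbrakk>i \<le> n; j \<le> n\<rbrakk> \<Longrightarrow> F (mop i) (mop j) = (if i = j then of_real (mnorm i) else 0)"
  using form_orth[of j "mop i"] form_orth'[of i "mop j"] form_mop_self[of i] by (cases i j rule: linorder_cases) auto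

text \<open>A monic null polynomial of degree \<open>n\<close> differs from \<open>mop n\<close> by
  a polynomial of lower degree, to which \<open>mop n\<close> is orthogonal; so the squared norm of
  \<open>mop n\<close> equals its pairing with a null vector.\<close>

lemma mnorm_n: "mnorm n = 0"
proof -
  obtain Q where Q: "degree Q = n" "coeff Q n = 1" "F Q Q = 0" using form_degenerate by auto
  have "Q - mop n = 0 \<or> degree (Q - mop n) < n"
    by (rule degree_monic_diff) (use Q in simp_all)
  then have "F (mop n) (Q - mop n) = 0" using form_orth'[of n] by auto
  then have "F (mop n) Q = F (mop n) (mop n)" by (simp add: form_diff)
  then show ?thesis using form_null[OF Q(3), of "mop n"] by (simp add: mnorm_def)
qed

lemma form_mop_n: "F p (mop n) = 0" "F (mop n) p = 0"
  using form_null[of "mop n"] form_null_left[of "mop n"] mnorm_n form_mop_self[of n] by simp_all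

text \<open>Pythagoras for z Phi_k = Phi_{k+1} + cnj alpha_k * Phi_k^*: the summands are orthogonal,
  and both z Phi_k and Phi_k^* have the norm of Phi_k.\<close>

lemma mnorm_Suc:
  assumes "k < n"
  shows "mnorm (Suc k) = (1 - (cmod (alph k))\<^sup>2) * mnorm k"
proof -
  let ?S = "poly_star (mop k)" and ?c = "cnj (alph k)"
  have st: "?S = rev_poly k (mop k)" by (simp add: poly_star_eq_rev_poly)
  have z: "pCons 0 (mop k) = mop (Suc k) + Polynomial.smult ?c ?S"
    by (simp add: mop.simps(2) alph_def)
  have S: "F ?S ?S = F (mop k) (mop k)" using form_rev_poly[of "mop k" k "mop k"] st by simp
  have "degree ?S < Suc k" using degree_rev_poly[of k "mop k"] st by simp
  then have o: "F ?S (mop (Suc k)) = 0" "F (mop (Suc k)) ?S = 0"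
    using form_orth[of "Suc k" ?S] form_orth'[of "Suc k" ?S] assms by simp_all
  have "F (mop k) (mop k) = F (pCons 0 (mop k)) (pCons 0 (mop k))" by (rule form_shift[symmetric])
  also have "\<dots> = F (mop (Suc k)) (mop (Suc k)) + (alph k * cnj (alph k)) * F (mop k) (mop k)"
    unfolding z using o S by (simp add: form_add form_add_left form_smult form_smult_left)
  finally have "complex_of_real (mnorm k) = of_real (mnorm (Suc k) + (cmod (alph k))\<^sup>2 * mnorm k)"
    unfolding form_mop_self complex_norm_square[symmetric] by simp
  then have "mnorm k = mnorm (Suc k) + (cmod (alph k))\<^sup>2 * mnorm k" unfolding of_real_eq_iff .
  then show ?thesis by (simp add: algebra_simps)
qed

lemma alph_less_1: "k < n - 1 \<Longrightarrow> cmod (alph k) < 1"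
proof -
  assume k: "k < n - 1"
  then have "0 < (1 - (cmod (alph k))\<^sup>2) * mnorm k"
    using mnorm_Suc[of k] mnorm_pos[of "Suc k"] by simp
  moreover have "0 < mnorm k" using mnorm_pos k by simp
  ultimately have "(cmod (alph k))\<^sup>2 < 1" by (simp add: zero_less_mult_iff)
  then show ?thesis by (simp add: power2_less_1_iff abs_square_less_1)
qed

lemma n_pos: "0 < n"
proof (rule ccontr)
  assume "\<not> 0 < n"
  then have "mop n = 1" by simp
  then show False using mnorm_n form_one by (simp add: mnorm_def)
qed

lemma alph_last: "cmod (alph (n - 1)) = 1"
proof -
  have "(1 - (cmod (alph (n - 1)))\<^sup>2) * mnorm (n - 1) = 0"
    using mnorm_Suc[of "n - 1"] mnorm_n n_pos by simp
  then have "(cmod (alph (n - 1)))\<^sup>2 = 1" using mnorm_pos[of "n - 1"] n_pos by simp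
  then show ?thesis by (simp add: power2_eq_1_iff) (smt (verit) norm_ge_zero)
qed

section \<open>Orthonormal expansion\<close>

definition onp :: "nat \<Rightarrow> complex poly" where
  "onp k = Polynomial.smult (of_real (1 / sqrt (mnorm k))) (mop k)"

lemma degree_onp [simp]: "k < n \<Longrightarrow> degree (onp k) = k"
  using mnorm_pos[of k] by (simp add: onp_def)

lemma form_onp: "\<lbrakk>i < n; j < n\<rbrakk> \<Longrightarrow> F (onp i) (onp j) = (if i = j then 1 else 0)"
  using mnorm_pos[of i] by (auto simp: onp_def form_smult form_smult_left form_mop simp flip: of_real_mult)

text \<open>On all polynomials the form is degenerate, so the remainder of the expansion is null
  rather than zero. It is orthogonal to every polynomial of degree below \<open>n\<close>, and
  division by the null polynomial \<open>mop n\<close> extends this to all degrees.\<close>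

lemma form_expansion:
  fixes p :: "complex poly"
  defines "r \<equiv> p - (\<Sum>k<n. Polynomial.smult (F (onp k) p) (onp k))"
  shows "F r r = 0"
proof -
  have orth: "F (onp j) r = 0" if "j < n" for j
    using that by (simp add: r_def form_diff form_sum form_smult form_onp if_distrib[of "\<lambda>x. _ * x"] cong: if_cong)
  have low: "F q r = 0" if "degree q < n" for q
    using that
  proof (induction q rule: szego_induct[where \<alpha> = alph])
    case (add q c j)
    then have "F (szego alph j) r = 0"
      using orth[of j] mnorm_pos[of j] by (simp add: onp_def form_smult_left mop_eq_szego)
    then show ?case using add by (simp add: form_add_left form_smult_left)
  qed simp
  have "F p r = F (p mod mop n) r + F (p div mop n * mop n) r"
    by (metis form_add_left add.commute div_mult_mod_eq)
  also have "F (p div mop n * mop n) r = 0"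
    by (rule form_null_left, rule form_null_mult) (simp add: form_mop_n)
  also have "F (p mod mop n) r = 0"
    using low[of "p mod mop n"] degree_mod_less[of "mop n" p] n_pos lead_coeff_mop[of n]
    by (metis coeff_0 degree_0 degree_mop zero_neq_one)
  finally have "F p r = 0" by simp
  moreover have "F r r = F p r - (\<Sum>k<n. cnj (F (onp k) p) * F (onp k) r)"
    by (subst (1) r_def) (simp add: form_diff(2) form_sum_left form_smult_left)
  ultimately show ?thesis by (simp add: orth)
qed

lemma form_expand: "F q p = (\<Sum>k<n. F (onp k) p * F q (onp k))"
  using form_null[OF form_expansion[of p], of q] by (simp add: form_diff form_sum form_smult)

text \<open>The null remainder stays null after multiplication by z, so the expansion may be taken
  inside the shift. This is what makes the matrix of multiplication by z act correctly on
  coordinates.\<close>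

lemma form_expand_shift: "F q (pCons 0 p) = (\<Sum>k<n. F (onp k) p * F q (pCons 0 (onp k)))"
proof -
  let ?r = "p - (\<Sum>k<n. Polynomial.smult (F (onp k) p) (onp k))"
  have pc: "pCons 0 (a + b) = pCons 0 a + pCons 0 b" "pCons 0 (a - b) = pCons 0 a - pCons 0 b"
    "pCons 0 (Polynomial.smult c a) = Polynomial.smult c (pCons 0 a)" for a b :: "complex poly" and c
    by simp_all
  have ps: "pCons 0 (\<Sum>k<m. f k) = (\<Sum>k<m. pCons 0 (f k))" for m and f :: "nat \<Rightarrow> complex poly"
    by (induction m) (simp_all add: pc(1))
  have "F (pCons 0 ?r) (pCons 0 ?r) = 0" using form_expansion[of p] form_shift by simp
  then have "F q (pCons 0 ?r) = 0" by (rule form_null)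
  moreover have "pCons 0 ?r = pCons 0 p - (\<Sum>k<n. Polynomial.smult (F (onp k) p) (pCons 0 (onp k)))"
    unfolding pc(2) ps pc(3) ..
  ultimately show ?thesis by (simp only: form_diff form_sum form_smult eq_iff_diff_eq_0[symmetric])
qed

end

text \<open>The uniqueness half of Verblunsky's theorem. The coefficients give \<open>mop k\<close>
  for all \<open>k \<le> n\<close>, orthogonality to 1 gives the pairing of 1 with degrees below
  \<open>n\<close>, division by the null polynomial \<open>mop n\<close> gives all moments, and the
  Toeplitz property gives the form.\<close>

lemma circle_form_determined:
  assumes F: "circle_form n F" and G: "circle_form n G"
    and eq: "\<And>k. k < n \<Longrightarrow> circle_form.alph F k = circle_form.alph G k"
  shows "F p q = G p q"
proof -
  interpret F: circle_form n F by fact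
  interpret G: circle_form n G by fact
  have P: "F.mop k = G.mop k" if "k \<le> n" for k
    unfolding F.mop_eq_szego G.mop_eq_szego using that eq by (intro szego_cong) simp
  have low: "F 1 r = G 1 r" if "degree r < n" for r
    using that
  proof (induction r rule: szego_induct[where \<alpha> = F.alph])
    case (add r c j)
    have "F 1 (F.mop j) = G 1 (F.mop j)"
      using F.form_orth[of j 1] G.form_orth[of j 1] F.form_one G.form_one P[of j] add.hyps
      by (cases j) simp_all
    then show ?case
      using add by (simp add: F.form_add G.form_add F.form_smult G.form_smult flip: F.mop_eq_szego)
  qed simp
  have one: "F 1 r = G 1 r" for r
  proof -
    have r: "r = r div F.mop n * F.mop n + r mod F.mop n" by (rule div_mult_mod_eq[symmetric])
    have "F 1 (r div F.mop n * F.mop n) = 0"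
      by (rule F.form_null, rule F.form_null_mult) (simp add: F.form_mop_n)
    moreover have "G 1 (r div F.mop n * F.mop n) = 0"
      by (rule G.form_null, rule G.form_null_mult) (simp add: P G.form_mop_n)
    moreover have "degree (r mod F.mop n) < n"
      using degree_mod_less[of "F.mop n" r] F.n_pos F.lead_coeff_mop[of n]
      by (metis coeff_0 degree_0 F.degree_mop zero_neq_one)
    ultimately show ?thesis using low[of "r mod F.mop n"] F.form_add[of 1] G.form_add[of 1] r by (metis add_0)
  qed
  have mon: "F (monom 1 i) (monom 1 j) = G (monom 1 i) (monom 1 j)" for i j
  proof (cases "i \<le> j")
    case True
    then show ?thesis using F.monom_shift[of 0 i "j - i"] G.monom_shift[of 0 i "j - i"] one by simp
  next
    case False
    then have "F (monom 1 j) (monom 1 i) = G (monom 1 j) (monom 1 i)"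
      using F.monom_shift[of 0 j "i - j"] G.monom_shift[of 0 j "i - j"] one by simp
    then show ?thesis using F.form_cnj[of "monom 1 i" "monom 1 j"] G.form_cnj[of "monom 1 i" "monom 1 j"] by simp
  qed
  show ?thesis
    using F.form_monoms[of p "max (degree p) (degree q)" q] G.form_monoms[of p "max (degree p) (degree q)" q] mon by simp
qed

section \<open>Measures with finitely many atoms\<close>

definition mform :: "complex measure \<Rightarrow> complex poly \<Rightarrow> complex poly \<Rightarrow> complex" where
  "mform \<mu> p q = (LINT z|\<mu>. cnj (poly p z) * poly q z)"

lemma borel_measurable_poly [measurable]: "poly (p :: complex poly) \<in> borel_measurable borel"
  by (intro borel_measurable_continuous_onI continuous_intros)

text \<open>\<open>S\<close> only has to carry the mass, and points of weight zero are allowed: two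
  measures can thus be compared on one set before their atoms are known to coincide.\<close>

locale finite_supp_measure = prob_space \<mu> for \<mu> :: "complex measure" +
  fixes S :: "complex set"
  assumes sets_borel [measurable_cong]: "sets \<mu> = sets borel"
    and finite_S: "finite S"
    and measure_S: "measure \<mu> S = 1"
begin

lemma sets_S [measurable]: "S \<in> sets borel" "{z} \<in> sets \<mu>" "A \<subseteq> S \<Longrightarrow> A \<in> sets \<mu>"
proof -
  have fin: "A \<in> sets borel" if "finite A" for A :: "complex set"
    using that by (intro borel_closed finite_imp_closed)
  show "S \<in> sets borel" using finite_S by (rule fin)
  show "{z} \<in> sets \<mu>" by (simp add: sets_borel)
  show "A \<subseteq> S \<Longrightarrow> A \<in> sets \<mu>" using finite_S finite_subset fin by (auto simp: sets_borel)
qed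

lemma AE_S: "AE z in \<mu>. z \<in> S"
  by (rule AE_prob_1) (rule measure_S)

lemma integral_finite_supp:
  fixes f :: "complex \<Rightarrow> complex"
  assumes [measurable]: "f \<in> borel_measurable borel"
  shows "integrable \<mu> f" "(LINT z|\<mu>. f z) = (\<Sum>\<zeta>\<in>S. of_real (measure \<mu> {\<zeta>}) * f \<zeta>)"
proof -
  let ?g = "\<lambda>z. \<Sum>\<zeta>\<in>S. indicator {\<zeta>} z *\<^sub>R f \<zeta>"
  have fm: "f \<in> borel_measurable \<mu>" by measurable
  have gi: "integrable \<mu> ?g"
    by (intro Bochner_Integration.integrable_sum integrable_scaleR_left integrable_real_indicator)
      (auto simp: sets_S emeasure_eq_measure)
  have ae: "AE z in \<mu>. f z = ?g z"
    using AE_S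
  proof eventually_elim
    case (elim z)
    have "?g z = (\<Sum>\<zeta>\<in>S. if \<zeta> = z then f z else 0)"
      by (intro sum.cong) (auto simp: indicator_def)
    then show ?case using elim finite_S by simp
  qed
  show "integrable \<mu> f"
    using gi integrable_cong_AE[OF fm borel_measurable_integrable[OF gi] ae] by simp
  have "(LINT z|\<mu>. f z) = (LINT z|\<mu>. ?g z)"
    by (rule integral_cong_AE[OF fm borel_measurable_integrable[OF gi] ae])
  also have "\<dots> = (\<Sum>\<zeta>\<in>S. LINT z|\<mu>. indicator {\<zeta>} z *\<^sub>R f \<zeta>)"
    by (intro Bochner_Integration.integral_sum integrable_scaleR_left integrable_real_indicator)
      (auto simp: sets_S emeasure_eq_measure)
  also have "\<dots> = (\<Sum>\<zeta>\<in>S. of_real (measure \<mu> {\<zeta>}) * f \<zeta>)"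
    using sets_borel by (intro sum.cong refl) (simp add: scaleR_conv_of_real sets_eq_imp_space_eq)
  finally show "(LINT z|\<mu>. f z) = (\<Sum>\<zeta>\<in>S. of_real (measure \<mu> {\<zeta>}) * f \<zeta>)" .
qed

lemma mform_eq: "mform \<mu> p q = (\<Sum>\<zeta>\<in>S. of_real (measure \<mu> {\<zeta>}) * (cnj (poly p \<zeta>) * poly q \<zeta>))"
  unfolding mform_def
  by (rule integral_finite_supp) (intro borel_measurable_continuous_onI continuous_intros)

lemma emeasure_finite_supp:
  assumes [measurable]: "A \<in> sets borel"
  shows "emeasure \<mu> A = (\<Sum>\<zeta>\<in>S \<inter> A. ennreal (measure \<mu> {\<zeta>}))"
proof -
  have "emeasure \<mu> A = emeasure \<mu> (S \<inter> A)"
    using AE_S by (intro emeasure_eq_AE) (auto simp: sets_borel)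
  also have "\<dots> = (\<Sum>\<zeta>\<in>S \<inter> A. emeasure \<mu> {\<zeta>})"
    using finite_S by (intro emeasure_eq_sum_singleton) (auto simp: sets_S)
  finally show ?thesis by (simp add: emeasure_eq_measure)
qed

end

lemma finite_supp_measure_eqI:
  assumes "finite_supp_measure \<mu> S" "finite_supp_measure \<nu> S"
    and eq: "\<And>p. (LINT z|\<mu>. poly p z) = (LINT z|\<nu>. poly p z)"
  shows "\<mu> = \<nu>"
proof -
  interpret M: finite_supp_measure \<mu> S by fact
  interpret N: finite_supp_measure \<nu> S by fact
  have w: "measure \<mu> {\<zeta>} = measure \<nu> {\<zeta>}" if "\<zeta> \<in> S" for \<zeta>
  proof -
    \<comment> \<open>An unnormalised Lagrange polynomial: vanishing at the other points of
      \<open>S\<close>, it isolates the weight at \<open>\<zeta>\<close> in the integral.\<close>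
    define L where "L = (\<Prod>\<xi>\<in>S - {\<zeta>}. [:- \<xi>, 1:])"
    have L0: "poly L \<xi> = 0" if "\<xi> \<in> S" "\<xi> \<noteq> \<zeta>" for \<xi>
      using that M.finite_S by (auto simp: L_def poly_prod)
    have L1: "poly L \<zeta> \<noteq> 0" using M.finite_S by (auto simp: L_def poly_prod)
    have "(LINT z|\<mu>. poly L z) = of_real (measure \<mu> {\<zeta>}) * poly L \<zeta>"
      using that M.finite_S L0 by (subst M.integral_finite_supp(2)) (auto simp: sum.remove[where x = \<zeta>])
    moreover have "(LINT z|\<nu>. poly L z) = of_real (measure \<nu> {\<zeta>}) * poly L \<zeta>"
      using that M.finite_S L0 by (subst N.integral_finite_supp(2)) (auto simp: sum.remove[where x = \<zeta>])
    ultimately show ?thesis using eq[of L] L1 by simp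
  qed
  show ?thesis
  proof (rule measure_eqI)
    fix A assume "A \<in> sets \<mu>"
    then have "A \<in> sets borel" by (simp add: M.sets_borel)
    then show "emeasure \<mu> A = emeasure \<nu> A"
      using w by (simp add: M.emeasure_finite_supp N.emeasure_finite_supp)
  qed (simp add: M.sets_borel N.sets_borel)
qed

lemma circle_measure_pts_finite_supp:
  "circle_measure_pts n \<mu> \<Longrightarrow> finite_supp_measure \<mu> (atoms \<mu>)"
  unfolding circle_measure_pts_def finite_supp_measure_def finite_supp_measure_axioms_def by simp

section \<open>Nodal polynomials and the form of a measure\<close>

lemma poly_eq_0_of_card_roots:
  fixes p :: "complex poly"
  assumes "degree p < card S" "\<And>z. z \<in> S \<Longrightarrow> poly p z = 0"
  shows "p = 0"
proof (rule ccontr)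
  assume "p \<noteq> 0"
  then have "finite {z. poly p z = 0}" "card {z. poly p z = 0} \<le> degree p"
    by (simp_all add: poly_roots_finite card_poly_roots_bound)
  moreover have "card S \<le> card {z. poly p z = 0}"
    using assms(2) by (intro card_mono) (auto simp: poly_roots_finite \<open>p \<noteq> 0\<close>)
  ultimately show False using assms(1) by simp
qed

lemma prod_linear_monic:
  fixes S :: "complex set"
  shows "degree (\<Prod>\<zeta>\<in>S. [:- \<zeta>, 1:]) = card S" "coeff (\<Prod>\<zeta>\<in>S. [:- \<zeta>, 1:]) (card S) = 1"
proof -
  show d: "degree (\<Prod>\<zeta>\<in>S. [:- \<zeta>, 1:]) = card S" by (simp add: degree_prod_eq_sum_degree)
  have "lead_coeff (\<Prod>\<zeta>\<in>S. [:- \<zeta>, 1:]) = (\<Prod>\<zeta>\<in>S. lead_coeff [:- \<zeta>, 1:])" by (rule lead_coeff_prod)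
  then show "coeff (\<Prod>\<zeta>\<in>S. [:- \<zeta>, 1:]) (card S) = 1" by (simp add: d)
qed

lemma monic_eq_prod_roots:
  fixes p :: "complex poly"
  assumes "finite S" "degree p = card S" "lead_coeff p = 1" "\<And>z. z \<in> S \<Longrightarrow> poly p z = 0"
  shows "p = (\<Prod>\<zeta>\<in>S. [:- \<zeta>, 1:])"
proof -
  let ?q = "\<Prod>\<zeta>\<in>S. [:- \<zeta>, 1:]"
  note q = prod_linear_monic[of S]
  have "coeff (p - ?q) (card S) = 0" using assms q by simp
  moreover have "degree (p - ?q) \<le> card S" using assms q by (intro degree_diff_le) auto
  ultimately have "p - ?q = 0 \<or> degree (p - ?q) < card S"
    by (metis leading_coeff_0_iff le_neq_implies_less)
  moreover have "poly (p - ?q) z = 0" if "z \<in> S" for z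
    using that assms by (auto simp: poly_prod)
  ultimately have "p - ?q = 0" using poly_eq_0_of_card_roots by blast
  then show ?thesis by simp
qed

lemma complex_cnj_mult_self: "cnj z * z = of_real ((cmod z)\<^sup>2)"
  using complex_norm_square[of z] by (simp add: mult.commute)

lemma circle_form_mform:
  assumes \<mu>: "circle_measure_pts n \<mu>"
  shows "circle_form n (mform \<mu>)"
proof -
  interpret finite_supp_measure \<mu> "atoms \<mu>" by (rule circle_measure_pts_finite_supp) fact
  have fin: "finite (atoms \<mu>)" and card: "card (atoms \<mu>) = n" and circ: "atoms \<mu> \<subseteq> sphere 0 1"
    using \<mu> by (auto simp: circle_measure_pts_def)
  have self: "mform \<mu> p p = of_real (\<Sum>\<zeta>\<in>atoms \<mu>. measure \<mu> {\<zeta>} * (cmod (poly p \<zeta>))\<^sup>2)" for p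
    unfolding mform_eq complex_cnj_mult_self by simp
  have null: "poly p \<zeta> = 0" if "mform \<mu> p p = 0" "\<zeta> \<in> atoms \<mu>" for p \<zeta>
  proof -
    have "(\<Sum>\<zeta>\<in>atoms \<mu>. measure \<mu> {\<zeta>} * (cmod (poly p \<zeta>))\<^sup>2) = 0"
      using that(1) unfolding self by (simp only: of_real_eq_0_iff)
    then have "measure \<mu> {\<zeta>} * (cmod (poly p \<zeta>))\<^sup>2 = 0"
      using fin that(2) by (subst (asm) sum_nonneg_eq_0_iff) auto
    then show ?thesis using that(2) by (simp add: atoms_def)
  qed
  show ?thesis
  proof
    fix p q r :: "complex poly" and c
    show "mform \<mu> p (q + r) = mform \<mu> p q + mform \<mu> p r"
      by (simp add: mform_eq sum.distrib algebra_simps)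
    show "mform \<mu> p (Polynomial.smult c q) = c * mform \<mu> p q"
      by (simp add: mform_eq sum_distrib_left algebra_simps)
    show "mform \<mu> q p = cnj (mform \<mu> p q)"
      by (simp add: mform_eq mult.commute mult.left_commute)
    have "cnj \<zeta> * \<zeta> = 1" if "\<zeta> \<in> atoms \<mu>" for \<zeta>
      using that circ by (auto simp: complex_cnj_mult_self)
    then have "cnj \<zeta> * (\<zeta> * x) = x" if "\<zeta> \<in> atoms \<mu>" for \<zeta> x
      using that by (simp flip: mult.assoc)
    then show "mform \<mu> (pCons 0 p) (pCons 0 q) = mform \<mu> p q"
      by (auto simp: mform_eq mult.assoc mult.left_commute intro!: sum.cong)
    show "0 \<le> Re (mform \<mu> p p)" unfolding self by (simp add: sum_nonneg)
    show "p = 0" if "degree p < n" "mform \<mu> p p = 0"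
      using that poly_eq_0_of_card_roots[of p "atoms \<mu>"] null[of p] card by auto
    show "\<exists>Q. degree Q = n \<and> lead_coeff Q = 1 \<and> mform \<mu> Q Q = 0"
    proof (intro exI[of _ "\<Prod>\<zeta>\<in>atoms \<mu>. [:- \<zeta>, 1:]"] conjI)
      have "poly (\<Prod>\<zeta>\<in>atoms \<mu>. [:- \<zeta>, 1:]) z = 0" if "z \<in> atoms \<mu>" for z
        using that fin by (auto simp: poly_prod)
      then show "mform \<mu> (\<Prod>\<zeta>\<in>atoms \<mu>. [:- \<zeta>, 1:]) (\<Prod>\<zeta>\<in>atoms \<mu>. [:- \<zeta>, 1:]) = 0"
        by (simp add: mform_eq)
    qed (use prod_linear_monic[of "atoms \<mu>"] card in simp_all)
    show "mform \<mu> 1 1 = 1" by (simp add: mform_def prob_space)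
  qed
qed

abbreviation malph :: "complex measure \<Rightarrow> nat \<Rightarrow> complex" where
  "malph \<mu> \<equiv> circle_form.alph (mform \<mu>)"

text \<open>Phi_n has norm zero and every atom has positive weight, so Phi_n vanishes at all
  \<open>n\<close> atoms; being monic of degree \<open>n\<close>, it is the nodal
  polynomial.\<close>

lemma szego_n_roots:
  assumes \<mu>: "circle_measure_pts n \<mu>"
  shows "szego (malph \<mu>) n = (\<Prod>\<zeta>\<in>atoms \<mu>. [:- \<zeta>, 1:])"
proof -
  interpret finite_supp_measure \<mu> "atoms \<mu>" by (rule circle_measure_pts_finite_supp) fact
  interpret circle_form n "mform \<mu>" by (rule circle_form_mform) fact
  have fin: "finite (atoms \<mu>)" and card: "card (atoms \<mu>) = n"
    using \<mu> by (auto simp: circle_measure_pts_def)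
  have "mform \<mu> (mop n) (mop n) = of_real (\<Sum>\<zeta>\<in>atoms \<mu>. measure \<mu> {\<zeta>} * (cmod (poly (mop n) \<zeta>))\<^sup>2)"
    unfolding mform_eq complex_cnj_mult_self by simp
  then have "(\<Sum>\<zeta>\<in>atoms \<mu>. measure \<mu> {\<zeta>} * (cmod (poly (mop n) \<zeta>))\<^sup>2) = 0"
    unfolding form_mop_n by (metis of_real_eq_0_iff)
  then have "\<forall>\<zeta>\<in>atoms \<mu>. measure \<mu> {\<zeta>} * (cmod (poly (mop n) \<zeta>))\<^sup>2 = 0"
    using fin by (subst (asm) sum_nonneg_eq_0_iff) auto
  then have "poly (mop n) \<zeta> = 0" if "\<zeta> \<in> atoms \<mu>" for \<zeta>
    using that by (auto simp: atoms_def)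
  then show ?thesis
    using monic_eq_prod_roots[OF fin, of "mop n"] card by (simp add: mop_eq_szego)
qed

lemma monic_op_eq_szego:
  assumes \<mu>: "circle_measure_pts n \<mu>" and "k \<le> n"
  shows "monic_op \<mu> k = szego (malph \<mu>) k"
proof -
  interpret circle_form n "mform \<mu>" by (rule circle_form_mform) fact
  have card: "card (atoms \<mu>) = n" using \<mu> by (auto simp: circle_measure_pts_def)
  show ?thesis
  proof (cases "k < n")
    case True
    have "(THE P. degree P = k \<and> lead_coeff P = 1 \<and>
       (\<forall>Q. degree Q < k \<longrightarrow> (LINT z|\<mu>. cnj (poly Q z) * poly P z) = 0)) = mop k"
    proof (rule the_equality)
      show "degree (mop k) = k \<and> lead_coeff (mop k) = 1 \<and>
         (\<forall>Q. degree Q < k \<longrightarrow> (LINT z|\<mu>. cnj (poly Q z) * poly (mop k) z) = 0)"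
        using form_orth[of k] True by (simp add: mform_def)
      show "P = mop k" if "degree P = k \<and> lead_coeff P = 1 \<and>
         (\<forall>Q. degree Q < k \<longrightarrow> (LINT z|\<mu>. cnj (poly Q z) * poly P z) = 0)" for P
        using that True by (intro mop_unique) (auto simp: mform_def)
    qed
    then show ?thesis using True card by (simp add: monic_op_def mop_eq_szego)
  next
    case False
    then show ?thesis using szego_n_roots[OF \<mu>] assms(2) card by (simp add: monic_op_def)
  qed
qed

lemma poly_star_nonzero: "p \<noteq> 0 \<Longrightarrow> poly_star p \<noteq> 0"
  by (metis coeff_0 coeff_poly_star complex_cnj_zero_iff diff_zero leading_coeff_0_iff zero_le)

lemma verblunsky_eq_malph:
  assumes \<mu>: "circle_measure_pts n \<mu>" and "k < n"
  shows "verblunsky \<mu> k = malph \<mu> k"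
  unfolding verblunsky_def
proof (rule the_equality)
  have 1: "monic_op \<mu> k = szego (malph \<mu>) k" "monic_op \<mu> (Suc k) = szego (malph \<mu>) (Suc k)"
    using monic_op_eq_szego[OF \<mu>] assms(2) by auto
  then show "monic_op \<mu> (Suc k) =
      pCons 0 (monic_op \<mu> k) - Polynomial.smult (cnj (malph \<mu> k)) (poly_star (monic_op \<mu> k))"
    by (simp add: szego.simps(2))
  fix a assume "monic_op \<mu> (Suc k) =
      pCons 0 (monic_op \<mu> k) - Polynomial.smult (cnj a) (poly_star (monic_op \<mu> k))"
  then have "Polynomial.smult (cnj a - cnj (malph \<mu> k)) (poly_star (szego (malph \<mu>) k)) = 0"
    by (simp add: 1 szego.simps(2) smult_diff_left)
  then show "a = malph \<mu> k" using poly_star_nonzero[OF szego_nonzero] by simp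
qed

lemma deformed_verblunsky_eq:
  assumes "circle_measure_pts n \<mu>" and "k < n"
  shows "deformed_verblunsky \<mu> k = deformed (malph \<mu>) k"
  using assms by (simp add: deformed_verblunsky_def deformed_def monic_op_eq_szego)

definition verb_range :: "nat \<Rightarrow> (nat \<Rightarrow> complex) set" where
  "verb_range n = {\<alpha>. (\<forall>k<n - 1. cmod (\<alpha> k) < 1) \<and> cmod (\<alpha> (n - 1)) = 1}"

lemma malph_in_range: "circle_measure_pts n \<mu> \<Longrightarrow> malph \<mu> \<in> verb_range n"
  using circle_form.alph_less_1[OF circle_form_mform] circle_form.alph_last[OF circle_form_mform]
  by (auto simp: verb_range_def)

text \<open>The coefficients fix \<open>szego _ n\<close>, whose roots are the atoms; on a common
  finite support the integrals of polynomials, that is the form paired with 1, fix the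
  weights.\<close>

lemma circle_measure_determined:
  assumes \<mu>: "circle_measure_pts n \<mu>" and \<nu>: "circle_measure_pts n \<nu>"
    and eq: "\<And>k. k < n \<Longrightarrow> malph \<mu> k = malph \<nu> k"
  shows "\<mu> = \<nu>"
proof (rule finite_supp_measure_eqI)
  have roots: "atoms m = {z. poly (szego (malph m) n) z = 0}" if "circle_measure_pts n m" for m
    using that szego_n_roots[OF that] by (auto simp: poly_prod circle_measure_pts_def)
  have "szego (malph \<mu>) n = szego (malph \<nu>) n" using eq by (intro szego_cong) auto
  then have at: "atoms \<nu> = atoms \<mu>" using roots \<mu> \<nu> by simp
  show "finite_supp_measure \<mu> (atoms \<mu>)" using \<mu> by (rule circle_measure_pts_finite_supp)
  show "finite_supp_measure \<nu> (atoms \<mu>)" using \<nu> at circle_measure_pts_finite_supp by metis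
  fix p
  show "(LINT z|\<mu>. poly p z) = (LINT z|\<nu>. poly p z)"
    using circle_form_determined[OF circle_form_mform[OF \<mu>] circle_form_mform[OF \<nu>] eq, of 1 p]
    by (simp add: mform_def)
qed

section \<open>Existence of the measure with given Verblunsky coefficients\<close>

text \<open>Orthonormal rows of a square matrix force orthonormal columns. It trades orthogonality
  of Christoffel-Darboux kernels at different nodes for orthogonality of polynomials of different
  degrees.\<close>

lemma square_inverse_sums:
  fixes X :: "nat \<Rightarrow> nat \<Rightarrow> complex"
  assumes "\<And>i j. \<lbrakk>i < n; j < n\<rbrakk> \<Longrightarrow> (\<Sum>k<n. X i k * cnj (X j k)) = (if i = j then 1 else 0)"
    and "i < n" "j < n"
  shows "(\<Sum>k<n. cnj (X k i) * X k j) = (if i = j then 1 else 0)"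
proof -
  define A where "A = Matrix.mat n n (\<lambda>(i, j). X i j)"
  define B where "B = Matrix.mat n n (\<lambda>(i, j). cnj (X j i))"
  have AB: "A \<in> carrier_mat n n" "B \<in> carrier_mat n n" by (simp_all add: A_def B_def)
  have "A * B = 1\<^sub>m n"
    using assms(1) by (intro eq_matI) (simp_all add: A_def B_def scalar_prod_def atLeast0LessThan)
  then have "B * A = 1\<^sub>m n" by (rule mat_mult_left_right_inverse[OF AB])
  then have "(B * A) $$ (i, j) = 1\<^sub>m n $$ (i, j)" by simp
  then show ?thesis
    using assms(2,3) by (simp add: A_def B_def scalar_prod_def atLeast0LessThan)
qed

text \<open>The squared norm that \<open>mnorm_Suc\<close> dictates for Phi_k, available before any
  measure exists.\<close>

definition snorm :: "(nat \<Rightarrow> complex) \<Rightarrow> nat \<Rightarrow> real" where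
  "snorm \<alpha> k = (\<Prod>j<k. 1 - (cmod (\<alpha> j))\<^sup>2)"

lemma snorm_pos: "(\<And>j. j < k \<Longrightarrow> cmod (\<alpha> j) < 1) \<Longrightarrow> 0 < snorm \<alpha> k"
  unfolding snorm_def by (intro prod_pos) (auto simp: abs_square_less_1)

lemma szego_christoffel_darboux:
  assumes "\<And>j. j < m \<Longrightarrow> cmod (\<alpha> j) < 1"
  shows "(1 - z * cnj w) * (\<Sum>k\<le>m. poly (szego \<alpha> k) z * cnj (poly (szego \<alpha> k) w) / of_real (snorm \<alpha> k)) =
    (poly (poly_star (szego \<alpha> m)) z * cnj (poly (poly_star (szego \<alpha> m)) w) -
      z * cnj w * poly (szego \<alpha> m) z * cnj (poly (szego \<alpha> m) w)) / of_real (snorm \<alpha> m)"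
  using assms
proof (induction m)
  case 0
  have "poly_star 1 = (1 :: complex poly)" using poly_star_szego_0 by simp
  then show ?case by (simp add: snorm_def)
next
  case (Suc m)
  let ?S = "\<lambda>m. \<Sum>k\<le>m. poly (szego \<alpha> k) z * cnj (poly (szego \<alpha> k) w) / of_real (snorm \<alpha> k)"
  define A B A' B' where "A = z * poly (szego \<alpha> m) z" and "B = poly (poly_star (szego \<alpha> m)) z"
    and "A' = w * poly (szego \<alpha> m) w" and "B' = poly (poly_star (szego \<alpha> m)) w"
  define P Q P' Q' where "P = poly (szego \<alpha> (Suc m)) z" and "Q = poly (poly_star (szego \<alpha> (Suc m))) z"
    and "P' = poly (szego \<alpha> (Suc m)) w" and "Q' = poly (poly_star (szego \<alpha> (Suc m))) w"
  have P: "P = A - cnj (\<alpha> m) * B" "P' = A' - cnj (\<alpha> m) * B'"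
    by (simp_all add: P_def P'_def A_def A'_def B_def B'_def poly_szego_Suc)
  have Q: "Q = B - \<alpha> m * A" "Q' = B' - \<alpha> m * A'"
    by (simp_all add: Q_def Q'_def A_def A'_def B_def B'_def poly_poly_star_szego_Suc)
  define c where "c = complex_of_real (1 - (cmod (\<alpha> m))\<^sup>2)"
  have N: "snorm \<alpha> m \<noteq> 0" "snorm \<alpha> (Suc m) \<noteq> 0"
    using snorm_pos[of m \<alpha>] snorm_pos[of "Suc m" \<alpha>] Suc.prems by force+
  have Nc: "complex_of_real (snorm \<alpha> (Suc m)) = c * of_real (snorm \<alpha> m)" by (simp add: snorm_def c_def)
  have c0: "c \<noteq> 0" using N(2) Nc by auto
  have c: "c = 1 - \<alpha> m * cnj (\<alpha> m)" unfolding c_def using complex_norm_square[of "\<alpha> m"] by simp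
  have key: "Q * cnj Q' - P * cnj P' = c * (B * cnj B' - A * cnj A')"
    unfolding P Q c by (simp add: algebra_simps)
  have "(1 - z * cnj w) * ?S m = (B * cnj B' - A * cnj A') / of_real (snorm \<alpha> m)"
    using Suc by (simp add: A_def B_def A'_def B'_def algebra_simps)
  also have "\<dots> = (Q * cnj Q' - P * cnj P') / of_real (snorm \<alpha> (Suc m))"
    unfolding key Nc using c0 by simp
  finally have "(1 - z * cnj w) * ?S (Suc m) =
      (Q * cnj Q' - P * cnj P') / of_real (snorm \<alpha> (Suc m)) + (1 - z * cnj w) * (P * cnj P' / of_real (snorm \<alpha> (Suc m)))"
    by (simp add: distrib_left P_def P'_def)
  also have "\<dots> = (Q * cnj Q' - z * cnj w * P * cnj P') / of_real (snorm \<alpha> (Suc m))"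
    by (simp add: diff_divide_distrib left_diff_distrib mult.assoc)
  finally show ?case by (simp add: P_def P'_def Q_def Q'_def)
qed

text \<open>In the open disc |z Phi_m| < |Phi_m^*|, so with |alpha_m| = 1 neither Phi_{m+1} nor
  Phi_{m+1}^* can vanish there. A root outside the closed disc would reflect to a root of
  Phi_{m+1}^* inside.\<close>

lemma szego_roots_on_circle:
  assumes \<alpha>: "\<alpha> \<in> verb_range n" and "1 \<le> n" and z: "poly (szego \<alpha> n) z = 0"
  shows "cmod z = 1"
proof -
  obtain m where n: "n = Suc m" using assms(2) by (cases n) auto
  have a: "\<And>j. j < m \<Longrightarrow> cmod (\<alpha> j) < 1" and am: "cmod (\<alpha> m) = 1"
    using \<alpha> by (auto simp: verb_range_def n)
  have inside: "poly (szego \<alpha> n) w \<noteq> 0 \<and> poly (poly_star (szego \<alpha> n)) w \<noteq> 0" if w: "cmod w < 1" for w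
  proof -
    let ?P = "poly (szego \<alpha> m) w" and ?S = "poly (poly_star (szego \<alpha> m)) w"
    have b: "?S \<noteq> 0" "cmod ?P \<le> cmod ?S"
      using szego_star_bounds[of m \<alpha> w, OF a] w by auto
    have "cmod (w * ?P) \<le> cmod w * cmod ?S"
      using b by (simp add: norm_mult mult_left_mono)
    also have "\<dots> < cmod ?S" using w b by simp
    finally have lt: "cmod (w * ?P) < cmod ?S" .
    have "w * ?P \<noteq> cnj (\<alpha> m) * ?S" using lt am by (metis complex_mod_cnj mult_1 norm_mult less_irrefl)
    moreover have "?S \<noteq> \<alpha> m * w * ?P" using lt am by (metis mult_1 mult.assoc norm_mult less_irrefl)
    ultimately show ?thesis by (simp add: n poly_szego_Suc poly_poly_star_szego_Suc)
  qed
  have "\<not> cmod z < 1" using inside[of z] z by auto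
  moreover have "\<not> cmod z > 1"
  proof
    assume gt: "cmod z > 1"
    define w where "w = 1 / cnj z"
    have z0: "z \<noteq> 0" using gt by auto
    then have w0: "w \<noteq> 0" by (simp add: w_def)
    have "cmod w < 1" using gt by (simp add: w_def norm_divide divide_less_eq)
    then have "poly (poly_star (szego \<alpha> n)) w \<noteq> 0" using inside by blast
    moreover have "1 / cnj w = z" using z0 by (simp add: w_def)
    ultimately show False using poly_poly_star[OF w0, of "szego \<alpha> n"] z by simp
  qed
  ultimately show ?thesis by simp
qed

section \<open>The Christoffel-Darboux kernel at the zeros of the last polynomial\<close>

definition cd_kernel :: "(nat \<Rightarrow> complex) \<Rightarrow> nat \<Rightarrow> complex \<Rightarrow> complex poly" where
  "cd_kernel \<alpha> m w = (\<Sum>k\<le>m. Polynomial.smult (cnj (poly (szego \<alpha> k) w) / of_real (snorm \<alpha> k)) (szego \<alpha> k))"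

lemma poly_cd_kernel: "poly (cd_kernel \<alpha> m w) z =
    (\<Sum>k\<le>m. poly (szego \<alpha> k) z * cnj (poly (szego \<alpha> k) w) / of_real (snorm \<alpha> k))"
  by (simp add: cd_kernel_def poly_sum mult.commute)

lemma cd_kernel_diag:
  assumes "\<And>j. j < m \<Longrightarrow> cmod (\<alpha> j) < 1"
  shows "poly (cd_kernel \<alpha> m w) w = of_real (\<Sum>k\<le>m. (cmod (poly (szego \<alpha> k) w))\<^sup>2 / snorm \<alpha> k)"
    and "0 < (\<Sum>k\<le>m. (cmod (poly (szego \<alpha> k) w))\<^sup>2 / snorm \<alpha> k)"
proof -
  show "poly (cd_kernel \<alpha> m w) w = of_real (\<Sum>k\<le>m. (cmod (poly (szego \<alpha> k) w))\<^sup>2 / snorm \<alpha> k)"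
    unfolding poly_cd_kernel complex_norm_square[symmetric] by simp
  have pos: "0 < snorm \<alpha> k" if "k \<le> m" for k using that assms by (intro snorm_pos) auto
  show "0 < (\<Sum>k\<le>m. (cmod (poly (szego \<alpha> k) w))\<^sup>2 / snorm \<alpha> k)"
  proof (rule sum_pos2[of _ 0])
    show "0 < (cmod (poly (szego \<alpha> 0) w))\<^sup>2 / snorm \<alpha> 0" by (simp add: snorm_def)
    show "0 \<le> (cmod (poly (szego \<alpha> i) w))\<^sup>2 / snorm \<alpha> i" if "i \<in> {..m}" for i
      using pos[of i] that by simp
  qed auto
qed

text \<open>At a root w, w Phi_m(w) = cnj alpha_m * Phi_m^*(w). As |alpha_m| = 1, the
  Christoffel-Darboux numerator becomes a nonzero multiple of Phi_{m+1}(z), so the kernel based at w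
  vanishes at all other roots.\<close>

lemma cd_kernel_at_root:
  assumes \<alpha>: "\<alpha> \<in> verb_range (Suc m)" and w: "poly (szego \<alpha> (Suc m)) w = 0"
  shows "\<exists>c. c \<noteq> 0 \<and> [:1, - cnj w:] * cd_kernel \<alpha> m w = Polynomial.smult c (szego \<alpha> (Suc m))"
proof -
  have a: "\<And>j. j < m \<Longrightarrow> cmod (\<alpha> j) < 1" and am: "cmod (\<alpha> m) = 1"
    using \<alpha> by (auto simp: verb_range_def)
  have w1: "cmod w = 1" using szego_roots_on_circle[OF \<alpha> _ w] by simp
  define B' where "B' = poly (poly_star (szego \<alpha> m)) w"
  have B0: "B' \<noteq> 0" using szego_star_bounds[of m \<alpha> w, OF a] w1 by (simp add: B'_def)
  have root: "w * poly (szego \<alpha> m) w = cnj (\<alpha> m) * B'"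
    using w by (simp add: poly_szego_Suc B'_def)
  have cr: "cnj w * cnj (poly (szego \<alpha> m) w) = \<alpha> m * cnj B'"
    using arg_cong[OF root, of cnj] by simp
  have aa: "\<alpha> m * cnj (\<alpha> m) = 1" using complex_norm_square[of "\<alpha> m"] am by simp
  define c where "c = - \<alpha> m * cnj B' / of_real (snorm \<alpha> m)"
  have "\<alpha> m \<noteq> 0" using am by auto
  then have "c \<noteq> 0" using B0 snorm_pos[of m \<alpha>, OF a] by (simp add: c_def)
  moreover have "poly ([:1, - cnj w:] * cd_kernel \<alpha> m w) z = poly (Polynomial.smult c (szego \<alpha> (Suc m))) z" for z
  proof -
    let ?A = "z * poly (szego \<alpha> m) z" and ?B = "poly (poly_star (szego \<alpha> m)) z"
    have "poly ([:1, - cnj w:] * cd_kernel \<alpha> m w) z = (1 - z * cnj w) * poly (cd_kernel \<alpha> m w) z"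
      by (simp add: algebra_simps)
    also have "\<dots> = (?B * cnj B' - ?A * (cnj w * cnj (poly (szego \<alpha> m) w))) / of_real (snorm \<alpha> m)"
      unfolding poly_cd_kernel by (subst szego_christoffel_darboux, rule a) (simp_all add: B'_def mult_ac)
    also have "\<dots> = cnj B' * (\<alpha> m * cnj (\<alpha> m) * ?B - \<alpha> m * ?A) / of_real (snorm \<alpha> m)"
      unfolding cr aa by (simp add: algebra_simps)
    also have "\<dots> = c * (?A - cnj (\<alpha> m) * ?B)"
      unfolding c_def by (simp add: algebra_simps diff_divide_distrib)
    finally show ?thesis by (simp add: poly_szego_Suc)
  qed
  ultimately show ?thesis by (intro exI[of _ c]) (simp add: poly_eq_poly_eq_iff[symmetric] fun_eq_iff del: mult_pCons_left)
qed

text \<open>Differentiating the identity of \<open>cd_kernel_at_root\<close> at a double root w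
  leaves - cnj w times the kernel on the diagonal, which would have to be 0 but is positive.\<close>

lemma szego_rsquarefree:
  assumes \<alpha>: "\<alpha> \<in> verb_range (Suc m)"
  shows "rsquarefree (szego \<alpha> (Suc m))"
  unfolding rsquarefree_roots
proof safe
  fix w assume w: "poly (szego \<alpha> (Suc m)) w = 0" and d: "poly (pderiv (szego \<alpha> (Suc m))) w = 0"
  have a: "\<And>j. j < m \<Longrightarrow> cmod (\<alpha> j) < 1" using \<alpha> by (auto simp: verb_range_def)
  have w1: "cmod w = 1" using szego_roots_on_circle[OF \<alpha> _ w] by simp
  then have ww: "w * cnj w = 1" using complex_norm_square[of w] by simp
  obtain c where c: "[:1, - cnj w:] * cd_kernel \<alpha> m w = Polynomial.smult c (szego \<alpha> (Suc m))"
    using cd_kernel_at_root[OF \<alpha> w] by blast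
  have "poly (pderiv ([:1, - cnj w:] * cd_kernel \<alpha> m w)) w =
      (1 - w * cnj w) * poly (pderiv (cd_kernel \<alpha> m w)) w - cnj w * poly (cd_kernel \<alpha> m w) w"
    unfolding pderiv_mult by (simp add: pderiv_pCons algebra_simps)
  then have "cnj w * poly (cd_kernel \<alpha> m w) w = 0"
    unfolding c using d ww by (simp add: pderiv_smult)
  moreover have "poly (cd_kernel \<alpha> m w) w = of_real (\<Sum>k\<le>m. (cmod (poly (szego \<alpha> k) w))\<^sup>2 / snorm \<alpha> k)"
    "0 < (\<Sum>k\<le>m. (cmod (poly (szego \<alpha> k) w))\<^sup>2 / snorm \<alpha> k)"
    by (rule cd_kernel_diag, erule a)+
  then have "poly (cd_kernel \<alpha> m w) w \<noteq> 0" by (metis less_irrefl of_real_eq_0_iff)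
  ultimately show False using w1 by auto
qed

lemma exists_circle_measure:
  assumes \<alpha>: "\<alpha> \<in> verb_range n" and n1: "1 \<le> n"
  shows "\<exists>\<mu>. circle_measure_pts n \<mu> \<and> (\<forall>k<n. malph \<mu> k = \<alpha> k)"
proof -
  obtain m where n: "n = Suc m" using n1 by (cases n) auto
  have \<alpha>': "\<alpha> \<in> verb_range (Suc m)" using \<alpha> n by simp
  have a: "\<And>j. j < m \<Longrightarrow> cmod (\<alpha> j) < 1" using \<alpha>' by (auto simp: verb_range_def)
  have np: "0 < snorm \<alpha> k" if "k < n" for k using that a n by (intro snorm_pos) auto
  define S where "S = {z. poly (szego \<alpha> n) z = 0}"
  have finS: "finite S" by (simp add: S_def poly_roots_finite)
  have sqf: "rsquarefree (szego \<alpha> n)" using szego_rsquarefree[OF \<alpha>'] n by simp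
  then have cardS: "card S = n" using rsquarefree_card_degree[of "szego \<alpha> n"] by (simp add: S_def)
  have nodal: "szego \<alpha> n = (\<Prod>\<zeta>\<in>S. [:- \<zeta>, 1:])"
  proof (rule monic_eq_prod_roots[OF finS])
    show "poly (szego \<alpha> n) z = 0" if "z \<in> S" for z using that by (simp add: S_def)
  qed (simp_all add: cardS)
  have circ: "S \<subseteq> sphere 0 1" using szego_roots_on_circle[OF \<alpha> n1] by (auto simp: S_def)
  define K where "K w = (\<Sum>k\<le>m. (cmod (poly (szego \<alpha> k) w))\<^sup>2 / snorm \<alpha> k)" for w
  have K: "poly (cd_kernel \<alpha> m w) w = of_real (K w)" "0 < K w" for w
    unfolding K_def by (rule cd_kernel_diag, erule a)+
  have off: "poly (cd_kernel \<alpha> m w) z = 0" if "z \<in> S" "w \<in> S" "z \<noteq> w" for z w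
  proof -
    obtain c where c: "[:1, - cnj w:] * cd_kernel \<alpha> m w = Polynomial.smult c (szego \<alpha> (Suc m))"
      using cd_kernel_at_root[OF \<alpha>', of w] \<open>w \<in> S\<close> by (auto simp: S_def n)
    have "poly ([:1, - cnj w:] * cd_kernel \<alpha> m w) z = 0" unfolding c using that by (simp add: S_def n)
    then have "(1 - z * cnj w) * poly (cd_kernel \<alpha> m w) z = 0" by (auto simp: algebra_simps)
    moreover have "1 - z * cnj w \<noteq> 0"
    proof
      assume "1 - z * cnj w = 0"
      then have "z * cnj w = 1" by simp
      then have "z * (w * cnj w) = w" by (metis mult.commute mult.left_commute mult_1)
      moreover have "w * cnj w = 1" using complex_norm_square[of w] \<open>w \<in> S\<close> circ by auto
      ultimately show False using \<open>z \<noteq> w\<close> by simp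
    qed
    ultimately show ?thesis by simp
  qed
  obtain g where g: "bij_betw g {..<n} S" using ex_bij_betw_nat_finite[OF finS] cardS by (auto simp: atLeast0LessThan)
  \<comment> \<open>Rows are nodes, columns are degrees. The scaling makes the rows orthonormal by
    the vanishing of the kernel between distinct nodes; orthonormality of the columns is then
    orthogonality of the Phi_k for the weights \<open>1 / K \<zeta>\<close>.\<close>
  define X where "X i k = poly (szego \<alpha> k) (g i) / of_real (sqrt (snorm \<alpha> k)) / of_real (sqrt (K (g i)))" for i k
  have XX: "(\<Sum>k<n. X i k * cnj (X j k)) = (if i = j then 1 else 0)" if "i < n" "j < n" for i j
  proof -
    have nm: "{..<n} = {..m}" by (auto simp: n)
    have gS: "g i \<in> S" "g j \<in> S" using that g by (auto simp: bij_betw_def)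
    have "(\<Sum>k<n. X i k * cnj (X j k)) =
        (\<Sum>k\<le>m. poly (szego \<alpha> k) (g i) * cnj (poly (szego \<alpha> k) (g j)) / of_real (snorm \<alpha> k)) /
          of_real (sqrt (K (g i)) * sqrt (K (g j)))"
      unfolding sum_divide_distrib nm
    proof (rule sum.cong)
      fix k assume "k \<in> {..m}"
      then have "complex_of_real (snorm \<alpha> k) = of_real (sqrt (snorm \<alpha> k)) * of_real (sqrt (snorm \<alpha> k))"
        using np[of k] n by (simp flip: of_real_mult)
      then show "X i k * cnj (X j k) = poly (szego \<alpha> k) (g i) * cnj (poly (szego \<alpha> k) (g j)) / of_real (snorm \<alpha> k) /
          of_real (sqrt (K (g i)) * sqrt (K (g j)))"
        by (simp add: X_def mult_ac)
    qed simp
    also have "(\<Sum>k\<le>m. poly (szego \<alpha> k) (g i) * cnj (poly (szego \<alpha> k) (g j)) / of_real (snorm \<alpha> k)) =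
        poly (cd_kernel \<alpha> m (g j)) (g i)" by (rule poly_cd_kernel[symmetric])
    also have "\<dots> / of_real (sqrt (K (g i)) * sqrt (K (g j))) = (if i = j then 1 else 0)"
    proof (cases "i = j")
      case True
      have "sqrt (K (g j)) * sqrt (K (g j)) = K (g j)" using K(2)[of "g j"] by simp
      then show ?thesis using True K[of "g j"] by (simp del: real_sqrt_mult_self)
    next
      case False
      then have "g i \<noteq> g j" using g that by (auto simp: bij_betw_def inj_on_def)
      then show ?thesis using off[OF gS] False by simp
    qed
    finally show ?thesis .
  qed
  have orth: "(\<Sum>\<zeta>\<in>S. of_real (1 / K \<zeta>) * (cnj (poly (szego \<alpha> k) \<zeta>) * poly (szego \<alpha> l) \<zeta>)) =
      (if k = l then of_real (snorm \<alpha> k) else 0)" if "k < n" "l < n" for k l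
  proof -
    let ?c = "complex_of_real (sqrt (snorm \<alpha> k) * sqrt (snorm \<alpha> l))"
    have c: "?c \<noteq> 0" using np[OF that(1)] np[OF that(2)] by simp
    have "(\<Sum>\<zeta>\<in>S. of_real (1 / K \<zeta>) * (cnj (poly (szego \<alpha> k) \<zeta>) * poly (szego \<alpha> l) \<zeta>)) =
        (\<Sum>i<n. of_real (1 / K (g i)) * (cnj (poly (szego \<alpha> k) (g i)) * poly (szego \<alpha> l) (g i)))"
      by (rule sum.reindex_bij_betw[OF g, symmetric])
    also have "\<dots> = (\<Sum>i<n. ?c * (cnj (X i k) * X i l))"
    proof (rule sum.cong)
      fix i
      have "complex_of_real (K (g i)) = of_real (sqrt (K (g i))) * of_real (sqrt (K (g i)))"
        using K(2)[of "g i"] by (simp flip: of_real_mult)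
      then show "of_real (1 / K (g i)) * (cnj (poly (szego \<alpha> k) (g i)) * poly (szego \<alpha> l) (g i)) = ?c * (cnj (X i k) * X i l)"
        using c by (simp add: X_def mult_ac)
    qed simp
    also have "\<dots> = ?c * (if k = l then 1 else 0)"
      unfolding sum_distrib_left[symmetric] using square_inverse_sums[OF XX that] by simp
    also have "\<dots> = (if k = l then of_real (snorm \<alpha> k) else 0)"
      using np[OF that(1)] by (auto simp flip: of_real_mult)
    finally show ?thesis .
  qed
  \<comment> \<open>\<open>point_measure\<close> lives on the power set of \<open>S\<close>; the
    image under the identity turns it into a Borel measure on the plane.\<close>
  define \<mu> where "\<mu> = distr (point_measure S (\<lambda>\<zeta>. ennreal (1 / K \<zeta>))) borel (\<lambda>z. z)"
  have em: "emeasure \<mu> A = (\<Sum>\<zeta>\<in>S \<inter> A. ennreal (1 / K \<zeta>))" if "A \<in> sets borel" for A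
  proof -
    have "emeasure \<mu> A = emeasure (point_measure S (\<lambda>\<zeta>. ennreal (1 / K \<zeta>))) (A \<inter> S)"
      using that unfolding \<mu>_def by (subst emeasure_distr) (auto simp: space_point_measure)
    also have "\<dots> = (\<Sum>\<zeta>\<in>S \<inter> A. ennreal (1 / K \<zeta>))"
      using finS by (subst emeasure_point_measure_finite) (auto simp: Int_commute)
    finally show ?thesis .
  qed
  have tot: "(\<Sum>\<zeta>\<in>S. 1 / K \<zeta>) = 1"
  proof -
    have "complex_of_real (\<Sum>\<zeta>\<in>S. 1 / K \<zeta>) = 1" using orth[of 0 0] n by (simp add: snorm_def)
    then show ?thesis by (simp only: of_real_eq_1_iff)
  qed
  have Sb: "S \<in> sets borel" using finS by (simp add: borel_closed finite_imp_closed)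
  have "emeasure \<mu> UNIV = 1" "emeasure \<mu> S = 1"
    using em[of UNIV] em[OF Sb] tot K(2) by (simp_all add: sum_ennreal less_imp_le)
  have msing: "measure \<mu> {z} = (if z \<in> S then 1 / K z else 0)" for z
    using em[of "{z}"] K(2)[of z] by (auto simp: measure_def)
  have atoms: "atoms \<mu> = S" using K(2) by (auto simp: atoms_def msing)
  have \<mu>: "circle_measure_pts n \<mu>"
    unfolding circle_measure_pts_def atoms
  proof (intro conjI)
    show "prob_space \<mu>" using \<open>emeasure \<mu> UNIV = 1\<close> by (intro prob_spaceI) (simp add: \<mu>_def)
    show "measure \<mu> S = 1" using \<open>emeasure \<mu> S = 1\<close> by (simp add: measure_def)
  qed (use finS cardS circ in \<open>auto simp: \<mu>_def\<close>)
  interpret fs: finite_supp_measure \<mu> "atoms \<mu>" by (rule circle_measure_pts_finite_supp) fact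
  interpret circle_form n "mform \<mu>" by (rule circle_form_mform) fact
  have orth': "mform \<mu> (szego \<alpha> k) (szego \<alpha> l) = (if k = l then of_real (snorm \<alpha> k) else 0)" if "k < n" "l < n" for k l
    using orth[OF that] by (simp add: fs.mform_eq atoms msing cong: sum.cong)
  have eqs: "szego (malph \<mu>) k = szego \<alpha> k" if "k \<le> n" for k
  proof (cases "k < n")
    case True
    have "mform \<mu> q (szego \<alpha> k) = 0" if "degree q < k" for q
      using that
    proof (induction q rule: szego_induct[where \<alpha> = \<alpha>])
      case (add q c j)
      then show ?case using orth'[of j k] True by (simp add: form_add_left form_smult_left)
    qed simp
    then have "szego \<alpha> k = mop k" using True by (intro mop_unique) auto
    then show ?thesis by (simp add: mop_eq_szego)
  next
    case False
    then have "k = n" using that by simp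
    then show ?thesis using szego_n_roots[OF \<mu>] nodal atoms by simp
  qed
  \<comment> \<open>The coefficient can be read off from the constant term of the next polynomial,
    since Phi_k^* has constant term 1. Hence equal polynomials up to degree \<open>n\<close> give
    equal coefficients.\<close>
  have c0: "\<beta> k = - cnj (coeff (szego \<beta> (Suc k)) 0)" for \<beta> k
    by (simp add: szego.simps(2) coeff_poly_star)
  have "malph \<mu> k = \<alpha> k" if "k < n" for k
    using c0[of "malph \<mu>" k] c0[of \<alpha> k] eqs[of "Suc k"] that by simp
  then show ?thesis using \<mu> by blast
qed

lemma verblunsky_measure_props:
  assumes "\<alpha> \<in> verb_range n" and "1 \<le> n"
  shows "circle_measure_pts n (verblunsky_measure n \<alpha>)"
    and "\<And>k. k < n \<Longrightarrow> malph (verblunsky_measure n \<alpha>) k = \<alpha> k"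
proof -
  obtain \<mu> where \<mu>: "circle_measure_pts n \<mu>" "\<forall>k<n. malph \<mu> k = \<alpha> k"
    using exists_circle_measure[OF assms] by blast
  have "verblunsky_measure n \<alpha> = \<mu>"
    unfolding verblunsky_measure_def
  proof (rule the_equality)
    show "circle_measure_pts n \<mu> \<and> (\<forall>k<n. verblunsky \<mu> k = \<alpha> k)"
      using \<mu> verblunsky_eq_malph by simp
    show "\<nu> = \<mu>" if "circle_measure_pts n \<nu> \<and> (\<forall>k<n. verblunsky \<nu> k = \<alpha> k)" for \<nu>
      using that \<mu> verblunsky_eq_malph by (intro circle_measure_determined) auto
  qed
  then show "circle_measure_pts n (verblunsky_measure n \<alpha>)"
    and "\<And>k. k < n \<Longrightarrow> malph (verblunsky_measure n \<alpha>) k = \<alpha> k"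
    using \<mu> by auto
qed

text \<open>With no witness the describing predicate is constantly false, so the description is one
  fixed value that does not depend on \<open>\<alpha>\<close>. This makes \<open>ggt n\<close>
  constant off \<open>verb_range n\<close>, hence measurable on the whole space.\<close>

lemma verblunsky_measure_outside:
  assumes "\<alpha> \<notin> verb_range n"  and "1 \<le> n"
  shows "verblunsky_measure n \<alpha> = (THE \<mu>. False)"
proof -
  have no: "\<not> (circle_measure_pts n \<mu> \<and> (\<forall>k<n. verblunsky \<mu> k = \<alpha> k))" for \<mu>
  proof
    assume "circle_measure_pts n \<mu> \<and> (\<forall>k<n. verblunsky \<mu> k = \<alpha> k)"
    then have "malph \<mu> \<in> verb_range n" "\<forall>k<n. malph \<mu> k = \<alpha> k"
      using malph_in_range verblunsky_eq_malph by auto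
    then show False using assms by (auto simp: verb_range_def)
  qed
  have eq: "(\<lambda>\<mu>. circle_measure_pts n \<mu> \<and> (\<forall>k<n. verblunsky \<mu> k = \<alpha> k)) = (\<lambda>\<mu>. False)"
    by (intro ext iffI) (erule notE[OF no], erule FalseE)
  show ?thesis unfolding verblunsky_measure_def eq ..
qed

section \<open>Unitary matrices with a cyclic vector\<close>

definition kr :: "complex Matrix.mat \<Rightarrow> nat \<Rightarrow> nat \<Rightarrow> complex" where
  "kr A k i = (A ^\<^sub>m k) $$ (i, 0)"

text \<open>The vector \<open>p(A) e\<^sub>1\<close>.\<close>

definition kpoly :: "complex Matrix.mat \<Rightarrow> complex poly \<Rightarrow> nat \<Rightarrow> complex" where
  "kpoly A p i = (\<Sum>k\<le>degree p. coeff p k * kr A k i)"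

text \<open>The inner product of \<open>p(A) e\<^sub>1\<close> and \<open>q(A) e\<^sub>1\<close>.\<close>

definition gform :: "nat \<Rightarrow> complex Matrix.mat \<Rightarrow> complex poly \<Rightarrow> complex poly \<Rightarrow> complex" where
  "gform n A p q = (\<Sum>i<n. cnj (kpoly A p i) * kpoly A q i)"

definition krylov :: "nat \<Rightarrow> complex Matrix.mat \<Rightarrow> complex Matrix.mat" where
  "krylov n A = Matrix.mat n n (\<lambda>(i, k). kr A k i)"

text \<open>The unitary matrices with cyclic vector \<open>e\<^sub>1\<close>, by \<open>cyclic_vec_iff_det\<close> below.\<close>

definition good_mats :: "nat \<Rightarrow> complex Matrix.mat set" where
  "good_mats n = {A. unitary_mat n A \<and> det (krylov n A) \<noteq> 0}"

lemma pow_mat_commute: "A \<in> carrier_mat n n \<Longrightarrow> A ^\<^sub>m k * A = A * A ^\<^sub>m k"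
proof (induction k)
  case (Suc k)
  have "A ^\<^sub>m Suc k * A = (A * A ^\<^sub>m k) * A" using Suc by simp
  also have "\<dots> = A * (A ^\<^sub>m k * A)"
    using Suc.prems by (intro assoc_mult_mat[of _ n n _ n _ n] pow_carrier_mat)
  finally show ?case by simp
qed simp

lemma mat_adjoint_carrier: "A \<in> carrier_mat n n \<Longrightarrow> mat_adjoint A \<in> carrier_mat n n"
  unfolding mat_adjoint_def by (intro carrier_matI) simp_all

lemma mat_adjoint_index:
  assumes "A \<in> carrier_mat n n" "i < n" "j < n"
  shows "mat_adjoint A $$ (i, j) = cnj (A $$ (j, i))"
proof -
  have "mat_adjoint A $$ (i, j) = (map conjugate (cols A) ! i) $ j"
    unfolding mat_adjoint_def using assms by (intro mat_of_rows_index) auto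
  then show ?thesis using assms by simp
qed

lemma mat_mult_index:
  assumes "A \<in> carrier_mat n n" "B \<in> carrier_mat n n" "i < n" "j < n"
  shows "(A * B) $$ (i, j) = (\<Sum>l<n. A $$ (i, l) * B $$ (l, j))"
  using assms by (simp add: scalar_prod_def atLeast0LessThan)

lemma kr_0: "A \<in> carrier_mat n n \<Longrightarrow> i < n \<Longrightarrow> kr A 0 i = (if i = 0 then 1 else 0)"
  by (cases "n = 0") (auto simp: kr_def)

lemma kr_Suc:
  assumes "A \<in> carrier_mat n n" "i < n"
  shows "kr A (Suc k) i = (\<Sum>l<n. A $$ (i, l) * kr A k l)"
  using assms mat_mult_index[OF assms(1) pow_carrier_mat[OF assms(1), of k] assms(2), of 0]
  by (simp add: kr_def pow_mat_commute)

lemma kpoly_le: "degree p \<le> N \<Longrightarrow> kpoly A p i = (\<Sum>k\<le>N. coeff p k * kr A k i)"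
  unfolding kpoly_def by (intro sum.mono_neutral_left) (auto simp: coeff_eq_0)

lemma kpoly_add: "kpoly A (p + q) i = kpoly A p i + kpoly A q i"
proof -
  let ?N = "max (degree p) (degree q)"
  have "degree (p + q) \<le> ?N" by (rule degree_add_le) auto
  then show ?thesis
    using kpoly_le[of p ?N A i] kpoly_le[of q ?N A i] kpoly_le[of "p + q" ?N A i]
    by (simp add: distrib_right sum.distrib)
qed

lemma kpoly_smult: "kpoly A (Polynomial.smult c p) i = c * kpoly A p i"
  using kpoly_le[of "Polynomial.smult c p" "degree p" A i]
  by (simp add: kpoly_def sum_distrib_left mult.assoc degree_smult_le)


lemma kpoly_1: "A \<in> carrier_mat n n \<Longrightarrow> i < n \<Longrightarrow> kpoly A 1 i = (if i = 0 then 1 else 0)"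
  by (simp add: kpoly_def kr_0)

lemma kpoly_monom: "kpoly A (monom 1 k) i = kr A k i"
proof -
  have "kpoly A (monom 1 k) i = (\<Sum>j\<le>k. if j = k then kr A k i else 0)"
    by (subst kpoly_le[of _ k])
      (simp_all add: degree_monom_eq if_distrib[of "\<lambda>x. x * _"] eq_commute[of k] cong: if_cong)
  then show ?thesis by simp
qed

lemma kpoly_pCons_0:
  assumes "A \<in> carrier_mat n n" "i < n"
  shows "kpoly A (pCons 0 p) i = (\<Sum>l<n. A $$ (i, l) * kpoly A p l)"
proof -
  have "kpoly A (pCons 0 p) i = (\<Sum>k\<le>Suc (degree p). coeff (pCons 0 p) k * kr A k i)"
    by (rule kpoly_le) (simp add: degree_pCons_le)
  also have "\<dots> = (\<Sum>k\<le>degree p. coeff p k * kr A (Suc k) i)"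
    by (subst sum.atMost_Suc_shift) simp
  also have "\<dots> = (\<Sum>k\<le>degree p. \<Sum>l<n. coeff p k * (A $$ (i, l) * kr A k l))"
    using kr_Suc[OF assms] by (simp add: sum_distrib_left)
  also have "\<dots> = (\<Sum>l<n. A $$ (i, l) * kpoly A p l)"
    by (subst sum.swap) (simp add: kpoly_def sum_distrib_left mult.left_commute)
  finally show ?thesis .
qed

text \<open>A vector in the kernel of the Krylov matrix is the coefficient vector of a polynomial of
  degree below \<open>n\<close> with p(A) e_1 = 0.\<close>

lemma det_krylov_0_iff:
  "det (krylov n A) = 0 \<longleftrightarrow> (\<exists>p. p \<noteq> 0 \<and> degree p < n \<and> (\<forall>i<n. kpoly A p i = 0))"
proof -
  have K: "krylov n A \<in> carrier_mat n n" by (simp add: krylov_def)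
  have Kv: "(krylov n A *\<^sub>v v) $ i = (\<Sum>k<n. v $ k * kr A k i)" if "v \<in> carrier_vec n" "i < n" for v i
    using that by (simp add: krylov_def scalar_prod_def atLeast0LessThan mult.commute)
  show ?thesis
    unfolding det_0_iff_vec_prod_zero[OF K]
  proof safe
    fix v assume v: "v \<in> carrier_vec n" "v \<noteq> 0\<^sub>v n" "krylov n A *\<^sub>v v = 0\<^sub>v n"
    define p where "p = (\<Sum>k<n. monom (v $ k) k)"
    have cp: "coeff p j = (if j < n then v $ j else 0)" for j
    proof -
      have "coeff p j = (\<Sum>k<n. if k = j then v $ j else 0)"
        unfolding p_def coeff_sum by (intro sum.cong) auto
      then show ?thesis by simp
    qed
    obtain j where j: "j < n" "v $ j \<noteq> 0" using v by (metis carrier_vecD eq_vecI index_zero_vec(1) index_zero_vec(2))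
    then have p0: "p \<noteq> 0" using cp[of j] by auto
    have dp: "degree p < n" using p0 cp[of "degree p"] leading_coeff_neq_0[of p] by (metis)
    have "kpoly A p i = 0" if "i < n" for i
    proof -
      have "kpoly A p i = (\<Sum>k\<le>n - 1. coeff p k * kr A k i)" using dp by (intro kpoly_le) simp
      also have "{..n - 1} = {..<n}" using dp by auto
      also have "(\<Sum>k<n. coeff p k * kr A k i) = (krylov n A *\<^sub>v v) $ i"
        using Kv[OF v(1) that] by (simp add: cp)
      finally show ?thesis unfolding v(3) using that by simp
    qed
    then show "\<exists>p. p \<noteq> 0 \<and> degree p < n \<and> (\<forall>i<n. kpoly A p i = 0)" using p0 dp by blast
  next
    fix p :: "complex poly" assume p: "p \<noteq> 0" "degree p < n" "\<forall>i<n. kpoly A p i = 0"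
    define v where "v = vec n (coeff p)"
    have nn: "{..n - 1} = {..<n}" using p by auto
    have "v \<in> carrier_vec n" by (simp add: v_def)
    moreover have "v \<noteq> 0\<^sub>v n"
    proof
      assume "v = 0\<^sub>v n"
      then have "v $ degree p = 0" using p by simp
      then show False using p by (simp add: v_def)
    qed
    moreover have "krylov n A *\<^sub>v v = 0\<^sub>v n"
    proof (rule eq_vecI)
      fix i assume "i < dim_vec (0\<^sub>v n :: complex Matrix.vec)"
      then have i: "i < n" by simp
      have "(krylov n A *\<^sub>v v) $ i = (\<Sum>k\<le>n - 1. coeff p k * kr A k i)"
        using i unfolding nn by (simp add: Kv v_def)
      also have "\<dots> = kpoly A p i" using p by (intro kpoly_le[symmetric]) simp
      finally show "(krylov n A *\<^sub>v v) $ i = 0\<^sub>v n $ i" using p i by simp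
    qed (simp add: krylov_def)
    ultimately show "\<exists>v. v \<in> carrier_vec n \<and> v \<noteq> 0\<^sub>v n \<and> krylov n A *\<^sub>v v = 0\<^sub>v n" by blast
  qed
qed

lemma unitary_columns:
  assumes "unitary_mat n A" "l < n" "m < n"
  shows "(\<Sum>i<n. cnj (A $$ (i, l)) * A $$ (i, m)) = (if l = m then 1 else 0)"
proof -
  have A: "A \<in> carrier_mat n n" "mat_adjoint A * A = 1\<^sub>m n" using assms by (auto simp: unitary_mat_def)
  have "(mat_adjoint A * A) $$ (l, m) = (if l = m then 1 else 0)" using A assms by simp
  then show ?thesis
    using assms mat_mult_index[OF mat_adjoint_carrier[OF A(1)] A(1), of l m] mat_adjoint_index[OF A(1)] by simp
qed

lemma unitary_preserves:
  fixes x y :: "nat \<Rightarrow> complex"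
  assumes "unitary_mat n A"
  shows "(\<Sum>i<n. cnj (\<Sum>l<n. A $$ (i, l) * x l) * (\<Sum>m<n. A $$ (i, m) * y m)) = (\<Sum>i<n. cnj (x i) * y i)"
proof -
  have "(\<Sum>i<n. cnj (\<Sum>l<n. A $$ (i, l) * x l) * (\<Sum>m<n. A $$ (i, m) * y m)) =
      (\<Sum>i<n. \<Sum>l<n. \<Sum>m<n. cnj (x l) * y m * (cnj (A $$ (i, l)) * A $$ (i, m)))"
    by (simp only: cnj_sum sum_product complex_cnj_mult) (simp only: mult_ac)
  also have "\<dots> = (\<Sum>l<n. \<Sum>i<n. \<Sum>m<n. cnj (x l) * y m * (cnj (A $$ (i, l)) * A $$ (i, m)))"
    by (rule sum.swap)
  also have "\<dots> = (\<Sum>l<n. \<Sum>m<n. cnj (x l) * y m * (\<Sum>i<n. cnj (A $$ (i, l)) * A $$ (i, m)))"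
    unfolding sum_distrib_left by (rule sum.cong[OF refl], rule sum.swap)
  also have "\<dots> = (\<Sum>l<n. \<Sum>m<n. if m = l then cnj (x l) * y m else 0)"
    using unitary_columns[OF assms] by (intro sum.cong refl) auto
  finally show ?thesis by simp
qed

lemma circle_form_gform:
  assumes "A \<in> good_mats n" and n1: "1 \<le> n"
  shows "circle_form n (gform n A)"
proof -
  have U: "unitary_mat n A" and A: "A \<in> carrier_mat n n" and D: "det (krylov n A) \<noteq> 0"
    using assms by (auto simp: good_mats_def unitary_mat_def)
  have self: "gform n A p p = of_real (\<Sum>i<n. (cmod (kpoly A p i))\<^sup>2)" for p
    unfolding gform_def complex_cnj_mult_self by simp
  show ?thesis
  proof
    fix p q r :: "complex poly" and c
    show "gform n A p (q + r) = gform n A p q + gform n A p r"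
      by (simp add: gform_def kpoly_add sum.distrib algebra_simps)
    show "gform n A p (Polynomial.smult c q) = c * gform n A p q"
      by (simp add: gform_def kpoly_smult sum_distrib_left algebra_simps)
    show "gform n A q p = cnj (gform n A p q)"
      by (simp add: gform_def mult.commute)
    show "gform n A (pCons 0 p) (pCons 0 q) = gform n A p q"
      using unitary_preserves[OF U, of "kpoly A p" "kpoly A q"] by (simp add: gform_def kpoly_pCons_0[OF A])
    show "0 \<le> Re (gform n A p p)" unfolding self by (simp add: sum_nonneg)
    show "p = 0" if "degree p < n" "gform n A p p = 0"
    proof -
      have "(\<Sum>i<n. (cmod (kpoly A p i))\<^sup>2) = 0" using that(2) unfolding self by (simp only: of_real_eq_0_iff)
      then have "\<forall>i\<in>{..<n}. (cmod (kpoly A p i))\<^sup>2 = 0" by (subst (asm) sum_nonneg_eq_0_iff) auto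
      then have "\<forall>i<n. kpoly A p i = 0" by simp
      then show ?thesis using D that(1) det_krylov_0_iff by blast
    qed
    show "\<exists>Q. degree Q = n \<and> lead_coeff Q = 1 \<and> gform n A Q Q = 0"
    proof -
      have K: "krylov n A \<in> carrier_mat n n" by (simp add: krylov_def)
      obtain B where B: "B \<in> carrier_mat n n" "krylov n A * B = 1\<^sub>m n"
        using det_non_zero_imp_unit[OF K D, of undefined] unfolding Units_def ring_mat_def by auto
      \<comment> \<open>Invertibility of the Krylov matrix expresses A^n e_1 through lower powers.
        The resulting monic \<open>Q\<close> of degree \<open>n\<close> satisfies Q(A) e_1 = 0 and
        serves as the null polynomial.\<close>
      define w where "w = vec n (kr A n)"
      define v where "v = B *\<^sub>v w"
      have w: "w \<in> carrier_vec n" and v: "v \<in> carrier_vec n" using B by (auto simp: w_def v_def)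
      have "krylov n A *\<^sub>v v = w"
        unfolding v_def using B K w by (simp flip: assoc_mult_mat_vec)
      then have Kv: "(\<Sum>k<n. v $ k * kr A k i) = kr A n i" if "i < n" for i
        using that v by (auto simp: krylov_def w_def scalar_prod_def atLeast0LessThan mult.commute dest!: arg_cong[of _ _ "\<lambda>x. x $ i"])
      define Q where "Q = monom 1 n - (\<Sum>k<n. monom (v $ k) k)"
      have cQ: "coeff Q j = (if j = n then 1 else if j < n then - (v $ j) else 0)" for j
      proof -
        have "(\<Sum>k<n. coeff (monom (v $ k) k) j) = (\<Sum>k<n. if k = j then v $ j else 0)"
          by (intro sum.cong) auto
        then show ?thesis by (simp add: Q_def coeff_sum)
      qed
      have dQ: "degree Q = n"
        by (rule antisym) (auto intro!: degree_le le_degree simp: cQ)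
      have "kpoly A Q i = 0" if "i < n" for i
      proof -
        have "kpoly A Q i = (\<Sum>k<n. coeff Q k * kr A k i) + coeff Q n * kr A n i"
          unfolding kpoly_def dQ by (simp add: lessThan_Suc_atMost[symmetric])
        also have "(\<Sum>k<n. coeff Q k * kr A k i) = - (\<Sum>k<n. v $ k * kr A k i)"
          by (simp add: cQ sum_negf)
        finally show ?thesis using Kv[OF that] by (simp add: cQ)
      qed
      then have "gform n A Q Q = 0" by (simp add: gform_def)
      then show ?thesis using dQ cQ[of n] by (intro exI[of _ Q]) simp
    qed
    have "gform n A 1 1 = (\<Sum>i<n. if i = 0 then 1 else 0)"
      unfolding gform_def using kpoly_1[OF A] by (intro sum.cong) auto
    then show "gform n A 1 1 = 1" using n1 by simp
  qed
qed

text \<open>If the determinant vanishes, a nonzero vector \<open>w\<close> in the left kernel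
  annihilates the first \<open>n\<close> Krylov vectors, a polynomial relation carries this to all
  powers, and the span lies in a hyperplane. Conversely, the inverse Krylov matrix writes any vector
  through A^k e_1 with k < n.\<close>

lemma cyclic_vec_iff_det:
  assumes A: "A \<in> carrier_mat n n" and n1: "1 \<le> n"
  shows "cyclic_vec n A (unit_vec n 0) \<longleftrightarrow> det (krylov n A) \<noteq> 0"
proof -
  interpret vec_module "TYPE(complex)" n .
  let ?G = "range (\<lambda>k. (A ^\<^sub>m k) *\<^sub>v unit_vec n 0)"
  have gi: "((A ^\<^sub>m k) *\<^sub>v unit_vec n 0) $ i = kr A k i" if "i < n" for k i
    using that A n1 by (simp add: kr_def scalar_prod_def atLeast0LessThan unit_vec_def if_distrib[of "\<lambda>x. _ * x"] cong: if_cong)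
  have G1: "(A ^\<^sub>m k) *\<^sub>v unit_vec n 0 \<in> carrier_vec n" for k
    using pow_carrier_mat[OF A, of k] by (rule mult_mat_vec_carrier) simp
  then have G: "?G \<subseteq> carrier_vec n" by auto
  have sub: "submodule class_ring (span ?G) V" using G by (intro span_is_submodule) (simp add: module_vec_simps)
  have own: "?G \<subseteq> span ?G" using G by (intro in_own_span) (simp add: module_vec_simps)
  show ?thesis
    unfolding cyclic_vec_def
  proof
    assume sp: "span ?G = carrier_vec n"
    show "det (krylov n A) \<noteq> 0"
    proof
      assume D: "det (krylov n A) = 0"
      then obtain p where p: "p \<noteq> 0" "degree p < n" "\<forall>i<n. kpoly A p i = 0"
        using det_krylov_0_iff by blast
      let ?K = "transpose_mat (krylov n A)"
      have "det ?K = 0" using D by (simp add: det_transpose[of _ n] krylov_def)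
      moreover have KT: "?K \<in> carrier_mat n n" by (simp add: krylov_def)
      ultimately obtain w where w: "w \<in> carrier_vec n" "w \<noteq> 0\<^sub>v n" "?K *\<^sub>v w = 0\<^sub>v n"
        using det_0_iff_vec_prod_zero[OF KT] by blast
      have w0: "(\<Sum>i<n. w $ i * kr A k i) = 0" if "k < n" for k
      proof -
        have "(?K *\<^sub>v w) $ k = (\<Sum>i<n. w $ i * kr A k i)"
          using that w(1) by (simp add: krylov_def scalar_prod_def atLeast0LessThan mult.commute)
        then show ?thesis using w that by simp
      qed
      have wall: "(\<Sum>i<n. w $ i * kr A k i) = 0" for k
      proof (induction k rule: less_induct)
        case (less k)
        show ?case
        proof (cases "k < n")
          case False
          \<comment> \<open>Here \<open>k\<close> is at least \<open>n\<close> and hence exceeds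
            \<open>d\<close>. The relation p(A) e_1 = 0 multiplied by A^(k - d) expresses the k-th
            Krylov vector through earlier ones, its top coefficient being nonzero.\<close>
          define d where "d = degree p"
          have k: "k = (k - d) + d" using False p d_def by simp
          have rel: "(\<Sum>j\<le>d. coeff p j * kr A (l + j) i) = 0" if "i < n" for l i
            using that
          proof (induction l arbitrary: i)
            case 0
            then show ?case using p by (simp add: kpoly_def d_def)
          next
            case (Suc l)
            have "(\<Sum>j\<le>d. coeff p j * kr A (Suc l + j) i) = (\<Sum>j\<le>d. \<Sum>m<n. A $$ (i, m) * (coeff p j * kr A (l + j) m))"
              using kr_Suc[OF A Suc.prems] by (simp add: sum_distrib_left mult_ac)
            also have "\<dots> = (\<Sum>m<n. A $$ (i, m) * (\<Sum>j\<le>d. coeff p j * kr A (l + j) m))"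
              by (subst sum.swap) (simp add: sum_distrib_left)
            finally show ?case using Suc.IH by simp
          qed
          have "0 = (\<Sum>i<n. w $ i * (\<Sum>j\<le>d. coeff p j * kr A (k - d + j) i))"
            using rel by simp
          also have "\<dots> = (\<Sum>j\<le>d. coeff p j * (\<Sum>i<n. w $ i * kr A (k - d + j) i))"
            unfolding sum_distrib_left by (subst sum.swap) (simp add: mult_ac)
          also have "\<dots> = (\<Sum>j<d. coeff p j * (\<Sum>i<n. w $ i * kr A (k - d + j) i)) +
              coeff p d * (\<Sum>i<n. w $ i * kr A k i)"
            using k by (simp add: lessThan_Suc_atMost[symmetric])
          also have "(\<Sum>j<d. coeff p j * (\<Sum>i<n. w $ i * kr A (k - d + j) i)) = 0"
            using less k by (intro sum.neutral) auto
          finally show ?thesis using p by (simp add: d_def)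
        qed (use w0 in simp)
      qed
      let ?N = "{v \<in> carrier_vec n. (\<Sum>i<n. w $ i * v $ i) = 0}"
      have "submodule class_ring ?N V"
        unfolding submodule_def
        by (auto simp: module_vec_simps vec_module sum.distrib distrib_left sum_distrib_left[symmetric] mult.left_commute)
      moreover have "?G \<subseteq> ?N" using G wall gi by auto
      ultimately have "span ?G \<subseteq> ?N" by (rule span_is_subset[rotated])
      then have all: "(\<Sum>i<n. w $ i * v $ i) = 0" if "v \<in> carrier_vec n" for v using sp that by auto
      have "w $ j = 0" if "j < n" for j
        using all[of "unit_vec n j"] that by (simp add: unit_vec_def if_distrib[of "\<lambda>x. _ * x"] cong: if_cong)
      then show False using w by (auto simp: vec_eq_iff)
    qed
  next
    assume D: "det (krylov n A) \<noteq> 0"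
    have K: "krylov n A \<in> carrier_mat n n" by (simp add: krylov_def)
    obtain B where B: "B \<in> carrier_mat n n" "krylov n A * B = 1\<^sub>m n"
      using det_non_zero_imp_unit[OF K D, of undefined] unfolding Units_def ring_mat_def by auto
    show "span ?G = carrier_vec n"
    proof
      show "span ?G \<subseteq> carrier_vec n" using G by (rule span_is_subset2)
      show "carrier_vec n \<subseteq> span ?G"
      proof
        fix u :: "complex Matrix.vec" assume u: "u \<in> carrier_vec n"
        define v where "v = B *\<^sub>v u"
        have v: "v \<in> carrier_vec n" using B u by (auto simp: v_def)
        have Kv: "krylov n A *\<^sub>v v = u"
          unfolding v_def using B K u by (simp flip: assoc_mult_mat_vec)
        have part: "vec n (\<lambda>i. \<Sum>k<m. v $ k * kr A k i) \<in> span ?G" for m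
        proof (induction m)
          case 0
          have "vec n (\<lambda>i. \<Sum>k<0. v $ k * kr A k i) = 0\<^sub>v n" by auto
          then show ?case using sub by (simp add: submodule_def module_vec_simps)
        next
          case (Suc m)
          have "(A ^\<^sub>m m) *\<^sub>v unit_vec n 0 \<in> span ?G" using own by auto
          then have "v $ m \<cdot>\<^sub>v ((A ^\<^sub>m m) *\<^sub>v unit_vec n 0) \<in> span ?G"
            using sub by (simp add: submodule_def module_vec_simps)
          then have "vec n (\<lambda>i. \<Sum>k<m. v $ k * kr A k i) + v $ m \<cdot>\<^sub>v ((A ^\<^sub>m m) *\<^sub>v unit_vec n 0) \<in> span ?G"
            using Suc sub by (simp add: submodule_def module_vec_simps)
          also have "vec n (\<lambda>i. \<Sum>k<m. v $ k * kr A k i) + v $ m \<cdot>\<^sub>v ((A ^\<^sub>m m) *\<^sub>v unit_vec n 0) =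
              vec n (\<lambda>i. \<Sum>k<Suc m. v $ k * kr A k i)"
            using A gi by (intro eq_vecI) auto
          finally show ?case .
        qed
        have "vec n (\<lambda>i. \<Sum>k<n. v $ k * kr A k i) = krylov n A *\<^sub>v v"
          using v by (intro eq_vecI) (auto simp: krylov_def scalar_prod_def atLeast0LessThan mult.commute)
        then show "u \<in> span ?G" using part[of n] Kv by simp
      qed
    qed
  qed
qed

section \<open>Spectral measures\<close>

lemma AE_circle:
  assumes "prob_space \<nu>" "measure \<nu> (sphere 0 1) = 1"
  shows "AE z in \<nu>. cmod z = 1"
  using prob_space.AE_prob_1[OF assms] by simp

lemma powi_diff_circle:
  assumes "cmod z = 1"
  shows "cnj (z ^ i) * z ^ j = z powi (int j - int i)"
proof -
  have "z \<noteq> 0" using assms by auto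
  have "cnj z = inverse z"
    using assms complex_norm_square[of z] \<open>z \<noteq> 0\<close> by (simp add: field_simps)
  then have "cnj (z ^ i) = inverse (z ^ i)" by (simp add: power_inverse)
  then show ?thesis
    using \<open>z \<noteq> 0\<close> by (simp add: power_int_diff field_simps)
qed

lemma cnj_poly_mult_poly:
  "cnj (poly p z) * poly q z =
    (\<Sum>i\<le>degree p. \<Sum>j\<le>degree q. cnj (coeff p i) * coeff q j * (cnj (z ^ i) * z ^ j))"
  by (simp only: poly_altdef cnj_sum sum_product complex_cnj_mult) (simp only: mult_ac)

lemma integrable_powi:
  assumes "prob_space \<nu>" "sets \<nu> = sets borel" "measure \<nu> (sphere 0 1) = 1"
  shows "integrable \<nu> (\<lambda>z. cnj (z ^ i) * z ^ j)"
proof -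
  interpret prob_space \<nu> by fact
  show ?thesis
  proof (rule integrable_const_bound[where B = 1])
    show "AE z in \<nu>. norm (cnj (z ^ i) * z ^ j) \<le> 1"
      using AE_circle[OF assms(1,3)] by eventually_elim (simp add: norm_mult norm_power)
    have "(\<lambda>z. cnj (z ^ i) * z ^ j) \<in> borel_measurable borel"
      by (intro borel_measurable_continuous_onI continuous_intros)
    then show "(\<lambda>z. cnj (z ^ i) * z ^ j) \<in> borel_measurable \<nu>"
      using assms(2) by (simp cong: measurable_cong_sets)
  qed
qed

text \<open>Writes the form through integer moments for any probability measure on the circle, with
  no assumption on its support. Measures with equal moments then have equal forms, as the uniqueness
  of the spectral measure requires.\<close>

lemma mform_moments:
  assumes \<nu>: "prob_space \<nu>" "sets \<nu> = sets borel" "measure \<nu> (sphere 0 1) = 1"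
  shows "mform \<nu> p q = (\<Sum>i\<le>degree p. \<Sum>j\<le>degree q. cnj (coeff p i) * coeff q j * (LINT z|\<nu>. z powi (int j - int i)))"
proof -
  have moment: "(LINT z|\<nu>. cnj (z ^ i) * z ^ j) = (LINT z|\<nu>. z powi (int j - int i))" for i j
  proof (rule integral_cong_AE)
    have m: "(\<lambda>z. cnj (z ^ i) * z ^ j) \<in> borel_measurable \<nu>" by (rule borel_measurable_integrable, rule integrable_powi[OF \<nu>])
    show "(\<lambda>z. cnj (z ^ i) * z ^ j) \<in> borel_measurable \<nu>" by (rule m)
    have "(\<lambda>z :: complex. z powi k) \<in> borel_measurable borel" for k
      by (cases k rule: int_cases4) (simp_all add: power_int_minus)
    then show "(\<lambda>z. z powi (int j - int i)) \<in> borel_measurable \<nu>"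
      using \<nu>(2) by (simp cong: measurable_cong_sets)
    show "AE z in \<nu>. cnj (z ^ i) * z ^ j = z powi (int j - int i)"
      using AE_circle[OF \<nu>(1,3)] by eventually_elim (rule powi_diff_circle)
  qed
  have "mform \<nu> p q = (LINT z|\<nu>. (\<Sum>i\<le>degree p. \<Sum>j\<le>degree q. cnj (coeff p i) * coeff q j * (cnj (z ^ i) * z ^ j)))"
    unfolding mform_def cnj_poly_mult_poly ..
  also have "\<dots> = (\<Sum>i\<le>degree p. \<Sum>j\<le>degree q. cnj (coeff p i) * coeff q j * (LINT z|\<nu>. cnj (z ^ i) * z ^ j))"
    using integrable_powi[OF \<nu>] by (simp add: Bochner_Integration.integral_sum)
  also have "\<dots> = (\<Sum>i\<le>degree p. \<Sum>j\<le>degree q. cnj (coeff p i) * coeff q j * (LINT z|\<nu>. z powi (int j - int i)))"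
    unfolding moment ..
  finally show ?thesis .
qed

lemma circle_measure_pts_sphere:
  assumes "circle_measure_pts n \<mu>"
  shows "prob_space \<mu>" "sets \<mu> = sets borel" "measure \<mu> (sphere 0 1) = 1"
proof -
  show p: "prob_space \<mu>" and s: "sets \<mu> = sets borel" using assms by (auto simp: circle_measure_pts_def)
  interpret prob_space \<mu> by fact
  have "measure \<mu> (atoms \<mu>) \<le> measure \<mu> (sphere 0 1)"
    using assms by (intro finite_measure_mono) (auto simp: circle_measure_pts_def s)
  then show "measure \<mu> (sphere 0 1) = 1"
    using assms by (intro antisym prob_le_1) (simp add: circle_measure_pts_def)
qed

abbreviation galph :: "nat \<Rightarrow> complex Matrix.mat \<Rightarrow> nat \<Rightarrow> complex" where
  "galph n A \<equiv> circle_form.alph (gform n A)"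

lemma galph_in_range:
  assumes "A \<in> good_mats n" "1 \<le> n"
  shows "galph n A \<in> verb_range n"
  using circle_form.alph_less_1[OF circle_form_gform[OF assms]] circle_form.alph_last[OF circle_form_gform[OF assms]]
  by (auto simp: verb_range_def)

text \<open>The measure is built from the coefficients of the matrix form, so both forms have the
  same \<open>alph\<close> and agree by \<open>circle_form_determined\<close>. This replaces the
  spectral theorem for a unitary matrix with cyclic vector.\<close>

lemma mform_verblunsky_measure_galph:
  assumes A: "A \<in> good_mats n" and n1: "1 \<le> n"
  shows "mform (verblunsky_measure n (galph n A)) p q = gform n A p q"
proof -
  note props = verblunsky_measure_props[OF galph_in_range[OF A n1] n1]
  show ?thesis
    by (rule circle_form_determined[OF circle_form_mform[OF props(1)] circle_form_gform[OF A n1]])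
      (rule props(2))
qed

lemma unitary_powi_moment:
  assumes A: "A \<in> carrier_mat n n" and n1: "1 \<le> n"
  shows "(unitary_powi A k *\<^sub>v unit_vec n 0) \<bullet>c unit_vec n 0 =
    (if k \<ge> 0 then kr A (nat k) 0 else cnj (kr A (nat (- k)) 0))"
proof -
  have entry: "(B *\<^sub>v unit_vec n 0) \<bullet>c unit_vec n 0 = B $$ (0, 0)" if B: "B \<in> carrier_mat n n" for B :: "complex Matrix.mat"
  proof -
    have "(B *\<^sub>v unit_vec n 0) \<bullet>c unit_vec n 0 = (\<Sum>i<n. (B *\<^sub>v unit_vec n 0) $ i * cnj (unit_vec n 0 $ i))"
      using B by (simp add: scalar_prod_def atLeast0LessThan)
    also have "\<dots> = (\<Sum>i<n. if i = 0 then (B *\<^sub>v unit_vec n 0) $ 0 else 0)"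
      by (intro sum.cong) (auto simp: unit_vec_def)
    also have "\<dots> = (B *\<^sub>v unit_vec n 0) $ 0" using n1 by simp
    also have "\<dots> = B $$ (0, 0)"
      using B n1 by (simp add: scalar_prod_def atLeast0LessThan unit_vec_def if_distrib[of "\<lambda>x. _ * x"] cong: if_cong)
    finally show ?thesis .
  qed
  have adj: "(mat_adjoint A ^\<^sub>m m) $$ (i, j) = cnj ((A ^\<^sub>m m) $$ (j, i))" if "i < n" "j < n" for m i j
    using that
  proof (induction m arbitrary: i j)
    case 0
    then show ?case using A mat_adjoint_carrier[OF A] by auto
  next
    case (Suc m)
    note A' = mat_adjoint_carrier[OF A]
    have "(mat_adjoint A ^\<^sub>m Suc m) $$ (i, j) = (\<Sum>l<n. (mat_adjoint A ^\<^sub>m m) $$ (i, l) * mat_adjoint A $$ (l, j))"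
      using mat_mult_index[OF pow_carrier_mat[OF A'] A' Suc.prems] by simp
    also have "\<dots> = cnj (\<Sum>l<n. A $$ (j, l) * (A ^\<^sub>m m) $$ (l, i))"
      using Suc mat_adjoint_index[OF A] by (simp add: mult.commute)
    also have "(\<Sum>l<n. A $$ (j, l) * (A ^\<^sub>m m) $$ (l, i)) = (A ^\<^sub>m Suc m) $$ (j, i)"
      using mat_mult_index[OF A pow_carrier_mat[OF A] Suc.prems(2,1)] pow_mat_commute[OF A] by simp
    finally show ?case .
  qed
  show ?thesis
  proof (cases "k \<ge> 0")
    case True
    then show ?thesis using entry[OF pow_carrier_mat[OF A]] by (simp add: unitary_powi_def kr_def)
  next
    case False
    then show ?thesis
      using entry[OF pow_carrier_mat[OF mat_adjoint_carrier[OF A]]] adj[of 0 0] n1 by (simp add: unitary_powi_def kr_def)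
  qed
qed

lemma gform_moments:
  assumes A: "A \<in> carrier_mat n n" and n1: "1 \<le> n"
  shows "gform n A 1 (monom 1 m) = kr A m 0"
proof -
  have "gform n A 1 (monom 1 m) = (\<Sum>i<n. if i = 0 then kr A m 0 else 0)"
    unfolding gform_def using kpoly_1[OF A] by (intro sum.cong) (auto simp: kpoly_monom)
  then show ?thesis using n1 by simp
qed

lemma spectral_measure_good:
  assumes A: "A \<in> good_mats n" and n1: "1 \<le> n"
  shows "spectral_measure n A (unit_vec n 0) = verblunsky_measure n (galph n A)"
proof -
  define \<mu> where "\<mu> = verblunsky_measure n (galph n A)"
  have U: "unitary_mat n A" and Ac: "A \<in> carrier_mat n n" and D: "det (krylov n A) \<noteq> 0"
    using A by (auto simp: good_mats_def unitary_mat_def)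
  have cyc: "cyclic_vec n A (unit_vec n 0)" using cyclic_vec_iff_det[OF Ac n1] D by simp
  have \<mu>: "circle_measure_pts n \<mu>"
    unfolding \<mu>_def by (rule verblunsky_measure_props(1)[OF galph_in_range[OF A n1] n1])
  note \<mu>s = circle_measure_pts_sphere[OF \<mu>]
  have form: "mform \<mu> p q = gform n A p q" for p q
    unfolding \<mu>_def by (rule mform_verblunsky_measure_galph[OF A n1])
  have e: "unit_vec n 0 \<bullet>c unit_vec n 0 = (1 :: complex)"
    using unitary_powi_moment[OF Ac n1, of 0] Ac n1 by (simp add: unitary_powi_def kr_0)
  have mom: "(unitary_powi A k *\<^sub>v unit_vec n 0) \<bullet>c unit_vec n 0 = (LINT z|\<mu>. z powi k)" for k
  proof -
    have pos: "kr A m 0 = (LINT z|\<mu>. z ^ m)" for m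
      using form[of 1 "monom 1 m"] gform_moments[OF Ac n1, of m] by (simp add: mform_def poly_monom)
    show ?thesis
    proof (cases "k \<ge> 0")
      case True
      then show ?thesis using unitary_powi_moment[OF Ac n1, of k] pos[of "nat k"] by (simp add: power_int_def)
    next
      case False
      define m where "m = nat (- k)"
      have k: "k = - int m" using False by (simp add: m_def)
      have "cnj (LINT z|\<mu>. z ^ m) = cnj (mform \<mu> 1 (monom 1 m))" by (simp add: mform_def poly_monom)
      also have "\<dots> = mform \<mu> (monom 1 m) 1"
        by (rule circle_form.form_cnj[OF circle_form_mform[OF \<mu>], symmetric])
      also have "\<dots> = (LINT z|\<mu>. z powi (0 - int m))"
      proof -
        define I where "I k = (LINT z|\<mu>. z powi k)" for k
        have "mform \<mu> (monom 1 m) 1 = (\<Sum>i\<le>m. \<Sum>j\<le>0. cnj (coeff (monom 1 m) i) * coeff 1 j * I (int j - int i))"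
          using mform_moments[OF \<mu>s, of "monom 1 m" 1]
          by (simp only: degree_monom_eq[OF one_neq_zero] degree_1 I_def)
        also have "\<dots> = (\<Sum>i\<le>m. if i = m then I (0 - int m) else 0)"
          by (intro sum.cong) auto
        finally show ?thesis by (simp add: I_def)
      qed
      finally have "cnj (kr A m 0) = (LINT z|\<mu>. z powi k)" unfolding pos k by simp
      moreover have "(unitary_powi A k *\<^sub>v unit_vec n 0) \<bullet>c unit_vec n 0 = cnj (kr A m 0)"
        unfolding unitary_powi_moment[OF Ac n1] m_def using False by simp
      ultimately show ?thesis by simp
    qed
  qed
  have "(THE \<nu>. prob_space \<nu> \<and> sets \<nu> = sets borel \<and> measure \<nu> (sphere 0 1) = 1 \<and>
           (\<forall>k::int. (unitary_powi A k *\<^sub>v unit_vec n 0) \<bullet>c unit_vec n 0 = (LINT z|\<nu>. z powi k))) = \<mu>"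
  proof (rule the_equality)
    fix \<nu> assume "prob_space \<nu> \<and> sets \<nu> = sets borel \<and> measure \<nu> (sphere 0 1) = 1 \<and>
           (\<forall>k::int. (unitary_powi A k *\<^sub>v unit_vec n 0) \<bullet>c unit_vec n 0 = (LINT z|\<nu>. z powi k))"
    then have \<nu>: "prob_space \<nu>" "sets \<nu> = sets borel" "measure \<nu> (sphere 0 1) = 1"
      and mom': "\<And>k. (LINT z|\<nu>. z powi k) = (LINT z|\<mu>. z powi k)"
      using mom by auto
    have same: "mform \<nu> p q = mform \<mu> p q" for p q
      unfolding mform_moments[OF \<nu>] mform_moments[OF \<mu>s] mom' ..
    interpret M: finite_supp_measure \<mu> "atoms \<mu>" by (rule circle_measure_pts_finite_supp) fact
    interpret N: prob_space \<nu> by fact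
    \<comment> \<open>The nodal polynomial of \<open>\<mu>\<close> has norm zero. Equal moments give
      equal forms, so |P|^2 also has integral 0 under \<open>\<nu>\<close>, which is therefore
      carried by the atoms of \<open>\<mu>\<close>; there \<open>finite_supp_measure_eqI\<close>
      applies.\<close>
    define P where "P = (\<Prod>\<zeta>\<in>atoms \<mu>. [:- \<zeta>, 1:])"
    have P0: "poly P z = 0 \<longleftrightarrow> z \<in> atoms \<mu>" for z
      using M.finite_S by (auto simp: P_def poly_prod)
    have "mform \<nu> P P = 0" unfolding same by (simp add: M.mform_eq P0)
    then have "(LINT z|\<nu>. complex_of_real ((cmod (poly P z))\<^sup>2)) = 0"
      unfolding mform_def complex_cnj_mult_self .
    then have int0: "(LINT z|\<nu>. (cmod (poly P z))\<^sup>2) = 0"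
      by (simp only: integral_complex_of_real of_real_eq_0_iff)
    have integ: "integrable \<nu> (\<lambda>z. (cmod (poly P z))\<^sup>2)"
    proof -
      have "integrable \<nu> (\<lambda>z. \<Sum>i\<le>degree P. \<Sum>j\<le>degree P. cnj (coeff P i) * coeff P j * (cnj (z ^ i) * z ^ j))"
        using integrable_powi[OF \<nu>] by simp
      also have "(\<lambda>z. \<Sum>i\<le>degree P. \<Sum>j\<le>degree P. cnj (coeff P i) * coeff P j * (cnj (z ^ i) * z ^ j)) =
          (\<lambda>z. complex_of_real ((cmod (poly P z))\<^sup>2))"
        unfolding complex_cnj_mult_self[symmetric] cnj_poly_mult_poly ..
      finally show ?thesis by (simp only: complex_of_real_integrable_eq)
    qed
    have "AE z in \<nu>. (cmod (poly P z))\<^sup>2 = 0"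
      using integral_nonneg_eq_0_iff_AE[OF integ] int0 by simp
    then have ae: "AE z in \<nu>. z \<in> atoms \<mu>" by (simp add: P0)
    have at: "atoms \<mu> \<in> sets \<nu>" using M.sets_S(1) \<nu>(2) by simp
    have "measure \<nu> (atoms \<mu>) = 1" using N.AE_in_set_eq_1[OF at] ae by simp
    then have "finite_supp_measure \<nu> (atoms \<mu>)"
      using \<nu> M.finite_S by (simp add: finite_supp_measure_def finite_supp_measure_axioms_def)
    moreover have "finite_supp_measure \<mu> (atoms \<mu>)" by unfold_locales
    ultimately show "\<nu> = \<mu>"
    proof (rule finite_supp_measure_eqI)
      show "(LINT z|\<nu>. poly p z) = (LINT z|\<mu>. poly p z)" for p
        using same[of 1 p] by (simp add: mform_def)
    qed
  qed (use \<mu>s mom in auto)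
  then show ?thesis
    unfolding spectral_measure_def \<mu>_def[symmetric] using U e cyc by simp
qed

text \<open>The default value does not depend on \<open>A\<close>, so the deformed coefficients are
  constant off \<open>good_mats n\<close>; this half of the case split enters
  \<open>measurable_gcoef\<close>.\<close>

lemma spectral_measure_not_good:
  assumes "A \<notin> good_mats n" and n1: "1 \<le> n"
  shows "spectral_measure n A (unit_vec n 0) = undefined"
proof -
  have "\<not> (unitary_mat n A \<and> cyclic_vec n A (unit_vec n 0))"
    using assms cyclic_vec_iff_det[OF _ n1, of A] by (auto simp: good_mats_def unitary_mat_def)
  then show ?thesis unfolding spectral_measure_def by auto
qed

lemma deformed_cong: "(\<And>j. j \<le> k \<Longrightarrow> \<alpha> j = \<alpha>' j) \<Longrightarrow> deformed \<alpha> k = deformed \<alpha>' k"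
  unfolding deformed_def by (simp add: szego_cong[of _ \<alpha> \<alpha>'] del: szego.simps)

lemma deformed_spectral_good:
  assumes A: "A \<in> good_mats n" and n1: "1 \<le> n" and k: "k < n"
  shows "deformed_verblunsky (spectral_measure n A (unit_vec n 0)) k = deformed (galph n A) k"
proof -
  note props = verblunsky_measure_props[OF galph_in_range[OF A n1] n1]
  have "deformed_verblunsky (spectral_measure n A (unit_vec n 0)) k =
      deformed (malph (verblunsky_measure n (galph n A))) k"
    unfolding spectral_measure_good[OF A n1] by (rule deformed_verblunsky_eq[OF props(1) k])
  also have "\<dots> = deformed (galph n A) k" using k by (intro deformed_cong props(2)) simp
  finally show ?thesis .
qed

text \<open>The nodal polynomial P annihilates e_1. For an atom zeta write P = (z - zeta) R;
  cyclicity gives R(A) e_1 \<noteq> 0 because R has degree below n, and this vector is an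
  eigenvector for zeta. So the n distinct atoms are all the roots.\<close>

lemma char_poly_good:
  assumes A: "A \<in> good_mats n" and n1: "1 \<le> n"
  defines "\<mu> \<equiv> verblunsky_measure n (galph n A)"
  shows "char_poly A = (\<Prod>\<zeta>\<in>atoms \<mu>. [:- \<zeta>, 1:])"
proof -
  have Ac: "A \<in> carrier_mat n n" and D: "det (krylov n A) \<noteq> 0"
    using A by (auto simp: good_mats_def unitary_mat_def)
  have \<mu>: "circle_measure_pts n \<mu>"
    unfolding \<mu>_def by (rule verblunsky_measure_props(1)[OF galph_in_range[OF A n1] n1])
  interpret M: finite_supp_measure \<mu> "atoms \<mu>" by (rule circle_measure_pts_finite_supp) fact
  have card: "card (atoms \<mu>) = n" using \<mu> by (simp add: circle_measure_pts_def)
  define P where "P = (\<Prod>\<zeta>\<in>atoms \<mu>. [:- \<zeta>, 1:])"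
  have P0: "poly P z = 0 \<longleftrightarrow> z \<in> atoms \<mu>" for z
    using M.finite_S by (auto simp: P_def poly_prod)
  have dP: "degree P = n" using prod_linear_monic(1)[of "atoms \<mu>"] card by (simp add: P_def)
  have "gform n A P P = mform \<mu> P P"
    unfolding \<mu>_def by (rule mform_verblunsky_measure_galph[OF A n1, symmetric])
  also have "\<dots> = 0" by (simp add: M.mform_eq P0)
  finally have "complex_of_real (\<Sum>i<n. (cmod (kpoly A P i))\<^sup>2) = 0"
    unfolding gform_def complex_cnj_mult_self by simp
  then have "(\<Sum>i<n. (cmod (kpoly A P i))\<^sup>2) = 0" by (simp only: of_real_eq_0_iff)
  then have "\<forall>i\<in>{..<n}. (cmod (kpoly A P i))\<^sup>2 = 0" by (subst (asm) sum_nonneg_eq_0_iff) auto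
  then have kP: "kpoly A P i = 0" if "i < n" for i using that by simp
  have "poly (char_poly A) \<zeta> = 0" if \<zeta>: "\<zeta> \<in> atoms \<mu>" for \<zeta>
  proof -
    obtain R where R: "P = [:- \<zeta>, 1:] * R" using P0[of \<zeta>] \<zeta> by (auto simp: poly_eq_0_iff_dvd elim: dvdE)
    have R0: "R \<noteq> 0" using R dP n1 by auto
    have "degree P = degree [:- \<zeta>, 1:] + degree R"
      unfolding R by (intro degree_mult_eq) (use R0 in auto)
    then have dR: "degree R < n" using dP by simp
    define v where "v = vec n (kpoly A R)"
    obtain j where j: "j < n" "kpoly A R j \<noteq> 0" using D det_krylov_0_iff[of n A] R0 dR by blast
    have PR: "P = pCons 0 R + Polynomial.smult (- \<zeta>) R" unfolding R by simp
    have "A *\<^sub>v v = \<zeta> \<cdot>\<^sub>v v"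
    proof (rule eq_vecI)
      fix i assume "i < dim_vec (\<zeta> \<cdot>\<^sub>v v)"
      then have i: "i < n" by (simp add: v_def)
      have "0 = (\<Sum>l<n. A $$ (i, l) * kpoly A R l) - \<zeta> * kpoly A R i"
        using kP[OF i] unfolding PR kpoly_add kpoly_smult kpoly_pCons_0[OF Ac i] by simp
      then show "(A *\<^sub>v v) $ i = (\<zeta> \<cdot>\<^sub>v v) $ i"
        using Ac i by (simp add: v_def scalar_prod_def atLeast0LessThan)
    qed (use Ac in \<open>simp add: v_def\<close>)
    moreover have "v \<noteq> 0\<^sub>v n" using j by (auto simp: v_def vec_eq_iff)
    ultimately have "eigenvalue A \<zeta>"
      unfolding eigenvalue_def eigenvector_def using Ac by (intro exI[of _ v]) (auto simp: v_def)
    then show ?thesis using eigenvalue_root_char_poly[OF Ac] by simp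
  qed
  then show ?thesis
    using degree_monic_char_poly[OF Ac] card M.finite_S by (intro monic_eq_prod_roots) auto
qed

section \<open>The GGT matrix\<close>

lemma ggt_entry:
  assumes \<alpha>: "\<alpha> \<in> verb_range n" and n1: "1 \<le> n" and ij: "i < n" "j < n"
  defines "\<mu> \<equiv> verblunsky_measure n \<alpha>"
  shows "ggt n \<alpha> $$ (i, j) = mform \<mu> (circle_form.onp (mform \<mu>) i) (pCons 0 (circle_form.onp (mform \<mu>) j))"
proof -
  have \<mu>: "circle_measure_pts n \<mu>" unfolding \<mu>_def by (rule verblunsky_measure_props(1)[OF \<alpha> n1])
  interpret circle_form n "mform \<mu>" by (rule circle_form_mform) fact
  have on: "orthonormal_op \<mu> k = onp k" if "k < n" for k
  proof -
    have "complex_of_real (LINT z|\<mu>. (cmod (poly (mop k) z))\<^sup>2) = mform \<mu> (mop k) (mop k)"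
      unfolding mform_def complex_cnj_mult_self by (rule integral_complex_of_real[symmetric])
    then have "(LINT z|\<mu>. (cmod (poly (mop k) z))\<^sup>2) = mnorm k"
      unfolding form_mop_self by (simp only: of_real_eq_iff)
    then show ?thesis
      using monic_op_eq_szego[OF \<mu>, of k] that by (simp add: orthonormal_op_def onp_def mop_eq_szego)
  qed
  show ?thesis
    using ij on[OF ij(1)] on[OF ij(2)] unfolding ggt_def \<mu>_def[symmetric] Let_def by (simp add: mform_def)
qed

text \<open>G^k e_1 is the coordinate vector of z^k in the orthonormal polynomials, by
  \<open>form_expand_shift\<close>. Hence the matrix form of G is the form of the measure; unitarity
  comes from shift invariance and cyclicity from nondegeneracy below degree
  \<open>n\<close>.\<close>

lemma ggt_good:
  assumes \<alpha>: "\<alpha> \<in> verb_range n" and n1: "1 \<le> n"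
  shows "ggt n \<alpha> \<in> good_mats n" and "gform n (ggt n \<alpha>) = mform (verblunsky_measure n \<alpha>)"
proof -
  define \<mu> where "\<mu> = verblunsky_measure n \<alpha>"
  have \<mu>: "circle_measure_pts n \<mu>" unfolding \<mu>_def by (rule verblunsky_measure_props(1)[OF \<alpha> n1])
  interpret circle_form n "mform \<mu>" by (rule circle_form_mform) fact
  define G where "G = ggt n \<alpha>"
  have G: "G \<in> carrier_mat n n" by (simp add: G_def ggt_def Let_def)
  have ent: "G $$ (i, j) = mform \<mu> (onp i) (pCons 0 (onp j))" if "i < n" "j < n" for i j
    unfolding G_def \<mu>_def by (rule ggt_entry[OF \<alpha> n1 that])
  \<comment> \<open>This matches e_1 with the constant polynomial and starts the induction.\<close>
  have "onp 0 = 1" using form_one by (simp add: onp_def mnorm_def)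
  then have "kr G k i = mform \<mu> (onp i) (monom 1 k)" if "i < n" for i k
    using that
  proof (induction k arbitrary: i)
    case 0
    have "mform \<mu> (onp i) 1 = (if i = 0 then 1 else 0)"
      using form_onp[of i 0] 0 n1 by simp
    then show ?case using 0 by (simp add: kr_0[OF G])
  next
    case (Suc k)
    have "kr G (Suc k) i = (\<Sum>l<n. mform \<mu> (onp l) (monom 1 k) * mform \<mu> (onp i) (pCons 0 (onp l)))"
      using Suc ent by (simp add: kr_Suc[OF G] mult.commute)
    then show ?case using form_expand_shift[of "onp i" "monom 1 k"] by (simp add: monom_Suc)
  qed
  then have kG: "kpoly G p i = mform \<mu> (onp i) p" if "i < n" for p i
  proof -
    have "p = (\<Sum>k\<le>degree p. Polynomial.smult (coeff p k) (monom 1 k))"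
      using poly_as_sum_of_monoms[of p, symmetric] by (simp add: smult_monom)
    then have "mform \<mu> (onp i) p = (\<Sum>k\<le>degree p. coeff p k * mform \<mu> (onp i) (monom 1 k))"
      using form_sum[of "onp i" "\<lambda>k. Polynomial.smult (coeff p k) (monom 1 k)" "{..degree p}"] form_smult by simp
    then show ?thesis using that \<open>\<And>k i. i < n \<Longrightarrow> kr G k i = mform \<mu> (onp i) (monom 1 k)\<close> by (simp add: kpoly_def)
  qed
  have gf: "gform n G p q = mform \<mu> p q" for p q
  proof -
    have "gform n G p q = (\<Sum>k<n. mform \<mu> (onp k) q * mform \<mu> p (onp k))"
      unfolding gform_def using kG form_cnj[of p] by (intro sum.cong) (auto simp: mult.commute)
    then show ?thesis using form_expand[of p q] by simp
  qed
  then show "gform n (ggt n \<alpha>) = mform (verblunsky_measure n \<alpha>)"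
    unfolding G_def \<mu>_def by (intro ext)
  have "mat_adjoint G * G = 1\<^sub>m n"
  proof (rule eq_matI)
    fix i j assume "i < dim_row (1\<^sub>m n :: complex Matrix.mat)" "j < dim_col (1\<^sub>m n :: complex Matrix.mat)"
    then have ij: "i < n" "j < n" by auto
    have "(mat_adjoint G * G) $$ (i, j) = (\<Sum>l<n. cnj (G $$ (l, i)) * G $$ (l, j))"
      using mat_mult_index[OF mat_adjoint_carrier[OF G] G ij] mat_adjoint_index[OF G] ij by simp
    also have "\<dots> = (\<Sum>l<n. mform \<mu> (onp l) (pCons 0 (onp j)) * mform \<mu> (pCons 0 (onp i)) (onp l))"
      using ij by (intro sum.cong) (auto simp: ent form_cnj[of "pCons 0 (onp i)"] mult.commute)
    also have "\<dots> = mform \<mu> (onp i) (onp j)"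
      unfolding form_expand[symmetric] by (rule form_shift)
    finally show "(mat_adjoint G * G) $$ (i, j) = 1\<^sub>m n $$ (i, j)" using ij by (simp add: form_onp)
  qed (use G mat_adjoint_carrier[OF G] in auto)
  then have "unitary_mat n G"
    using mat_mult_left_right_inverse[OF mat_adjoint_carrier[OF G] G] G by (simp add: unitary_mat_def)
  moreover have "det (krylov n G) \<noteq> 0"
  proof
    assume "det (krylov n G) = 0"
    then obtain p where p: "p \<noteq> 0" "degree p < n" "\<forall>i<n. kpoly G p i = 0" using det_krylov_0_iff by blast
    then have "mform \<mu> p p = 0" unfolding gf[symmetric] by (simp add: gform_def)
    then show False using form_nondegenerate p by blast
  qed
  ultimately show "ggt n \<alpha> \<in> good_mats n" by (simp add: good_mats_def G_def)
qed

lemma galph_ggt: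
  assumes "\<alpha> \<in> verb_range n" "1 \<le> n" "k < n"
  shows "galph n (ggt n \<alpha>) k = \<alpha> k"
  using verblunsky_measure_props(2)[OF assms] ggt_good(2)[OF assms(1,2)] by simp

lemma deformed_ggt:
  assumes "\<alpha> \<in> verb_range n" "1 \<le> n" "k < n"
  shows "deformed_verblunsky (spectral_measure n (ggt n \<alpha>) (unit_vec n 0)) k = deformed \<alpha> k"
  using deformed_spectral_good[OF ggt_good(1)[OF assms(1,2)] assms(2,3)]
    deformed_cong[of k "galph n (ggt n \<alpha>)" \<alpha>] galph_ggt[OF assms(1,2)] assms(3) by simp

section \<open>The determinant in terms of the deformed coefficients\<close>

definition jweight :: "complex \<Rightarrow> complex \<Rightarrow> complex" where
  "jweight \<delta> z = (1 - z) powr cnj \<delta> * (1 - cnj z) powr \<delta>"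

lemma Re_pos_of_unit_disc:
  assumes "cmod z \<le> 1" "z \<noteq> 1"
  shows "0 < Re (1 - z)"
proof -
  have "Re z \<noteq> 1"
  proof
    assume r: "Re z = 1"
    then have "1 + (Im z)\<^sup>2 \<le> 1" using assms(1) cmod_power2[of z] power_le_one[of "cmod z" 2] by simp
    then have "Im z = 0" by simp
    then show False using r assms(2) by (simp add: complex_eq_iff)
  qed
  moreover have "Re z \<le> 1" using complex_Re_le_cmod[of z] assms(1) by simp
  ultimately show ?thesis by simp
qed

lemma jweight_1 [simp]: "jweight \<delta> 1 = 0"
  by (simp add: jweight_def)

text \<open>In the closed disc without 1, the number 1 - z has positive real part and avoids the
  branch cut. The two logarithms are then conjugate, and so are the two exponents.\<close>

lemma jweight_eq_exp:
  assumes "cmod z \<le> 1" "z \<noteq> 1"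
  shows "jweight \<delta> z = of_real (exp (2 * Re (cnj \<delta> * Ln (1 - z))))"
proof -
  have r: "0 < Re (1 - z)" using assms by (rule Re_pos_of_unit_disc)
  then have nz: "1 - z \<noteq> 0" "1 - cnj z \<noteq> 0" by (auto simp: complex_eq_iff)
  have "1 - z \<notin> \<real>\<^sub>\<le>\<^sub>0" using r by (auto simp: complex_nonpos_Reals_iff)
  then have "Ln (1 - cnj z) = cnj (Ln (1 - z))" using cnj_Ln[of "1 - z"] by simp
  then have "jweight \<delta> z = exp (cnj \<delta> * Ln (1 - z) + cnj (cnj \<delta> * Ln (1 - z)))"
    using nz by (simp add: jweight_def powr_def exp_add)
  also have "cnj \<delta> * Ln (1 - z) + cnj (cnj \<delta> * Ln (1 - z)) = of_real (2 * Re (cnj \<delta> * Ln (1 - z)))"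
    by (rule complex_add_cnj)
  finally show ?thesis by (simp only: exp_of_real)
qed

text \<open>The values lie in the discrete set of integer multiples of 2 pi i, whose distinct points
  are at distance at least 1, so a continuous \<open>f\<close> is constant.\<close>

lemma continuous_log_unique:
  fixes f :: "real \<Rightarrow> complex"
  assumes "continuous_on {0..1} f" "\<And>r. r \<in> {0..1} \<Longrightarrow> exp (f r) = 1" "f 0 = 0"
  shows "f 1 = 0"
proof -
  have "f constant_on {0..1}"
  proof (rule continuous_discrete_range_constant)
    fix x assume x: "x \<in> {0..1::real}"
    have "1 \<le> cmod (f y - f x)" if y: "y \<in> {0..1}" "f y \<noteq> f x" for y
    proof -
      obtain m l :: int where ml: "Im (f y) = of_int (2 * m) * pi" "Im (f x) = of_int (2 * l) * pi"
        and re: "Re (f y) = 0" "Re (f x) = 0"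
        using assms(2)[OF x] assms(2)[OF y(1)] unfolding exp_eq_1 by blast
      have "m \<noteq> l" using y(2) ml re by (auto simp: complex_eq_iff)
      then have "1 \<le> \<bar>real_of_int (m - l)\<bar>" by linarith
      then have "1 * 1 \<le> \<bar>real_of_int (m - l)\<bar> * (2 * pi)" using pi_gt3 by (intro mult_mono) auto
      also have "\<dots> = \<bar>real_of_int (m - l) * (2 * pi)\<bar>" by (simp add: abs_mult)
      also have "\<dots> = \<bar>Im (f y - f x)\<bar>" using ml by (intro arg_cong[of _ _ abs]) (simp add: algebra_simps)
      also have "\<dots> \<le> cmod (f y - f x)" by (rule abs_Im_le_cmod)
      finally show ?thesis by simp
    qed
    then show "\<exists>e>0. \<forall>y. y \<in> {0..1} \<and> f y \<noteq> f x \<longrightarrow> e \<le> cmod (f y - f x)" by (intro exI[of _ 1]) auto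
  qed (use assms in auto)
  then obtain c where "\<And>x. x \<in> {0..1} \<Longrightarrow> f x = c" unfolding constant_on_def by blast
  then show ?thesis using assms(3) by (metis atLeastAtMost_iff order_refl zero_le_one)
qed

text \<open>Both sides are the value at \<open>r = 1\<close> of a continuous logarithm, vanishing at \<open>r = 0\<close>, of
  \<open>\<Phi>\<^sub>n\<^sup>*(r)\<close> on \<open>[0, 1]\<close>; this is why the principal branches match exactly.\<close>

lemma sum_Ln_deformed:
  assumes \<alpha>: "\<alpha> \<in> verb_range n" and n1: "1 \<le> n"
    and S: "finite S" "szego \<alpha> n = (\<Prod>\<zeta>\<in>S. [:- \<zeta>, 1:])" "S \<subseteq> sphere 0 1" "1 \<notin> S"
  shows "(\<Sum>\<zeta>\<in>S. Ln (1 - \<zeta>)) = (\<Sum>k<n. Ln (1 - deformed \<alpha> k))"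
proof -
  \<comment> \<open>The factors of \<open>poly_star_szego_prod\<close> along the radius: at r = 0
    they equal 0, at r = 1 they are the conjugated deformed coefficients.\<close>
  define c where "c k r = \<alpha> k * of_real r * blaschke \<alpha> k (of_real r)" for k r
  have a: "\<And>j. j < n - 1 \<Longrightarrow> cmod (\<alpha> j) < 1" and al: "cmod (\<alpha> (n - 1)) = 1"
    using \<alpha> by (auto simp: verb_range_def)
  have ale: "cmod (\<alpha> j) \<le> 1" if "j < n" for j
  proof (cases "j < n - 1")
    case False
    then have "j = n - 1" using that by simp
    then show ?thesis using al by simp
  qed (use a less_imp_le in blast)
  have card: "card S = n" using degree_szego[of \<alpha> n] unfolding S(2) prod_linear_monic(1) .
  have star: "poly (poly_star (szego \<alpha> n)) (of_real r) = (\<Prod>\<zeta>\<in>S. 1 - of_real r * cnj \<zeta>)" for r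
  proof (cases "r = 0")
    case False
    have "poly (poly_star (szego \<alpha> n)) (of_real r) = of_real r ^ n * cnj (\<Prod>\<zeta>\<in>S. 1 / of_real r - \<zeta>)"
      using False by (subst poly_poly_star) (simp_all add: S(2) poly_prod prod_linear_monic(1) card)
    also have "of_real r ^ n = (\<Prod>\<zeta>\<in>S. complex_of_real r)" by (simp add: card)
    also have "\<dots> * cnj (\<Prod>\<zeta>\<in>S. 1 / of_real r - \<zeta>) = (\<Prod>\<zeta>\<in>S. of_real r * cnj (1 / of_real r - \<zeta>))"
      by (simp add: prod.distrib)
    also have "\<dots> = (\<Prod>\<zeta>\<in>S. 1 - of_real r * cnj \<zeta>)"
      using False by (intro prod.cong) (auto simp: field_simps)
    finally show ?thesis .
  qed (simp add: poly_poly_star_0)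
  have star': "poly (poly_star (szego \<alpha> n)) (of_real r) = (\<Prod>k<n. 1 - c k r)" if "r \<in> {0..1}" for r
    unfolding c_def using that by (intro poly_star_szego_prod a) auto
  have rz: "cmod (of_real r * cnj \<zeta>) \<le> 1 \<and> of_real r * cnj \<zeta> \<noteq> 1" if "r \<in> {0..1}" "\<zeta> \<in> S" for r \<zeta>
  proof -
    have z: "cmod \<zeta> = 1" "\<zeta> \<noteq> 1" using that S by auto
    have "of_real r * cnj \<zeta> \<noteq> 1"
    proof
      assume e: "of_real r * cnj \<zeta> = 1"
      then have "cmod (of_real r * cnj \<zeta>) = 1" by simp
      then have "r = 1" using z that by (simp add: norm_mult)
      then have "cnj \<zeta> = 1" using e by simp
      then show False using z(2) by (metis complex_cnj_cnj complex_cnj_one)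
    qed
    then show ?thesis using z that by (simp add: norm_mult)
  qed
  have cz: "cmod (c k r) \<le> 1 \<and> c k r \<noteq> 1" if r: "r \<in> {0..1}" and k: "k < n" for k r
  proof
    have b: "cmod (blaschke \<alpha> k (of_real r)) \<le> 1"
      using r k a by (intro blaschke_le_1) auto
    have "cmod (\<alpha> k) * (r * cmod (blaschke \<alpha> k (of_real r))) \<le> 1 * (1 * 1)"
      using ale[OF k] r b by (intro mult_mono) auto
    then show "cmod (c k r) \<le> 1" using r by (simp add: c_def norm_mult)
    \<comment> \<open>The Blaschke bound only gives |c| \<le> 1. That no factor hits 1 comes from
      the other factorisation, which does not vanish on [0, 1] since the roots lie on the circle and
      1 is not among them.\<close>
    have "(\<Prod>\<zeta>\<in>S. 1 - of_real r * cnj \<zeta>) \<noteq> 0" using rz[OF r] S(1) by auto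
    then have "(\<Prod>k<n. 1 - c k r) \<noteq> 0" using star star'[OF r] by simp
    then show "c k r \<noteq> 1" using k by auto
  qed
  define f where "f r = (\<Sum>\<zeta>\<in>S. Ln (1 - of_real r * cnj \<zeta>)) - (\<Sum>k<n. Ln (1 - c k r))" for r
  have slit: "1 - w \<notin> \<real>\<^sub>\<le>\<^sub>0" if "cmod w \<le> 1 \<and> w \<noteq> 1" for w
    using Re_pos_of_unit_disc[of w] that by (auto simp: complex_nonpos_Reals_iff)
  have "f 1 = 0"
  proof (rule continuous_log_unique)
    have cc: "continuous_on {0..1} (c k)" if "k < n" for k
    proof -
      have "poly (poly_star (szego \<alpha> k)) (of_real r) \<noteq> 0" if "r \<in> {0..1}" for r
        using szego_star_bounds[of k \<alpha> "of_real r"] that a \<open>k < n\<close> by simp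
      then show ?thesis unfolding c_def[abs_def] blaschke_def by (intro continuous_intros) auto
    qed
    show "continuous_on {0..1} f"
      unfolding f_def using slit rz cz cc by (intro continuous_intros continuous_on_Ln') auto
    fix r :: real assume r: "r \<in> {0..1}"
    have 1: "exp (\<Sum>\<zeta>\<in>S. Ln (1 - of_real r * cnj \<zeta>)) = poly (poly_star (szego \<alpha> n)) (of_real r)"
      unfolding star exp_sum[OF S(1)] using rz[OF r] by (intro prod.cong refl exp_Ln) auto
    have 2: "exp (\<Sum>k<n. Ln (1 - c k r)) = poly (poly_star (szego \<alpha> n)) (of_real r)"
      unfolding star'[OF r] exp_sum[OF finite_lessThan] using cz[OF r] by (intro prod.cong refl exp_Ln) auto
    have "poly (poly_star (szego \<alpha> n)) (of_real r) \<noteq> 0" unfolding star using rz[OF r] S(1) by auto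
    then show "exp (f r) = 1" unfolding f_def exp_diff 1 2 by simp
  next
    show "f 0 = 0" by (simp add: f_def c_def)
  qed
  then have e: "(\<Sum>\<zeta>\<in>S. Ln (1 - cnj \<zeta>)) = (\<Sum>k<n. Ln (1 - c k 1))" by (simp add: f_def)
  have ck: "c k 1 = cnj (deformed \<alpha> k)" if "k < n" for k
    using that a by (simp add: c_def cnj_deformed_eq_blaschke[OF szego_at_1_nonzero])
  have "(\<Sum>\<zeta>\<in>S. Ln (1 - \<zeta>)) = cnj (\<Sum>\<zeta>\<in>S. Ln (1 - cnj \<zeta>))"
    unfolding cnj_sum
  proof (rule sum.cong[OF refl])
    fix \<zeta> assume "\<zeta> \<in> S"
    then show "Ln (1 - \<zeta>) = cnj (Ln (1 - cnj \<zeta>))"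
      using slit[of "cnj \<zeta>"] rz[of 1 \<zeta>] by (simp add: cnj_Ln)
  qed
  also have "\<dots> = (\<Sum>k<n. Ln (1 - deformed \<alpha> k))"
    unfolding e cnj_sum
  proof (rule sum.cong[OF refl])
    fix k assume "k \<in> {..<n}"
    then show "cnj (Ln (1 - c k 1)) = Ln (1 - deformed \<alpha> k)"
      using slit[of "c k 1"] cz[of 1 k] ck[of k] by (simp add: cnj_Ln)
  qed
  finally show ?thesis .
qed

lemma deformed_bounds:
  assumes \<alpha>: "\<alpha> \<in> verb_range n" and k: "k < n"
  shows "cmod (deformed \<alpha> k) = cmod (\<alpha> k)"
proof -
  have nz: "poly (szego \<alpha> k) 1 \<noteq> 0" using \<alpha> k by (intro szego_at_1_nonzero) (auto simp: verb_range_def)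
  then show ?thesis unfolding deformed_eq[OF nz] by (simp add: norm_mult norm_divide)
qed

lemma prod_jweight_deformed:
  assumes \<alpha>: "\<alpha> \<in> verb_range n" and n1: "1 \<le> n"
    and S: "finite S" "szego \<alpha> n = (\<Prod>\<zeta>\<in>S. [:- \<zeta>, 1:])" "S \<subseteq> sphere 0 1"
  shows "(\<Prod>\<zeta>\<in>S. jweight \<delta> \<zeta>) = (\<Prod>k<n. jweight \<delta> (deformed \<alpha> k))"
proof (cases "1 \<in> S")
  case True
  have "poly (szego \<alpha> n) 1 = 0" unfolding S(2) using True S(1) by (auto simp: poly_prod)
  then have "deformed \<alpha> (n - 1) = 1" using n1 by (simp add: deformed_def)
  then have "jweight \<delta> (deformed \<alpha> (n - 1)) = 0" by simp
  then have "(\<Prod>k<n. jweight \<delta> (deformed \<alpha> k)) = 0"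
    using n1 by (intro prod_zero) (auto intro!: bexI[of _ "n - 1"])
  moreover have "(\<Prod>\<zeta>\<in>S. jweight \<delta> \<zeta>) = 0" using True S(1) by (intro prod_zero) (auto intro!: bexI[of _ 1])
  ultimately show ?thesis by simp
next
  case False
  have nz: "poly (szego \<alpha> n) 1 \<noteq> 0" unfolding S(2) using False S(1) by (auto simp: poly_prod)
  have d: "cmod (deformed \<alpha> k) \<le> 1 \<and> deformed \<alpha> k \<noteq> 1" if k: "k < n" for k
  proof
    show "cmod (deformed \<alpha> k) \<le> 1"
      using deformed_bounds[OF \<alpha> k] \<alpha> k by (cases "k = n - 1") (auto simp: verb_range_def intro: less_imp_le)
    show "deformed \<alpha> k \<noteq> 1"
    proof (cases "k = n - 1")
      case True
      have "poly (szego \<alpha> k) 1 \<noteq> 0"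
        using \<alpha> k by (intro szego_at_1_nonzero) (auto simp: verb_range_def)
      then show ?thesis using nz True n1 by (simp add: deformed_def)
    next
      case False
      then have "cmod (deformed \<alpha> k) < 1" using deformed_bounds[OF \<alpha> k] \<alpha> k by (auto simp: verb_range_def)
      then show ?thesis by auto
    qed
  qed
  have "(\<Prod>\<zeta>\<in>S. jweight \<delta> \<zeta>) = (\<Prod>\<zeta>\<in>S. of_real (exp (2 * Re (cnj \<delta> * Ln (1 - \<zeta>)))))"
    using False S(3) by (intro prod.cong refl jweight_eq_exp) auto
  also have "\<dots> = of_real (exp (\<Sum>\<zeta>\<in>S. 2 * Re (cnj \<delta> * Ln (1 - \<zeta>))))"
    by (simp only: exp_sum[OF S(1)] of_real_prod)
  also have "(\<Sum>\<zeta>\<in>S. 2 * Re (cnj \<delta> * Ln (1 - \<zeta>))) = 2 * Re (cnj \<delta> * (\<Sum>\<zeta>\<in>S. Ln (1 - \<zeta>)))"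
    by (simp only: sum_distrib_left Re_sum)
  also have "\<dots> = 2 * Re (cnj \<delta> * (\<Sum>k<n. Ln (1 - deformed \<alpha> k)))"
    using sum_Ln_deformed[OF \<alpha> n1 S False] by simp
  also have "\<dots> = (\<Sum>k<n. 2 * Re (cnj \<delta> * Ln (1 - deformed \<alpha> k)))"
    by (simp only: sum_distrib_left Re_sum)
  also have "complex_of_real (exp \<dots>) = (\<Prod>k<n. of_real (exp (2 * Re (cnj \<delta> * Ln (1 - deformed \<alpha> k)))))"
    by (simp only: exp_sum[OF finite_lessThan] of_real_prod)
  also have "\<dots> = (\<Prod>k<n. jweight \<delta> (deformed \<alpha> k))"
    using d by (intro prod.cong refl jweight_eq_exp[symmetric]) auto
  finally show ?thesis .
qed

lemma det_delta_good:
  assumes A: "A \<in> good_mats n" and n1: "1 \<le> n"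
  shows "det_delta \<delta> A = (\<Prod>k<n. jweight \<delta> (deformed (galph n A) k))"
proof -
  note ra = galph_in_range[OF A n1]
  define \<mu> where "\<mu> = verblunsky_measure n (galph n A)"
  have \<mu>: "circle_measure_pts n \<mu>" unfolding \<mu>_def by (rule verblunsky_measure_props(1)[OF ra n1])
  have S: "finite (atoms \<mu>)" "atoms \<mu> \<subseteq> sphere 0 1" using \<mu> by (auto simp: circle_measure_pts_def)
  have "szego (galph n A) n = szego (malph \<mu>) n"
    unfolding \<mu>_def using verblunsky_measure_props(2)[OF ra n1] by (intro szego_cong) simp
  then have nodal: "szego (galph n A) n = (\<Prod>\<zeta>\<in>atoms \<mu>. [:- \<zeta>, 1:])" using szego_n_roots[OF \<mu>] by simp
  have "proots (char_poly A) = (\<Sum>\<zeta>\<in>atoms \<mu>. proots [:- \<zeta>, 1:])"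
    unfolding char_poly_good[OF A n1] \<mu>_def[symmetric] by (rule proots_prod) simp
  also have "\<dots> = (\<Sum>\<zeta>\<in>atoms \<mu>. {#\<zeta>#})" by (simp add: proots_linear_factor)
  also have "\<dots> = mset_set (atoms \<mu>)" using S(1) by (induction rule: finite_induct) auto
  finally have "det_delta \<delta> A = (\<Prod>\<zeta>\<in>atoms \<mu>. jweight \<delta> \<zeta>)"
    by (simp add: det_delta_def jweight_def prod_unfold_prod_mset)
  then show ?thesis using prod_jweight_deformed[OF ra n1 S(1) nodal S(2)] by simp
qed

section \<open>Measurability\<close>

lemma space_mat_borel: "space (mat_borel n) = carrier_mat n n"
  by (simp add: mat_borel_def)

lemma measurable_mat_entry:
  assumes "i < n" "j < n"
  shows "(\<lambda>A. A $$ (i, j)) \<in> borel_measurable (mat_borel n)"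
proof -
  let ?P = "\<Pi>\<^sub>M ij\<in>{..<n} \<times> {..<n}. (borel :: complex measure)"
  have "(\<lambda>A. \<lambda>ij\<in>{..<n} \<times> {..<n}. A $$ ij) \<in> mat_borel n \<rightarrow>\<^sub>M ?P"
    unfolding mat_borel_def by (rule measurable_vimage_algebra1) (auto simp: space_PiM)
  then have "(\<lambda>A. (\<lambda>ij\<in>{..<n} \<times> {..<n}. A $$ ij) (i, j)) \<in> borel_measurable (mat_borel n)"
    by (rule measurable_compose[OF _ measurable_component_singleton]) (use assms in auto)
  then show ?thesis using assms by simp
qed

lemma measurable_mat_borelI:
  assumes "\<And>x. x \<in> space N \<Longrightarrow> f x \<in> carrier_mat n n"
    and "\<And>i j. \<lbrakk>i < n; j < n\<rbrakk> \<Longrightarrow> (\<lambda>x. f x $$ (i, j)) \<in> borel_measurable N"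
  shows "f \<in> N \<rightarrow>\<^sub>M mat_borel n"
  unfolding mat_borel_def
proof (rule measurable_vimage_algebra2)
  show "(\<lambda>x. \<lambda>ij\<in>{..<n} \<times> {..<n}. f x $$ ij) \<in> N \<rightarrow>\<^sub>M (\<Pi>\<^sub>M ij\<in>{..<n} \<times> {..<n}. borel)"
    using assms(2) by (intro measurable_restrict) auto
qed (use assms(1) in auto)

lemma measurable_kr: "i < n \<Longrightarrow> (\<lambda>A. kr A k i) \<in> borel_measurable (mat_borel n)"
proof (induction k arbitrary: i)
  case 0
  have "(\<lambda>A. kr A 0 i) \<in> borel_measurable (mat_borel n) \<longleftrightarrow>
      (\<lambda>A. if i = 0 then 1 else 0 :: complex) \<in> borel_measurable (mat_borel n)"
    using 0 by (intro measurable_cong) (simp add: space_mat_borel kr_0)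
  then show ?case by simp
next
  case (Suc k)
  have "(\<lambda>A. kr A (Suc k) i) \<in> borel_measurable (mat_borel n) \<longleftrightarrow>
      (\<lambda>A. \<Sum>l<n. A $$ (i, l) * kr A k l) \<in> borel_measurable (mat_borel n)"
    using Suc.prems by (intro measurable_cong) (simp add: space_mat_borel kr_Suc)
  moreover have "(\<lambda>A. \<Sum>l<n. A $$ (i, l) * kr A k l) \<in> borel_measurable (mat_borel n)"
    using Suc measurable_mat_entry by (intro borel_measurable_sum borel_measurable_times) auto
  ultimately show ?case by simp
qed

lemma unitary_mat_iff:
  assumes A: "A \<in> carrier_mat n n"
  shows "unitary_mat n A \<longleftrightarrow> (\<forall>i\<in>{..<n}. \<forall>j\<in>{..<n}. (\<Sum>l<n. cnj (A $$ (l, i)) * A $$ (l, j)) = (if i = j then 1 else 0))"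
proof
  assume "unitary_mat n A"
  then show "\<forall>i\<in>{..<n}. \<forall>j\<in>{..<n}. (\<Sum>l<n. cnj (A $$ (l, i)) * A $$ (l, j)) = (if i = j then 1 else 0)"
    using unitary_columns by simp
next
  note A' = mat_adjoint_carrier[OF A]
  assume h: "\<forall>i\<in>{..<n}. \<forall>j\<in>{..<n}. (\<Sum>l<n. cnj (A $$ (l, i)) * A $$ (l, j)) = (if i = j then 1 else 0)"
  have "mat_adjoint A * A = 1\<^sub>m n"
  proof (rule eq_matI)
    fix i j assume "i < dim_row (1\<^sub>m n :: complex Matrix.mat)" "j < dim_col (1\<^sub>m n :: complex Matrix.mat)"
    then have ij: "i < n" "j < n" by auto
    then show "(mat_adjoint A * A) $$ (i, j) = 1\<^sub>m n $$ (i, j)"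
      using mat_mult_index[OF A' A ij] mat_adjoint_index[OF A] h by simp
  qed (use A A' in auto)
  then show "unitary_mat n A" using mat_mult_left_right_inverse[OF A' A] A by (simp add: unitary_mat_def)
qed

lemma sets_good_mats: "good_mats n \<in> sets (mat_borel n)"
proof -
  let ?M = "mat_borel n"
  \<comment> \<open>The Leibniz expansion: it shows the Krylov determinant to be a polynomial in
    measurable quantities.\<close>
  define D where "D A = (\<Sum>p | p permutes {0..<n}. signof p * (\<Prod>i = 0..<n. kr A (p i) i))" for A
  have D: "det (krylov n A) = D A" for A
  proof -
    have K: "krylov n A \<in> carrier_mat n n" by (simp add: krylov_def)
    show ?thesis unfolding det_def'[OF K] D_def
      by (intro sum.cong refl arg_cong2[of _ _ _ _ "(*)"] prod.cong) (auto simp: krylov_def permutes_in_image)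
  qed
  have "good_mats n = {A \<in> space ?M. (\<forall>i\<in>{..<n}. \<forall>j\<in>{..<n}. (\<Sum>l<n. cnj (A $$ (l, i)) * A $$ (l, j)) = (if i = j then 1 else 0)) \<and> D A \<noteq> 0}"
  proof (rule Set.set_eqI)
    fix A
    show "A \<in> good_mats n \<longleftrightarrow> A \<in> {A \<in> space ?M. (\<forall>i\<in>{..<n}. \<forall>j\<in>{..<n}. (\<Sum>l<n. cnj (A $$ (l, i)) * A $$ (l, j)) = (if i = j then 1 else 0)) \<and> D A \<noteq> 0}"
    proof (cases "A \<in> carrier_mat n n")
      case True
      then show ?thesis unfolding good_mats_def mem_Collect_eq unitary_mat_iff[OF True] D space_mat_borel by simp
    qed (auto simp: good_mats_def space_mat_borel unitary_mat_def)
  qed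
  also have "\<dots> \<in> sets ?M"
  proof -
    have m1: "(\<lambda>A. \<Sum>l<n. cnj (A $$ (l, i)) * A $$ (l, j)) \<in> borel_measurable ?M" if "i < n" "j < n" for i j
      using that measurable_mat_entry
      by (intro borel_measurable_sum borel_measurable_times) (auto intro: measurable_compose[OF _ borel_measurable_continuous_onI[OF continuous_on_cnj[OF continuous_on_id]]])
    have m2: "D \<in> borel_measurable ?M"
      unfolding D_def[abs_def]
      by (intro borel_measurable_sum borel_measurable_times borel_measurable_const borel_measurable_prod measurable_kr) auto
    have "{A \<in> space ?M. \<forall>i\<in>{..<n}. \<forall>j\<in>{..<n}. (\<Sum>l<n. cnj (A $$ (l, i)) * A $$ (l, j)) = (if i = j then 1 else 0)} \<in> sets ?M"
      using m1 by (intro sets.sets_Collect_finite_All borel_measurable_eq borel_measurable_const) auto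
    moreover have "D -` (- {0}) \<inter> space ?M \<in> sets ?M"
      by (rule measurable_sets[OF m2]) simp
    ultimately have "{A \<in> space ?M. \<forall>i\<in>{..<n}. \<forall>j\<in>{..<n}. (\<Sum>l<n. cnj (A $$ (l, i)) * A $$ (l, j)) = (if i = j then 1 else 0)} \<inter>
        (D -` (- {0}) \<inter> space ?M) \<in> sets ?M" by (rule sets.Int)
    then show ?thesis by (rule back_subst[of "\<lambda>X. X \<in> sets ?M"]) auto
  qed
  finally show ?thesis .
qed

section \<open>Measurable dependence of the coefficients on the matrix\<close>

lemma measurable_cnj: "f \<in> borel_measurable N \<Longrightarrow> (\<lambda>x. cnj (f x)) \<in> borel_measurable N"
  by (rule measurable_compose[OF _ borel_measurable_continuous_onI[OF continuous_on_cnj[OF continuous_on_id]]])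

lemma measurable_szego_coeff:
  assumes "\<And>j. j < k \<Longrightarrow> (\<lambda>x. \<alpha> x j) \<in> borel_measurable N"
  shows "(\<lambda>x. coeff (szego (\<alpha> x) k) i) \<in> borel_measurable N"
  using assms
proof (induction k arbitrary: i)
  case (Suc k)
  have IH: "(\<lambda>x. coeff (szego (\<alpha> x) k) i) \<in> borel_measurable N" for i using Suc by simp
  have p: "(\<lambda>x. coeff (pCons 0 (szego (\<alpha> x) k)) i) \<in> borel_measurable N"
    using IH by (cases i) auto
  have s: "(\<lambda>x. coeff (poly_star (szego (\<alpha> x) k)) i) \<in> borel_measurable N"
    using IH by (cases "i \<le> k") (simp_all add: coeff_poly_star measurable_cnj)
  have a: "(\<lambda>x. \<alpha> x k) \<in> borel_measurable N" using Suc.prems by simp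
  show ?case
    unfolding szego.simps(2) coeff_diff coeff_smult
    by (intro borel_measurable_diff borel_measurable_times p s measurable_cnj a)
qed simp

lemma measurable_galph:
  assumes n1: "1 \<le> n"
  shows "(\<lambda>A. galph n A k) \<in> borel_measurable (restrict_space (mat_borel n) (good_mats n))"
proof (induction k rule: less_induct)
  case (less k)
  define N where "N = restrict_space (mat_borel n) (good_mats n)"
  have sp: "A \<in> good_mats n" if "A \<in> space N" for A
    using that by (simp add: N_def space_restrict_space)
  have c: "(\<lambda>A. coeff (szego (galph n A) k) i) \<in> borel_measurable N" for i
    unfolding N_def by (rule measurable_szego_coeff[OF less])
  \<comment> \<open>The range of summation in \<open>kpoly\<close> follows the degree of
    \<open>p A\<close>; the common bound \<open>K\<close> replaces it by a range independent of
    \<open>A\<close>.\<close>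
  have mk: "(\<lambda>A. kpoly A (p A) i) \<in> borel_measurable N"
    if "\<And>A. degree (p A) \<le> K" "\<And>j. (\<lambda>A. coeff (p A) j) \<in> borel_measurable N" "i < n" for p K i
  proof -
    have "(\<lambda>A. kpoly A (p A) i) = (\<lambda>A. \<Sum>j\<le>K. coeff (p A) j * kr A j i)"
      using kpoly_le[OF that(1)] by auto
    moreover have "(\<lambda>A. kr A j i) \<in> borel_measurable N" for j
      unfolding N_def by (rule measurable_restrict_space1[OF measurable_kr[OF that(3)]])
    ultimately show ?thesis using that(2) by (simp only:) (intro borel_measurable_sum borel_measurable_times)
  qed
  have mg: "(\<lambda>A. gform n A (p A) (q A)) \<in> borel_measurable N"
    if "\<And>A. degree (p A) \<le> K" "\<And>j. (\<lambda>A. coeff (p A) j) \<in> borel_measurable N"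
      "\<And>A. degree (q A) \<le> K" "\<And>j. (\<lambda>A. coeff (q A) j) \<in> borel_measurable N" for p q K
    unfolding gform_def using mk[OF that(1,2)] mk[OF that(3,4)]
    by (intro borel_measurable_sum borel_measurable_times measurable_cnj) auto
  have eq: "galph n A k = cnj (gform n A 1 (pCons 0 (szego (galph n A) k)) /
      gform n A (szego (galph n A) k) (szego (galph n A) k))" if "A \<in> space N" for A
    using circle_form.alph_def[OF circle_form_gform[OF sp[OF that] n1], of k]
      circle_form.mop_eq_szego[OF circle_form_gform[OF sp[OF that] n1], of k] by simp
  have "(\<lambda>A. gform n A 1 (pCons 0 (szego (galph n A) k))) \<in> borel_measurable N"
  proof (rule mg[where K = "Suc k"])
    show "(\<lambda>A. coeff (pCons 0 (szego (galph n A) k)) j) \<in> borel_measurable N" for j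
      using c by (cases j) auto
  qed (auto intro: order.trans[OF degree_pCons_le])
  moreover have "(\<lambda>A. gform n A (szego (galph n A) k) (szego (galph n A) k)) \<in> borel_measurable N"
    by (rule mg[where K = k]) (use c in auto)
  ultimately have "(\<lambda>A. cnj (gform n A 1 (pCons 0 (szego (galph n A) k)) /
      gform n A (szego (galph n A) k) (szego (galph n A) k))) \<in> borel_measurable N"
    by (intro measurable_cnj borel_measurable_divide)
  then have "(\<lambda>A. galph n A k) \<in> borel_measurable N" by (subst measurable_cong[OF eq])
  then show ?case by (simp only: N_def)
qed

definition gcoef :: "nat \<Rightarrow> complex Matrix.mat \<Rightarrow> nat \<Rightarrow> complex" where
  "gcoef n A k = deformed_verblunsky (spectral_measure n A (unit_vec n 0)) k"

lemma measurable_gcoef: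
  assumes n1: "1 \<le> n" and k: "k < n"
  shows "(\<lambda>A. gcoef n A k) \<in> borel_measurable (mat_borel n)"
proof -
  let ?M = "mat_borel n"
  have eq: "(\<lambda>A. gcoef n A k) = (\<lambda>A. if A \<in> good_mats n then deformed (galph n A) k else deformed_verblunsky undefined k)"
    using deformed_spectral_good[OF _ n1 k] spectral_measure_not_good[OF _ n1] by (auto simp: gcoef_def)
  have "(\<lambda>A. poly (szego (galph n A) l) 1) \<in> borel_measurable (restrict_space ?M (good_mats n))" for l
    using measurable_szego_coeff[OF measurable_galph[OF n1]] by (simp add: poly_altdef)
  then have "(\<lambda>A. deformed (galph n A) k) \<in> borel_measurable (restrict_space ?M (good_mats n))"
    unfolding deformed_def by (intro borel_measurable_diff borel_measurable_divide borel_measurable_const)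
  moreover have "good_mats n \<inter> space ?M = good_mats n"
    by (auto simp: space_mat_borel good_mats_def unitary_mat_def)
  ultimately show ?thesis
    unfolding eq using sets_good_mats[of n]
    by (subst measurable_If_restrict_space_iff) (simp_all add: Int_def conj_commute)
qed

text \<open>The entries of the GGT matrix through a recursion on the inner products of \<open>\<Phi>\<^sub>i\<close> with
  \<open>\<Phi>\<^sub>j\<^sup>*\<close>.\<close>

primrec srec :: "(nat \<Rightarrow> complex) \<Rightarrow> nat \<Rightarrow> nat \<Rightarrow> complex" where
  "srec \<alpha> i 0 = (if i = 0 then 1 else 0)"
| "srec \<alpha> i (Suc j) = srec \<alpha> i j - \<alpha> j * ((if i = Suc j then of_real (snorm \<alpha> i) else 0) + cnj (\<alpha> j) * srec \<alpha> i j)"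

definition ggt_rec :: "(nat \<Rightarrow> complex) \<Rightarrow> nat \<Rightarrow> nat \<Rightarrow> complex" where
  "ggt_rec \<alpha> i j = ((if i = Suc j then of_real (snorm \<alpha> i) else 0) + cnj (\<alpha> j) * srec \<alpha> i j) *
     of_real (1 / sqrt (snorm \<alpha> i)) * of_real (1 / sqrt (snorm \<alpha> j))"

text \<open>\<open>T\<close> pairs Phi_i with z Phi_l = Phi_{l+1} + cnj alpha_l * Phi_l^*, and
  \<open>S\<close> propagates the pairing with Phi_l^* by the reversed recursion. The entry thereby
  becomes explicit in \<open>\<alpha>\<close>, with no measure left in it.\<close>

lemma ggt_entry_rec:
  assumes \<alpha>: "\<alpha> \<in> verb_range n" and n1: "1 \<le> n" and ij: "i < n" "j < n"
  shows "ggt n \<alpha> $$ (i, j) = ggt_rec \<alpha> i j"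
proof -
  define \<mu> where "\<mu> = verblunsky_measure n \<alpha>"
  have \<mu>: "circle_measure_pts n \<mu>" unfolding \<mu>_def by (rule verblunsky_measure_props(1)[OF \<alpha> n1])
  interpret circle_form n "mform \<mu>" by (rule circle_form_mform) fact
  have al: "alph k = \<alpha> k" if "k < n" for k unfolding \<mu>_def using that by (rule verblunsky_measure_props(2)[OF \<alpha> n1])
  have nrm: "mnorm k = snorm \<alpha> k" if "k \<le> n" for k
    using that
  proof (induction k)
    case 0
    then show ?case using form_one by (simp add: mnorm_def snorm_def)
  next
    case (Suc k)
    then show ?case using mnorm_Suc[of k] al[of k] by (simp add: snorm_def)
  qed
  have T: "mform \<mu> (mop i) (pCons 0 (mop l)) =
      (if i = Suc l then of_real (snorm \<alpha> i) else 0) + cnj (\<alpha> l) * mform \<mu> (mop i) (poly_star (mop l))" if "l < n" for l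
  proof -
    have "pCons 0 (mop l) = mop (Suc l) + Polynomial.smult (cnj (\<alpha> l)) (poly_star (mop l))"
      using al[OF that] by (simp add: mop_eq_szego szego.simps(2))
    then show ?thesis using ij that form_mop[of i "Suc l"] nrm[of i] by (auto simp: form_add form_smult)
  qed
  have S: "mform \<mu> (mop i) (poly_star (mop l)) = srec \<alpha> i l" if "l < n" for l
    using that
  proof (induction l)
    case 0
    have "poly_star (mop 0) = mop 0" using poly_star_szego_0[of \<alpha>] by simp
    then show ?case using form_mop[of i 0] ij nrm[of 0] by (simp add: snorm_def del: mop.simps)
  next
    case (Suc l)
    have "poly_star (mop (Suc l)) = poly_star (mop l) - Polynomial.smult (\<alpha> l) (pCons 0 (mop l))"
      using al[of l] Suc.prems by (simp add: mop_eq_szego poly_star_szego_Suc)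
    then show ?case using Suc T[of l] by (simp add: form_diff form_smult del: smult_pCons)
  qed
  have "ggt n \<alpha> $$ (i, j) = mform \<mu> (onp i) (pCons 0 (onp j))"
    unfolding \<mu>_def by (rule ggt_entry[OF \<alpha> n1 ij])
  also have "pCons 0 (onp j) = Polynomial.smult (of_real (1 / sqrt (mnorm j))) (pCons 0 (mop j))"
    by (simp add: onp_def)
  finally show ?thesis
    using ij nrm[of i] nrm[of j] T[OF ij(2)] S[OF ij(2)]
    by (simp add: ggt_rec_def onp_def form_smult form_smult_left mult_ac del: smult_pCons)
qed

lemma measurable_ggt_rec:
  assumes m: "\<And>k. k < n \<Longrightarrow> (\<lambda>\<alpha>. \<alpha> k) \<in> borel_measurable N" and ij: "i < n" "j < n"
  shows "(\<lambda>\<alpha>. ggt_rec \<alpha> i j) \<in> borel_measurable N"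
proof -
  have nm: "(\<lambda>\<alpha>. snorm \<alpha> k) \<in> borel_measurable N" if "k < n" for k
    using that m unfolding snorm_def
    by (intro borel_measurable_prod borel_measurable_diff borel_measurable_power borel_measurable_norm borel_measurable_const) auto
  have sm: "(\<lambda>\<alpha>. srec \<alpha> i l) \<in> borel_measurable N" if "l < n" for l
    using that
  proof (induction l)
    case (Suc l)
    have "(\<lambda>\<alpha>. if i = Suc l then complex_of_real (snorm \<alpha> i) else 0) \<in> borel_measurable N"
      using nm[OF ij(1)] by (cases "i = Suc l") (auto intro: borel_measurable_of_real)
    moreover have "(\<lambda>\<alpha>. \<alpha> l) \<in> borel_measurable N" "(\<lambda>\<alpha>. srec \<alpha> i l) \<in> borel_measurable N"
      using Suc m by auto
    ultimately show ?case unfolding srec.simps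
      by (intro borel_measurable_diff borel_measurable_times borel_measurable_add measurable_cnj)
  qed auto
  have "(\<lambda>\<alpha>. if i = Suc j then complex_of_real (snorm \<alpha> i) else 0) \<in> borel_measurable N"
    using nm[OF ij(1)] by (cases "i = Suc j") (auto intro: borel_measurable_of_real)
  then show ?thesis unfolding ggt_rec_def using nm[OF ij(1)] nm[OF ij(2)] sm[OF ij(2)] m[OF ij(2)]
    by (intro borel_measurable_times borel_measurable_add measurable_cnj borel_measurable_of_real borel_measurable_divide
        borel_measurable_const measurable_compose[OF _ borel_measurable_sqrt]) auto
qed

lemma sets_verb_range:
  assumes m: "\<And>k. k < n \<Longrightarrow> (\<lambda>\<alpha>. \<alpha> k) \<in> borel_measurable N" and n1: "1 \<le> n"
  shows "{\<alpha> \<in> space N. \<alpha> \<in> verb_range n} \<in> sets N"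
proof -
  have c: "(\<lambda>\<alpha>. cmod (\<alpha> k)) \<in> borel_measurable N" if "k < n" for k
    using m[OF that] by measurable
  have "{\<alpha> \<in> space N. \<alpha> \<in> verb_range n} =
      {\<alpha> \<in> space N. \<forall>k\<in>{..<n - 1}. cmod (\<alpha> k) < 1} \<inter> {\<alpha> \<in> space N. cmod (\<alpha> (n - 1)) = 1}"
    by (auto simp: verb_range_def)
  also have "\<dots> \<in> sets N"
    using c n1 by (intro sets.Int sets.sets_Collect_finite_All borel_measurable_less borel_measurable_eq borel_measurable_const) auto
  finally show ?thesis .
qed

lemma measurable_ggt:
  assumes m: "\<And>k. k < n \<Longrightarrow> (\<lambda>\<alpha>. \<alpha> k) \<in> borel_measurable N" and n1: "1 \<le> n"
  shows "ggt n \<in> N \<rightarrow>\<^sub>M mat_borel n"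
proof (rule measurable_mat_borelI)
  show "ggt n x \<in> carrier_mat n n" for x by (simp add: ggt_def Let_def)
  fix i j assume ij: "i < n" "j < n"
  \<comment> \<open>The value of the description off \<open>verb_range n\<close>, see
    \<open>verblunsky_measure_outside\<close>; it makes the entry the constant \<open>c\<close>
    there.\<close>
  define \<nu> where "\<nu> = (THE \<mu> :: complex measure. False)"
  define c where "c = (LINT z|\<nu>. cnj (poly (orthonormal_op \<nu> i) z) * (z * poly (orthonormal_op \<nu> j) z))"
  have "(\<lambda>\<alpha>. ggt n \<alpha> $$ (i, j)) = (\<lambda>\<alpha>. if \<alpha> \<in> verb_range n then ggt_rec \<alpha> i j else c)"
  proof
    fix \<alpha>
    have "ggt n \<alpha> $$ (i, j) = c" if "\<alpha> \<notin> verb_range n"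
      using ij verblunsky_measure_outside[OF that n1] by (simp add: ggt_def Let_def c_def \<nu>_def)
    then show "ggt n \<alpha> $$ (i, j) = (if \<alpha> \<in> verb_range n then ggt_rec \<alpha> i j else c)"
      using ggt_entry_rec[OF _ n1 ij] by auto
  qed
  then show "(\<lambda>\<alpha>. ggt n \<alpha> $$ (i, j)) \<in> borel_measurable N"
    using measurable_ggt_rec[OF m ij] sets_verb_range[OF m n1] by (auto intro: measurable_If)
qed

section \<open>Gauss's summation theorem for conjugate parameters\<close>

text \<open>The terms of the hypergeometric series 2F1(x, cnj x; c; 1), which are real because the
  numerator parameters are conjugate.\<close>

definition gterm :: "complex \<Rightarrow> real \<Rightarrow> nat \<Rightarrow> real" where
  "gterm x c k = (cmod (pochhammer x k))\<^sup>2 / (fact k * pochhammer c k)"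

lemma gterm_nonneg: "0 < c \<Longrightarrow> 0 \<le> gterm x c k"
  using pochhammer_pos[of c k] by (simp add: gterm_def)

lemma gterm_Suc:
  assumes "0 < c"
  shows "gterm x c (Suc k) = gterm x c k * (cmod (x + of_nat k))\<^sup>2 / ((real k + 1) * (c + real k))"
  using assms by (simp add: gterm_def pochhammer_Suc norm_mult power_mult_distrib divide_simps mult_ac add_ac)

lemma gterm_shift:
  assumes "0 < c"
  shows "gterm x (c + 1) k = gterm x c k * c / (c + real k)"
proof -
  have "pochhammer c k * (c + real k) = c * pochhammer (c + 1) k"
    using pochhammer_rec[of c k] pochhammer_Suc[of c k] by simp
  then have "pochhammer (c + 1) k = pochhammer c k * (c + real k) / c" using assms by (simp add: field_simps)
  then show ?thesis using assms by (simp add: gterm_def)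
qed

text \<open>Here \<open>c + s\<close> is c - x - cnj x. The first identity is a telescoping
  certificate for the contiguous relation between c and c + 1, with D_k = c * k *
  \<open>gterm x c k\<close>. The second exhibits the sign of D_k - D_{k+1} for large k.\<close>

lemma gterm_telescope:
  assumes "0 < c" and s: "s = - 2 * Re x"
  shows "c * (c + s) * gterm x c k - (cmod (of_real c - x))\<^sup>2 * gterm x (c + 1) k =
    c * real k * gterm x c k - c * real (Suc k) * gterm x c (Suc k)"
    and "c * real k * gterm x c k - c * real (Suc k) * gterm x c (Suc k) =
      c * ((real k * (c + s) - (cmod x)\<^sup>2) / (c + real k)) * gterm x c k"
proof -
  have ck: "c + real k \<noteq> 0" using assms by simp
  have n1: "(cmod (of_real c - x))\<^sup>2 = c\<^sup>2 + c * s + (cmod x)\<^sup>2"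
    unfolding cmod_power2 s by (simp add: power2_eq_square algebra_simps)
  have n2: "(cmod (x + of_nat k))\<^sup>2 = (cmod x)\<^sup>2 - real k * s + (real k)\<^sup>2"
    unfolding cmod_power2 s by (simp add: power2_eq_square algebra_simps)
  have "real (Suc k) * gterm x c (Suc k) = gterm x c k * ((cmod x)\<^sup>2 - real k * s + (real k)\<^sup>2) / (c + real k)"
    unfolding gterm_Suc[OF assms(1)] n2 by (simp add: add.commute)
  then have e: "c * real (Suc k) * gterm x c (Suc k) = c * (gterm x c k * ((cmod x)\<^sup>2 - real k * s + (real k)\<^sup>2) / (c + real k))"
    by (simp only: mult.assoc)
  show "c * real k * gterm x c k - c * real (Suc k) * gterm x c (Suc k) =
      c * ((real k * (c + s) - (cmod x)\<^sup>2) / (c + real k)) * gterm x c k"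
    unfolding e using ck by (simp add: field_simps power2_eq_square)
  then show "c * (c + s) * gterm x c k - (cmod (of_real c - x))\<^sup>2 * gterm x (c + 1) k =
    c * real k * gterm x c k - c * real (Suc k) * gterm x c (Suc k)"
    unfolding gterm_shift[OF assms(1)] n1 using ck by (simp add: field_simps power2_eq_square)
qed

text \<open>Kummer's test: eventually D_k - D_{k+1} is at least a positive constant times the k-th
  term, so D_k decreases and the terms are dominated by a convergent telescoping series. A positive
  limit of D_k would bound the terms below by a multiple of 1/k.\<close>

lemma gterm_summable:
  assumes c: "0 < c" and s: "s = - 2 * Re x" and cs: "0 < c + s"
  shows "summable (gterm x c)" and "(\<lambda>k. c * real k * gterm x c k) \<longlonglongrightarrow> 0"
proof -
  define D where "D k = c * real k * gterm x c k" for k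
  have D: "0 \<le> D k" for k using c gterm_nonneg[OF c] by (simp add: D_def)
  have step: "D k - D (Suc k) = c * ((real k * (c + s) - (cmod x)\<^sup>2) / (c + real k)) * gterm x c k" for k
    unfolding D_def by (rule gterm_telescope(2)[OF c s])
  have "filterlim (\<lambda>k. (real k * (c + s) - (cmod x)\<^sup>2) / (c + real k)) (nhds (c + s)) sequentially"
    using c by real_asymp
  then have "eventually (\<lambda>k. (c + s) / 2 < (real k * (c + s) - (cmod x)\<^sup>2) / (c + real k)) sequentially"
    using cs by (intro order_tendstoD(1)) auto
  then obtain K where K: "\<And>k. k \<ge> K \<Longrightarrow> (c + s) / 2 < (real k * (c + s) - (cmod x)\<^sup>2) / (c + real k)"
    by (auto simp: eventually_sequentially)
  have low: "c * ((c + s) / 2) * gterm x c k \<le> D k - D (Suc k)" if "k \<ge> K" for k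
    unfolding step using K[OF that] c gterm_nonneg[OF c]
    by (intro mult_right_mono mult_left_mono) auto
  have dec: "D (Suc k) \<le> D k" if "k \<ge> K" for k
  proof -
    have "0 \<le> c * ((c + s) / 2) * gterm x c k" using c cs gterm_nonneg[OF c] by simp
    then show ?thesis using low[OF that] by linarith
  qed
  have "decseq (\<lambda>k. D (k + K))" using dec by (intro decseq_SucI) simp
  then obtain L where L: "(\<lambda>k. D (k + K)) \<longlonglongrightarrow> L"
    using decseq_convergent[of "\<lambda>k. D (k + K)" 0] D by metis
  have "summable (\<lambda>k. D (k + K) - D (Suc (k + K)))"
    using telescope_summable'[OF L] by simp
  then have "summable (\<lambda>k. (D (k + K) - D (Suc (k + K))) / (c * ((c + s) / 2)))"
    by (rule summable_divide)
  then have "summable (\<lambda>k. gterm x c (k + K))"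
  proof (rule summable_comparison_test'[where N = 0])
    fix k
    have "gterm x c (k + K) * (c * ((c + s) / 2)) \<le> D (k + K) - D (Suc (k + K))"
      using low[of "k + K"] by (simp add: mult.commute)
    then show "norm (gterm x c (k + K)) \<le> (D (k + K) - D (Suc (k + K))) / (c * ((c + s) / 2))"
      using gterm_nonneg[OF c] c cs by (simp add: pos_le_divide_eq)
  qed
  then show sm: "summable (gterm x c)" by (simp add: summable_iff_shift)
  have DL: "D \<longlonglongrightarrow> L" using L by (rule LIMSEQ_offset)
  have "L = 0"
  proof (rule ccontr)
    assume "L \<noteq> 0"
    moreover have "0 \<le> L" using D by (intro LIMSEQ_le_const[OF DL]) auto
    ultimately have L0: "0 < L" by simp
    then have "eventually (\<lambda>k. L / 2 < D k) sequentially" by (intro order_tendstoD(1)[OF DL]) auto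
    then obtain N where N: "\<And>k. k \<ge> N \<Longrightarrow> L / 2 < D k" by (auto simp: eventually_sequentially)
    have "summable (\<lambda>k. 1 / real k)"
    proof (rule summable_comparison_test'[where N = "max N 1"])
      show "summable (\<lambda>k. 2 * c / L * gterm x c k)" using sm by (rule summable_mult)
      fix k assume k: "k \<ge> max N 1"
      then have "L / 2 < c * real k * gterm x c k" using N[of k] by (simp add: D_def)
      then show "norm (1 / real k) \<le> 2 * c / L * gterm x c k"
        using k L0 by (simp add: field_simps)
    qed
    then show False using not_summable_harmonic[where 'a = real] by (simp add: inverse_eq_divide)
  qed
  then show "(\<lambda>k. c * real k * gterm x c k) \<longlonglongrightarrow> 0" using DL by (simp add: D_def[abs_def])
qed

lemma gauss_contiguous:
  assumes c: "0 < c" and s: "s = - 2 * Re x" and cs: "0 < c + s"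
  shows "c * (c + s) * suminf (gterm x c) = (cmod (of_real c - x))\<^sup>2 * suminf (gterm x (c + 1))"
proof -
  have s1: "summable (gterm x c)" and D: "(\<lambda>k. c * real k * gterm x c k) \<longlonglongrightarrow> 0"
    using gterm_summable[OF assms] by auto
  have s2: "summable (gterm x (c + 1))" using c cs by (intro gterm_summable(1)[OF _ s]) auto
  have "(\<lambda>k. c * real k * gterm x c k - c * real (Suc k) * gterm x c (Suc k)) sums (c * real 0 * gterm x c 0 - 0)"
    by (rule telescope_sums'[OF D])
  then have "(\<lambda>k. c * (c + s) * gterm x c k - (cmod (of_real c - x))\<^sup>2 * gterm x (c + 1) k) sums 0"
    unfolding gterm_telescope(1)[OF c s] by simp
  moreover have "(\<lambda>k. c * (c + s) * gterm x c k - (cmod (of_real c - x))\<^sup>2 * gterm x (c + 1) k) sums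
      (c * (c + s) * suminf (gterm x c) - (cmod (of_real c - x))\<^sup>2 * suminf (gterm x (c + 1)))"
    by (intro sums_diff sums_mult summable_sums s1 s2)
  ultimately show ?thesis using sums_unique2 by force
qed

text \<open>The term of index 0 is 1 for every c, while all later terms pick up a factor c / (c +
  N). Hence the sum of the series tends to 1 as its lower parameter grows.\<close>

lemma gterm_shift_le:
  assumes c: "0 < c"
  shows "gterm x (c + real N) (Suc k) \<le> c / (c + real N) * gterm x c (Suc k)"
proof -
  have p: "0 < pochhammer (c + 1) k" using c by (intro pochhammer_pos) auto
  have "pochhammer (c + 1) k \<le> pochhammer (c + real N + 1) k"
    unfolding pochhammer_prod using c by (intro prod_mono) auto
  then have "(cmod (pochhammer x (Suc k)))\<^sup>2 / (fact (Suc k) * ((c + real N) * pochhammer (c + real N + 1) k))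
      \<le> (cmod (pochhammer x (Suc k)))\<^sup>2 / (fact (Suc k) * ((c + real N) * pochhammer (c + 1) k))"
    using p c by (intro divide_left_mono mult_left_mono mult_pos_pos) (auto intro: pochhammer_pos)
  also have "\<dots> = c / (c + real N) * gterm x c (Suc k)"
    using c p by (simp add: gterm_def pochhammer_rec[of c k])
  finally show ?thesis by (simp add: gterm_def pochhammer_rec[of "c + real N" k])
qed

text \<open>Iterating the contiguous relation moves c to c + N, where the series tends to 1. What
  remains is a quotient of Pochhammer symbols, whose limit is the defining limit of the reciprocal
  Gamma function.\<close>

lemma gauss_sum:
  assumes c: "0 < c" and s: "s = - 2 * Re x" and cs: "0 < c + s"
  shows "suminf (gterm x c) = Gamma c * Gamma (c + s) / (cmod (Gamma (of_real c - x)))\<^sup>2"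
proof -
  define S where "S c = suminf (gterm x c)" for c
  have sm: "summable (gterm x (c + real N))" for N
    using c cs by (intro gterm_summable(1)[OF _ s]) auto
  have iter: "S c * (pochhammer c N * pochhammer (c + s) N) = (cmod (pochhammer (of_real c - x) N))\<^sup>2 * S (c + real N)" for N
  proof (induction N)
    case (Suc N)
    have p: "0 < c + real N" "0 < c + real N + s" using c cs by auto
    have "S c * (pochhammer c (Suc N) * pochhammer (c + s) (Suc N)) =
        (S c * (pochhammer c N * pochhammer (c + s) N)) * ((c + real N) * (c + real N + s))"
      by (simp add: pochhammer_Suc algebra_simps)
    also have "\<dots> = (cmod (pochhammer (of_real c - x) N))\<^sup>2 * ((c + real N) * (c + real N + s) * S (c + real N))"
      unfolding Suc by simp
    also have "(c + real N) * (c + real N + s) * S (c + real N) =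
        (cmod (of_real (c + real N) - x))\<^sup>2 * S (c + real N + 1)"
      unfolding S_def by (rule gauss_contiguous[OF p(1) s p(2)])
    also have "(cmod (pochhammer (of_real c - x) N))\<^sup>2 * ((cmod (of_real (c + real N) - x))\<^sup>2 * S (c + real N + 1)) =
        (cmod (pochhammer (of_real c - x) (Suc N)))\<^sup>2 * S (c + real (Suc N))"
    proof -
      have "of_real (c + real N) - x = of_real c - x + of_nat N" "c + real N + 1 = c + real (Suc N)" by simp_all
      then show ?thesis by (simp only: pochhammer_Suc norm_mult power_mult_distrib mult.assoc)
    qed
    finally show ?case .
  qed simp
  have bnd: "1 \<le> S (c + real N) \<and> S (c + real N) \<le> 1 + c / (c + real N) * (S c - 1)" for N
  proof -
    have sp: "S (c + real M) = 1 + (\<Sum>k. gterm x (c + real M) (Suc k))" for M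
      using suminf_split_head[OF sm[of M]] by (simp add: S_def gterm_def)
    have s1: "summable (\<lambda>k. gterm x (c + real M) (Suc k))" for M
      using sm[of M] by (subst summable_Suc_iff)
    have "0 \<le> (\<Sum>k. gterm x (c + real N) (Suc k))"
      using c by (intro suminf_nonneg s1 gterm_nonneg) auto
    moreover have "(\<Sum>k. gterm x (c + real N) (Suc k)) \<le> (\<Sum>k. c / (c + real N) * gterm x c (Suc k))"
      using s1[of 0] by (intro suminf_le gterm_shift_le[OF c] s1 summable_mult) simp
    moreover have "(\<Sum>k. c / (c + real N) * gterm x c (Suc k)) = c / (c + real N) * (\<Sum>k. gterm x c (Suc k))"
      using s1[of 0] by (intro suminf_mult) simp
    ultimately show ?thesis using sp[of N] sp[of 0] by simp
  qed
  have lim1: "(\<lambda>N. S (c + real N)) \<longlonglongrightarrow> 1"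
  proof (rule real_tendsto_sandwich[of "\<lambda>_. 1" _ _ "\<lambda>N. 1 + c / (c + real N) * (S c - 1)"])
    show "(\<lambda>N. 1 + c / (c + real N) * (S c - 1)) \<longlonglongrightarrow> 1" using c by real_asymp
  qed (use bnd in auto)
  let ?r = "\<lambda>n. (cmod (rGamma_series (of_real c - x) n))\<^sup>2 / (rGamma_series c n * rGamma_series (c + s) n)"
  have rg0: "rGamma c \<noteq> 0" "rGamma (c + s) \<noteq> 0"
    using Gamma_real_pos[OF c] Gamma_real_pos[OF cs] by (auto simp: Gamma_def)
  have "?r \<longlonglongrightarrow> (cmod (rGamma (of_real c - x)))\<^sup>2 / (rGamma c * rGamma (c + s))"
    using rg0 by (intro tendsto_intros) auto
  moreover have "(\<lambda>n. S (c + real (Suc n))) \<longlonglongrightarrow> 1" using LIMSEQ_Suc[OF lim1] .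
  ultimately have "(\<lambda>n. ?r n * S (c + real (Suc n))) \<longlonglongrightarrow>
      (cmod (rGamma (of_real c - x)))\<^sup>2 / (rGamma c * rGamma (c + s)) * 1" by (rule tendsto_mult)
  moreover have "eventually (\<lambda>n. ?r n * S (c + real (Suc n)) = S c) sequentially"
    using eventually_gt_at_top[of 0]
  proof eventually_elim
    case (elim n)
    let ?p = "pochhammer c (Suc n)" and ?q = "pochhammer (c + s) (Suc n)" and ?w = "pochhammer (of_real c - x) (Suc n)"
    have pos: "0 < ?p" "0 < ?q" using c cs by (auto intro: pochhammer_pos)
    have "cmod (exp ((of_real c - x) * of_real (ln (real n)))) = exp ((c - Re x) * ln (real n))"
      by simp
    then have "(cmod (rGamma_series (of_real c - x) n))\<^sup>2 = (cmod ?w)\<^sup>2 / (fact n * exp ((c - Re x) * ln (real n)))\<^sup>2"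
      by (simp add: rGamma_series_def norm_divide norm_mult power_divide norm_fact)
    \<comment> \<open>As s = - 2 * Re x, we have 2 (c - Re x) = c + (c + s); so the factorials and
      the powers of n in the three \<open>rGamma_series\<close> cancel.\<close>
    also have "(fact n * exp ((c - Re x) * ln (real n)))\<^sup>2 =
        (fact n * exp (c * ln (real n))) * (fact n * exp ((c + s) * ln (real n)))"
      by (simp add: power2_eq_square s flip: exp_add) (simp add: algebra_simps flip: exp_add)
    finally have "?r n = (cmod ?w)\<^sup>2 / (?p * ?q)"
      by (simp add: rGamma_series_def)
    then have "?r n * S (c + real (Suc n)) = ((cmod ?w)\<^sup>2 * S (c + real (Suc n))) / (?p * ?q)" by simp
    also have "\<dots> = S c" unfolding iter[symmetric] using pos by simp
    finally show ?case .
  qed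
  ultimately have "(\<lambda>n :: nat. S c) \<longlonglongrightarrow> (cmod (rGamma (of_real c - x)))\<^sup>2 / (rGamma c * rGamma (c + s))"
    using tendsto_cong by force
  then have "S c = (cmod (rGamma (of_real c - x)))\<^sup>2 / (rGamma c * rGamma (c + s))"
    using LIMSEQ_unique tendsto_const by blast
  then show ?thesis
    by (simp add: S_def rGamma_inverse_Gamma norm_inverse power_inverse inverse_eq_divide norm_divide power_divide)
qed

section \<open>Invariance under the reflections \<open>z \<mapsto> u * cnj z\<close>\<close>

lemma borel_measurable_refl [measurable]: "(\<lambda>z. u * cnj z) \<in> borel_measurable borel"
  by (intro borel_measurable_continuous_onI continuous_intros)

lemma refl_invol: "cmod u = 1 \<Longrightarrow> u * cnj (u * cnj z) = z"
  using complex_norm_square[of u] by (simp add: mult.assoc[symmetric])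

text \<open>The plane as \<open>real ^ 2\<close>, the setting in which invariance under orthogonal
  transformations is applied.\<close>

definition cart :: "complex \<Rightarrow> real ^ 2" where
  "cart z = (\<chi> i. if i = 1 then Re z else Im z)"

definition uncart :: "real ^ 2 \<Rightarrow> complex" where
  "uncart v = Complex (vec_nth v 1) (vec_nth v 2)"

lemma cart_nth [simp]: "vec_nth (cart z) 1 = Re z" "vec_nth (cart z) 2 = Im z"
  by (simp_all add: cart_def)

lemma cart_uncart [simp]: "cart (uncart v) = v" and uncart_cart [simp]: "uncart (cart z) = z"
  by (simp_all add: uncart_def Finite_Cartesian_Product.vec_eq_iff forall_2)

lemma linear_cart: "linear cart" and linear_uncart: "linear uncart"
proof -
  show "linear cart" by (rule linearI) (simp_all add: Finite_Cartesian_Product.vec_eq_iff forall_2)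
  show "linear uncart" by (rule linearI) (simp_all add: uncart_def complex_eq_iff)
qed

lemma norm_cart [simp]: "norm (cart z) = cmod z"
  by (simp add: norm_vec_def L2_set_def UNIV_2 cmod_def)

lemma norm_uncart [simp]: "cmod (uncart v) = norm v"
  using norm_cart[of "uncart v"] by simp

lemma measurable_uncart [measurable]: "uncart \<in> borel_measurable borel"
  using linear_uncart by (intro borel_measurable_continuous_onI linear_continuous_on) (simp add: linear_linear)

lemma lborel_complex_cart: "distr lborel borel uncart = lborel"
proof (rule lborel_eqI[symmetric])
  fix l u :: complex assume "\<And>b. b \<in> Basis \<Longrightarrow> l \<bullet> b \<le> u \<bullet> b"
  from this[of 1] this[of \<i>] have lu: "Re l \<le> Re u" "Im l \<le> Im u" by (auto simp: Basis_complex_def)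
  have v: "uncart -` box l u = box (cart l) (cart u)"
    by (auto simp: mem_box_cart forall_2 mem_box Basis_complex_def uncart_def)
  have "emeasure (distr lborel borel uncart) (box l u) = emeasure lborel (box (cart l) (cart u))"
    by (subst emeasure_distr) (auto simp: v)
  also have "\<dots> = emeasure lborel (cbox (cart l) (cart u))"
    unfolding emeasure_lborel_box_eq emeasure_lborel_cbox_eq ..
  also have "\<dots> = ennreal (measure lborel (cbox (cart l) (cart u)))"
    by (rule emeasure_eq_ennreal_measure) (simp add: emeasure_lborel_cbox_eq)
  also have "measure lborel (cbox (cart l) (cart u)) = (\<Prod>i\<in>UNIV. vec_nth (cart u) i - vec_nth (cart l) i)"
    using lu by (intro content_cbox_cart) (simp add: interval_ne_empty_cart forall_2)
  also have "\<dots> = (Re u - Re l) * (Im u - Im l)" by (simp add: UNIV_2)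
  also have "\<dots> = prod ((\<bullet>) (u - l)) Basis" by (simp add: Basis_complex_def)
  finally show "emeasure (distr lborel borel uncart) (box l u) = ennreal (prod ((\<bullet>) (u - l)) Basis)" .
qed simp

text \<open>Carried over to \<open>real ^ 2\<close> the reflection is a linear isometry and an
  involution, so it preserves the measure of bounded Borel sets. Testing on boxes is enough to
  identify Lebesgue measure.\<close>

lemma lborel_refl:
  assumes u: "cmod u = 1"
  shows "distr lborel borel (\<lambda>z. u * cnj z) = lborel"
proof (rule lborel_eqI[symmetric])
  define T where "T z = u * cnj z" for z
  define T' where "T' v = cart (T (uncart v))" for v
  have TT: "T (T z) = z" for z unfolding T_def by (rule refl_invol[OF u])
  have Tm [measurable]: "T \<in> borel_measurable borel" unfolding T_def[abs_def] by measurable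
  have "linear T" by (rule linearI) (simp_all add: T_def algebra_simps)
  then have "linear T'" unfolding T'_def[abs_def]
    using linear_compose[OF linear_uncart] linear_compose[OF _ linear_cart] by (auto simp: o_def)
  moreover have nT: "norm (T' v) = norm v" for v
    using u by (simp add: T'_def T_def norm_mult)
  ultimately have orth: "orthogonal_transformation T'" by (auto simp: orthogonal_transformation)
  have inv: "T' (T' v) = v" for v by (simp add: T'_def TT)
  fix l r :: complex assume lr: "\<And>b. b \<in> Basis \<Longrightarrow> l \<bullet> b \<le> r \<bullet> b"
  define V where "V = uncart -` box l r"
  have V: "V \<in> sets borel" using measurable_sets[OF measurable_uncart, of "box l r"] by (simp add: V_def)
  have img: "uncart -` (T -` box l r) = T' ` V"
  proof (intro Set.set_eqI iffI)
    fix v assume "v \<in> uncart -` (T -` box l r)"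
    then have "T' v \<in> V" by (simp add: V_def T'_def)
    then show "v \<in> T' ` V" using inv[of v] by (metis imageI)
  next
    fix v assume "v \<in> T' ` V"
    then show "v \<in> uncart -` (T -` box l r)" by (auto simp: V_def T'_def TT)
  qed
  have Tb: "T -` box l r \<in> sets borel" using measurable_sets[OF Tm, of "box l r"] by simp
  have TV: "T' ` V \<in> sets borel"
    unfolding img[symmetric] using measurable_sets[OF measurable_uncart Tb] by simp
  obtain B where B: "\<And>z. z \<in> box l r \<Longrightarrow> cmod z \<le> B" using bounded_box[of l r] unfolding bounded_iff by blast
  have bV: "bounded V"
    unfolding bounded_iff using B by (intro exI[of _ B]) (auto simp: V_def simp flip: norm_uncart)
  have bTV: "bounded (T' ` V)"
    using bV nT unfolding bounded_iff by auto
  have lm: "V \<in> lmeasurable" using bV V by (intro bounded_set_imp_lmeasurable) auto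
  have "emeasure (distr lborel borel T) (box l r) = emeasure lborel (T -` box l r)"
    by (subst emeasure_distr) auto
  also have "\<dots> = emeasure (distr lborel borel uncart) (T -` box l r)" unfolding lborel_complex_cart ..
  also have "\<dots> = emeasure lborel (T' ` V)"
    using Tb by (subst emeasure_distr) (auto simp: img)
  also have "\<dots> = ennreal (measure lborel (T' ` V))"
    using emeasure_bounded_finite[OF bTV] by (intro emeasure_eq_ennreal_measure) auto
  also have "measure lborel (T' ` V) = measure lebesgue (T' ` V)"
    using TV by (simp add: measure_completion)
  also have "\<dots> = measure lebesgue V" by (rule measure_orthogonal_image[OF orth lm])
  also have "\<dots> = measure lborel V" using V by (simp add: measure_completion)
  also have "ennreal \<dots> = emeasure lborel V"
    using emeasure_bounded_finite[OF bV] by (intro emeasure_eq_ennreal_measure[symmetric]) auto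
  also have "\<dots> = emeasure (distr lborel borel uncart) (box l r)"
    by (subst emeasure_distr) (auto simp: V_def)
  also have "\<dots> = ennreal (prod ((\<bullet>) (r - l)) Basis)"
    unfolding lborel_complex_cart using lr by (rule emeasure_lborel_box)
  finally show "emeasure (distr lborel borel (\<lambda>z. u * cnj z)) (box l r) = ennreal (prod ((\<bullet>) (r - l)) Basis)"
    unfolding T_def[abs_def] .
qed simp

section \<open>Haar measure on the circle\<close>

lemma sets_circle_haar [simp, measurable_cong]: "sets circle_haar = sets borel"
  by (simp add: circle_haar_def)

lemma space_circle_haar [simp]: "space circle_haar = UNIV"
  by (simp add: circle_haar_def)

lemma measurable_cis [measurable]: "cis \<in> borel_measurable borel"
  by (intro borel_measurable_continuous_onI continuous_intros)

lemma nn_integral_circle_haar: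
  assumes [measurable]: "f \<in> borel_measurable borel"
  shows "(\<integral>\<^sup>+z. f z \<partial>circle_haar) = (\<integral>\<^sup>+t. f (cis t) * indicator {0..2 * pi} t \<partial>lborel) / ennreal (2 * pi)"
proof -
  have "(\<integral>\<^sup>+z. f z \<partial>circle_haar) = (\<integral>\<^sup>+t. f (cis t) \<partial>uniform_measure lborel {0..2 * pi})"
    unfolding circle_haar_def by (subst nn_integral_distr) (auto simp: uniform_measure_def)
  also have "\<dots> = (\<integral>\<^sup>+t. f (cis t) * indicator {0..2 * pi} t \<partial>lborel) / emeasure lborel {0..2 * pi}"
    by (rule nn_integral_uniform_measure) auto
  finally show ?thesis by simp
qed

lemma prob_space_circle_haar: "prob_space circle_haar"
proof -
  have "prob_space (uniform_measure lborel {0..2 * pi})" by (rule prob_space_uniform_measure) auto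
  then show ?thesis unfolding circle_haar_def
    by (rule prob_space.prob_space_distr) (simp add: uniform_measure_def)
qed

text \<open>With u = cis phi the reflection is t -> phi - t on angles. It maps [0, 2 pi] to
  [phi - 2 pi, phi]; cutting at 0 and moving the negative part by one period gives back [0, 2 pi],
  up to endpoints of measure zero.\<close>

lemma nn_integral_haar_refl:
  assumes f [measurable]: "f \<in> borel_measurable borel" and u: "cmod u = 1"
  shows "(\<integral>\<^sup>+z. f (u * cnj z) \<partial>circle_haar) = (\<integral>\<^sup>+z. f z \<partial>circle_haar)"
proof -
  obtain \<phi> where \<phi>: "0 \<le> \<phi>" "\<phi> < 2 * pi" "u = cis \<phi>"
  proof
    show "0 \<le> Arg2pi u" "Arg2pi u < 2 * pi" by (auto simp: Arg2pi_ge_0 Arg2pi_lt_2pi)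
    show "u = cis (Arg2pi u)" using Arg2pi_eq[of u] u by (simp add: cis_conv_exp)
  qed
  have c: "u * cnj (cis t) = cis (\<phi> - t)" for t
    by (simp add: \<phi>(3) cis_cnj cis_mult)
  define F where "F t = f (cis t)" for t
  have Fm [measurable]: "F \<in> borel_measurable borel" unfolding F_def by measurable
  have per: "F (t - 2 * pi) = F t" "F (t + - (2 * pi)) = F t" for t 
    by (simp_all add: F_def cis_divide[symmetric] cis_mult[symmetric] cis_cnj[symmetric])
  have "(\<integral>\<^sup>+t. F (\<phi> - t) * indicator {0..2 * pi} t \<partial>lborel) = (\<integral>\<^sup>+t. F (\<phi> + (-1) * t) * indicator {\<phi> - 2 * pi..\<phi>} (\<phi> + (-1) * t) \<partial>lborel)"
    by (intro nn_integral_cong) (auto simp: indicator_def)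
  also have "\<dots> = (\<integral>\<^sup>+t. F t * indicator {\<phi> - 2 * pi..\<phi>} t \<partial>lborel)"
    by (subst nn_integral_real_affine[of _ "-1" \<phi>]) auto
  also have "\<dots> = (\<integral>\<^sup>+t. F t * indicator {\<phi> - 2 * pi<..0} t + F t * indicator {0..\<phi>} t \<partial>lborel)"
  proof (rule nn_integral_cong_AE)
    have "AE t in lborel. t \<noteq> \<phi> - 2 * pi \<and> t \<noteq> 0" using AE_lborel_singleton[of "\<phi> - 2 * pi"] AE_lborel_singleton[of 0] by auto
    then show "AE t in lborel. F t * indicator {\<phi> - 2 * pi..\<phi>} t = F t * indicator {\<phi> - 2 * pi<..0} t + F t * indicator {0..\<phi>} t"
    proof eventually_elim
      case (elim t)
      then show ?case using \<phi> by (auto simp: indicator_def)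
    qed
  qed
  also have "\<dots> = (\<integral>\<^sup>+t. F t * indicator {\<phi> - 2 * pi<..0} t \<partial>lborel) + (\<integral>\<^sup>+t. F t * indicator {0..\<phi>} t \<partial>lborel)"
    by (rule nn_integral_add) auto
  also have "(\<integral>\<^sup>+t. F t * indicator {\<phi> - 2 * pi<..0} t \<partial>lborel) =
      (\<integral>\<^sup>+t. F (- (2 * pi) + 1 * t) * indicator {\<phi> - 2 * pi<..0} (- (2 * pi) + 1 * t) \<partial>lborel)"
    by (subst nn_integral_real_affine[of _ 1 "- (2 * pi)"]) auto
  also have "\<dots> = (\<integral>\<^sup>+t. F t * indicator {\<phi><..2 * pi} t \<partial>lborel)"
  proof (intro nn_integral_cong)
    fix t
    have "F (- (2 * pi) + 1 * t) = F t" using per(2)[of t] by (simp add: add.commute)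
    then show "F (- (2 * pi) + 1 * t) * indicator {\<phi> - 2 * pi<..0} (- (2 * pi) + 1 * t) = F t * indicator {\<phi><..2 * pi} t"
      by (auto simp: indicator_def)
  qed
  also have "(\<integral>\<^sup>+t. F t * indicator {\<phi><..2 * pi} t \<partial>lborel) + (\<integral>\<^sup>+t. F t * indicator {0..\<phi>} t \<partial>lborel) =
      (\<integral>\<^sup>+t. F t * indicator {\<phi><..2 * pi} t + F t * indicator {0..\<phi>} t \<partial>lborel)"
    by (rule nn_integral_add[symmetric]) auto
  also have "\<dots> = (\<integral>\<^sup>+t. F t * indicator {0..2 * pi} t \<partial>lborel)"
    using \<phi> by (intro nn_integral_cong) (auto simp: indicator_def)
  finally show ?thesis
    by (simp add: nn_integral_circle_haar c F_def)
qed

lemma haar_refl: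
  assumes u: "cmod u = 1"
  shows "distr circle_haar borel (\<lambda>z. u * cnj z) = circle_haar"
proof (rule measure_eqI)
  fix A assume "A \<in> sets (distr circle_haar borel (\<lambda>z. u * cnj z))"
  then have A [measurable]: "A \<in> sets borel" by simp
  have "emeasure (distr circle_haar borel (\<lambda>z. u * cnj z)) A = (\<integral>\<^sup>+z. indicator A (u * cnj z) \<partial>circle_haar)"
    by (subst nn_integral_indicator[symmetric], simp) (subst nn_integral_distr, auto)
  also have "\<dots> = (\<integral>\<^sup>+z. indicator A z \<partial>circle_haar)" by (rule nn_integral_haar_refl[OF _ u]) simp
  finally show "emeasure (distr circle_haar borel (\<lambda>z. u * cnj z)) A = emeasure circle_haar A" by simp
qed simp

section \<open>The laws \<open>nu\<close>\<close>

lemma sets_nu [simp, measurable_cong]: "sets (nu s) = sets borel"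
  by (simp add: nu_def)

lemma space_nu [simp]: "space (nu s) = UNIV"
  by (simp add: nu_def)

definition nu_dens :: "real \<Rightarrow> complex \<Rightarrow> ennreal" where
  "nu_dens s z = ennreal ((s - 1) / (2 * pi) * (1 - (cmod z)\<^sup>2) powr ((s - 3) / 2)) * indicator (ball 0 1) z"

lemma nu_eq_density: "s \<noteq> 1 \<Longrightarrow> nu s = density lborel (nu_dens s)"
  by (simp add: nu_def nu_dens_def[abs_def])

lemma measurable_nu_dens [measurable]: "nu_dens s \<in> borel_measurable borel"
proof -
  have [measurable]: "ball 0 1 \<in> sets (borel :: complex measure)" by simp
  show ?thesis unfolding nu_dens_def[abs_def] by measurable
qed

lemma nu_refl:
  assumes u: "cmod u = 1"
  shows "distr (nu s) borel (\<lambda>z. u * cnj z) = nu s"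
proof (cases "s = 1")
  case True
  then show ?thesis using haar_refl[OF u] by (simp add: nu_def)
next
  case False
  have inv: "nu_dens s (u * cnj z) = nu_dens s z" for z
    using u by (simp add: nu_dens_def norm_mult indicator_def)
  show ?thesis
  proof (rule measure_eqI)
    fix A assume "A \<in> sets (distr (nu s) borel (\<lambda>z. u * cnj z))"
    then have A [measurable]: "A \<in> sets borel" by simp
    have "emeasure (distr (nu s) borel (\<lambda>z. u * cnj z)) A = (\<integral>\<^sup>+z. indicator A (u * cnj z) \<partial>nu s)"
      by (subst nn_integral_indicator[symmetric], simp) (subst nn_integral_distr, auto)
    also have "\<dots> = (\<integral>\<^sup>+z. nu_dens s (u * cnj z) * indicator A (u * cnj z) \<partial>lborel)"
      unfolding nu_eq_density[OF False] inv by (subst nn_integral_density) auto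
    also have "\<dots> = (\<integral>\<^sup>+z. nu_dens s z * indicator A z \<partial>distr lborel borel (\<lambda>z. u * cnj z))"
      by (subst nn_integral_distr) auto
    also have "\<dots> = (\<integral>\<^sup>+z. nu_dens s z * indicator A z \<partial>lborel)" unfolding lborel_refl[OF u] ..
    also have "\<dots> = emeasure (nu s) A"
      unfolding nu_eq_density[OF False] by (rule emeasure_density[symmetric]) auto
    finally show "emeasure (distr (nu s) borel (\<lambda>z. u * cnj z)) A = emeasure (nu s) A" .
  qed simp
qed

lemma nn_integral_nu_refl:
  assumes u: "cmod u = 1" and f [measurable]: "f \<in> borel_measurable borel"
  shows "(\<integral>\<^sup>+z. f (u * cnj z) \<partial>nu s) = (\<integral>\<^sup>+z. f z \<partial>nu s)"
proof -
  have "(\<integral>\<^sup>+z. f z \<partial>nu s) = (\<integral>\<^sup>+z. f z \<partial>distr (nu s) borel (\<lambda>z. u * cnj z))" unfolding nu_refl[OF u] ..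
  also have "\<dots> = (\<integral>\<^sup>+z. f (u * cnj z) \<partial>nu s)" by (rule nn_integral_distr) auto
  finally show ?thesis by simp
qed

text \<open>A rotation is the composition of two reflections, the second being plain
  conjugation.\<close>

lemma nn_integral_nu_rotate:
  assumes u: "cmod u = 1" and f [measurable]: "f \<in> borel_measurable borel"
  shows "(\<integral>\<^sup>+z. f (u * z) \<partial>nu s) = (\<integral>\<^sup>+z. f z \<partial>nu s)"
proof -
  have m [measurable]: "(\<lambda>z. f (u * z)) \<in> borel_measurable borel" by measurable
  have "(\<integral>\<^sup>+z. f (u * z) \<partial>nu s) = (\<integral>\<^sup>+z. f (u * (1 * cnj z)) \<partial>nu s)"
    by (rule nn_integral_nu_refl[OF _ m, symmetric]) simp
  then show ?thesis using nn_integral_nu_refl[OF u f] by simp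
qed

section \<open>Normalisation constants\<close>

text \<open>The Taylor coefficients at 0 of \<open>(1 - z) powr cnj \<delta>\<close>, see
  \<open>bcoef_sums\<close>.\<close>

definition bcoef :: "complex \<Rightarrow> nat \<Rightarrow> complex" where
  "bcoef \<delta> k = (cnj \<delta> gchoose k) * (- 1) ^ k"

text \<open>The real counterpart of \<open>jweight\<close>, equal to it on the closed disc. As a
  squared modulus it is nonnegative on the whole plane, so it can be integrated as an extended
  nonnegative function without restricting the domain.\<close>

definition jw :: "complex \<Rightarrow> complex \<Rightarrow> real" where
  "jw \<delta> z = (cmod ((1 - z) powr cnj \<delta>))\<^sup>2"

lemma jw_nonneg [simp]: "0 \<le> jw \<delta> z" by (simp add: jw_def)

lemma measurable_Ln_complex [measurable]: "(Ln :: complex \<Rightarrow> complex) \<in> borel_measurable borel"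
proof -
  let ?A = "\<real>\<^sub>\<le>\<^sub>0 :: complex set"
  \<comment> \<open>The values of Ln on the branch cut, where it is not continuous: imaginary part
    pi on the negative axis, and the default value at 0. Off the cut continuity gives
    measurability.\<close>
  define g where "g z = (if z \<in> {0 :: complex} then Ln 0 else of_real (ln \<bar>Re z\<bar>) + of_real pi * \<i>)" for z
  have g [measurable]: "g \<in> borel_measurable borel" unfolding g_def[abs_def] by measurable
  have A: "?A \<in> sets borel" by (intro borel_closed closed_nonpos_Reals_complex)
  have eq: "Ln z = (if z \<in> ?A then g z else Ln z)" for z :: complex
  proof (cases "z \<in> ?A \<and> z \<noteq> 0")
    case True
    then have "Re z < 0" "z = of_real (Re z)" by (auto simp: complex_nonpos_Reals_iff complex_eq_iff)
    then have "Ln z = of_real (ln \<bar>Re z\<bar>) + of_real pi * \<i>"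
      using Ln_of_real'[of "Re z"] by simp
    then show ?thesis using True by (simp add: g_def)
  qed (auto simp: g_def)
  have "(\<lambda>z :: complex. if z \<in> ?A then g z else Ln z) \<in> borel_measurable borel"
  proof (subst measurable_If_restrict_space_iff)
    show "{x \<in> space borel. x \<in> ?A} \<in> sets borel" using A by simp
    have "Ln \<in> borel_measurable (restrict_space borel {z :: complex. z \<notin> ?A})"
      by (intro borel_measurable_continuous_on_restrict continuous_on_Ln) auto
    then show "g \<in> borel_measurable (restrict_space borel {z. z \<in> ?A}) \<and>
        Ln \<in> borel_measurable (restrict_space borel {z :: complex. z \<notin> ?A})"
      by (simp add: measurable_restrict_space1)
  qed
  moreover have "(\<lambda>z :: complex. if z \<in> ?A then g z else Ln z) = Ln" by (rule ext, rule eq[symmetric])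
  ultimately show ?thesis by (simp only:)
qed

lemma measurable_powr_complex [measurable]: "(\<lambda>z :: complex. (1 - z) powr d) \<in> borel_measurable borel"
proof -
  have "(\<lambda>z :: complex. (1 - z) powr d) = (\<lambda>z. if z \<in> {1} then 0 else exp (d * Ln (1 - z)))"
    by (auto simp: powr_def)
  moreover have "(\<lambda>z :: complex. if z \<in> {1} then 0 else exp (d * Ln (1 - z))) \<in> borel_measurable borel"
    by measurable
  ultimately show ?thesis by simp
qed

lemma measurable_jw [measurable]: "jw \<delta> \<in> borel_measurable borel"
  unfolding jw_def[abs_def] by measurable

lemma jw_eq_exp: "z \<noteq> 1 \<Longrightarrow> jw \<delta> z = exp (2 * Re (cnj \<delta> * Ln (1 - z)))"
proof -
  assume "z \<noteq> 1"
  then have "(1 - z = 0) = False" by simp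
  then show ?thesis by (simp only: jw_def powr_def if_False norm_exp_eq_Re exp_double)
qed

lemma jweight_eq_jw: "cmod z \<le> 1 \<Longrightarrow> jweight \<delta> z = of_real (jw \<delta> z)"
  by (cases "z = 1") (simp_all add: jweight_eq_exp jw_eq_exp, simp add: jw_def)

lemma bcoef_sums: "cmod z < 1 \<Longrightarrow> (\<lambda>k. bcoef \<delta> k * z ^ k) sums ((1 - z) powr cnj \<delta>)"
  using gen_binomial_complex[of "- z" "cnj \<delta>"] by (simp add: bcoef_def power_minus' mult_ac)

lemma cmod_bcoef: "(cmod (bcoef \<delta> k))\<^sup>2 = (cmod (pochhammer (- \<delta>) k))\<^sup>2 / (fact k)\<^sup>2"
proof -
  have "cnj (pochhammer (- \<delta>) k) = pochhammer (- cnj \<delta>) k"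
    by (simp add: pochhammer_prod)
  then have "cmod (pochhammer (- cnj \<delta>) k) = cmod (pochhammer (- \<delta>) k)"
    by (metis complex_mod_cnj)
  then show ?thesis
    by (simp add: bcoef_def gbinomial_pochhammer norm_mult norm_divide norm_power power_divide norm_fact)
qed

lemma AE_haar_norm: "AE \<zeta> in circle_haar. cmod \<zeta> = 1"
  unfolding circle_haar_def by (subst AE_distr_iff) (auto simp: uniform_measure_def)

lemma haar_orth:
  "(LINT \<zeta>|circle_haar. \<zeta> ^ j * cnj (\<zeta> ^ k)) = (if j = k then 1 else 0)"
proof -
  interpret prob_space circle_haar by (rule prob_space_circle_haar)
  show ?thesis
  proof (cases "j = k")
    case True
    have "(LINT \<zeta>|circle_haar. \<zeta> ^ j * cnj (\<zeta> ^ k)) = (LINT \<zeta>|circle_haar. 1)"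
    proof (rule integral_cong_AE)
      show "AE \<zeta> in circle_haar. \<zeta> ^ j * cnj (\<zeta> ^ k) = 1"
        using AE_haar_norm by eventually_elim (simp add: True complex_norm_square[symmetric] norm_power del: complex_cnj_power)
    qed (auto intro!: borel_measurable_continuous_onI continuous_intros simp: measurable_cong_sets[OF sets_circle_haar refl])
    then show ?thesis using True prob_space by simp
  next
    case False
    define I where "I = (LINT \<zeta>|circle_haar. \<zeta> ^ j * cnj (\<zeta> ^ k))"
    \<comment> \<open>A point of the circle with u^(j - k) = -1: rotating by it, as two successive
      reflections, turns the integral into its negative.\<close>
    define u where "u = cis (pi / (real j - real k))"
    have u1: "cmod u = 1" by (simp add: u_def)
    have uu: "u ^ j * cnj (u ^ k) = - 1"
    proof -
      have "u ^ j * cnj (u ^ k) = cis (real j * (pi / (real j - real k)) - real k * (pi / (real j - real k)))"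
      proof -
        have "u ^ m = cis (real m * (pi / (real j - real k)))" for m unfolding u_def by (rule Complex.DeMoivre)
        then show ?thesis by (simp only: cis_cnj cis_mult diff_conv_add_uminus)
      qed
      also have "real j * (pi / (real j - real k)) - real k * (pi / (real j - real k)) = pi"
        using False unfolding left_diff_distrib[symmetric] by simp
      finally show ?thesis by simp
    qed
    have m: "(\<lambda>\<zeta> :: complex. \<zeta> ^ j * cnj (\<zeta> ^ k)) \<in> borel_measurable borel"
      by (intro borel_measurable_continuous_onI continuous_intros)
    have refl: "(LINT \<zeta>|circle_haar. f (v * cnj \<zeta>)) = (LINT \<zeta>|circle_haar. f \<zeta>)"
      if "f \<in> borel_measurable borel" "cmod v = 1" for f :: "complex \<Rightarrow> complex" and v
    proof -
      have "(LINT \<zeta>|circle_haar. f \<zeta>) = (LINT \<zeta>|distr circle_haar borel (\<lambda>z. v * cnj z). f \<zeta>)"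
        unfolding haar_refl[OF that(2)] ..
      also have "\<dots> = (LINT \<zeta>|circle_haar. f (v * cnj \<zeta>))"
        using that by (intro integral_distr) auto
      finally show ?thesis by simp
    qed
    let ?f = "\<lambda>\<zeta> :: complex. \<zeta> ^ j * cnj (\<zeta> ^ k)"
    have m2: "(\<lambda>z. ?f (u * cnj z)) \<in> borel_measurable borel"
      by (intro borel_measurable_continuous_onI continuous_intros)
    have "I = (LINT \<zeta>|circle_haar. ?f (u * cnj \<zeta>))" unfolding I_def by (rule refl[OF m u1, symmetric])
    also have "\<dots> = (LINT \<zeta>|circle_haar. ?f (u * cnj (1 * cnj \<zeta>)))"
      using refl[OF m2, of 1] by simp
    also have "\<dots> = (LINT \<zeta>|circle_haar. (u ^ j * cnj (u ^ k)) * ?f \<zeta>)"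
      by (simp add: power_mult_distrib mult_ac)
    also have "\<dots> = - I" unfolding uu I_def by simp
    finally have "I = 0" by simp
    then show ?thesis using False by (simp add: I_def)
  qed
qed

text \<open>For |w| < 1 the coefficients are absolutely summable, so the partial sums are bounded
  uniformly on the circle. Parseval for polynomials then passes to the limit by dominated
  convergence.\<close>

lemma haar_parseval:
  assumes w: "cmod w < 1"
  shows "(\<integral>\<^sup>+\<zeta>. ennreal (jw \<delta> (w * \<zeta>)) \<partial>circle_haar) = (\<Sum>k. ennreal ((cmod (bcoef \<delta> k))\<^sup>2 * (cmod w) ^ (2 * k)))"
proof -
  interpret prob_space circle_haar by (rule prob_space_circle_haar)
  define c where "c k = bcoef \<delta> k * w ^ k" for k
  have sc: "summable (\<lambda>k. cmod (c k))"
  proof -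
    obtain r where r: "cmod w < r" "r < 1" using w dense by blast
    have r0: "0 \<le> r" using r norm_ge_zero[of w] by linarith
    have "summable (\<lambda>k. bcoef \<delta> k * (of_real r) ^ k)"
      using bcoef_sums[of "of_real r" \<delta>] r r0 by (simp add: sums_iff)
    then show ?thesis unfolding c_def
      by (rule powser_insidea) (use r r0 in simp)
  qed
  define B where "B = (\<Sum>k. cmod (c k))"
  define S where "S N \<zeta> = (\<Sum>k<N. c k * \<zeta> ^ k)" for N and \<zeta> :: complex
  have Sm [measurable]: "S N \<in> borel_measurable borel" for N
    unfolding S_def by (intro borel_measurable_continuous_onI continuous_intros)
  have Sb: "cmod (S N \<zeta>) \<le> B" if "cmod \<zeta> = 1" for N \<zeta>
  proof -
    have "cmod (S N \<zeta>) \<le> (\<Sum>k<N. cmod (c k * \<zeta> ^ k))" unfolding S_def by (rule norm_sum)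
    also have "\<dots> = (\<Sum>k<N. cmod (c k))" using that by (simp add: norm_mult norm_power)
    also have "\<dots> \<le> B" unfolding B_def by (intro sum_le_suminf[OF sc]) auto
    finally show ?thesis .
  qed
  have Slim: "(\<lambda>N. S N \<zeta>) \<longlonglongrightarrow> (1 - w * \<zeta>) powr cnj \<delta>" if "cmod \<zeta> = 1" for \<zeta>
    using bcoef_sums[of "w * \<zeta>" \<delta>] w that
    by (simp add: S_def c_def sums_def norm_mult power_mult_distrib mult_ac)
  have IS: "(LINT \<zeta>|circle_haar. (cmod (S N \<zeta>))\<^sup>2) = (\<Sum>k<N. (cmod (c k))\<^sup>2)" for N
  proof -
    have i: "integrable circle_haar (\<lambda>\<zeta>. \<zeta> ^ j * cnj (\<zeta> ^ k))" for j k
    proof (rule integrable_const_bound[where B = 1])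
      show "AE \<zeta> in circle_haar. norm (\<zeta> ^ j * cnj (\<zeta> ^ k)) \<le> 1"
        using AE_haar_norm by eventually_elim (simp add: norm_mult norm_power)
    qed (auto intro!: borel_measurable_continuous_onI continuous_intros simp: measurable_cong_sets[OF sets_circle_haar refl])
    have "complex_of_real (LINT \<zeta>|circle_haar. (cmod (S N \<zeta>))\<^sup>2) = (LINT \<zeta>|circle_haar. S N \<zeta> * cnj (S N \<zeta>))"
      unfolding complex_norm_square[symmetric] by (rule integral_complex_of_real[symmetric])
    also have "\<dots> = (LINT \<zeta>|circle_haar. (\<Sum>j<N. \<Sum>k<N. c j * cnj (c k) * (\<zeta> ^ j * cnj (\<zeta> ^ k))))"
      unfolding S_def by (simp only: cnj_sum sum_product complex_cnj_mult) (simp only: mult_ac)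
    also have "\<dots> = (\<Sum>j<N. \<Sum>k<N. c j * cnj (c k) * (LINT \<zeta>|circle_haar. \<zeta> ^ j * cnj (\<zeta> ^ k)))"
      using i by simp
    also have "\<dots> = (\<Sum>j<N. \<Sum>k<N. if k = j then c j * cnj (c j) else 0)"
      unfolding haar_orth by (intro sum.cong refl) auto
    also have "\<dots> = (\<Sum>j<N. c j * cnj (c j))" by simp
    also have "\<dots> = complex_of_real (\<Sum>k<N. (cmod (c k))\<^sup>2)"
      unfolding complex_norm_square[symmetric] by simp
    finally show ?thesis by (simp only: of_real_eq_iff)
  qed
  have fm: "(\<lambda>\<zeta>. jw \<delta> (w * \<zeta>)) \<in> borel_measurable circle_haar"
    unfolding jw_def by measurable
  have lim: "AE \<zeta> in circle_haar. (\<lambda>N. (cmod (S N \<zeta>))\<^sup>2) \<longlonglongrightarrow> jw \<delta> (w * \<zeta>)"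
    using AE_haar_norm unfolding jw_def by eventually_elim (intro tendsto_intros Slim)
  have bound: "AE \<zeta> in circle_haar. norm ((cmod (S N \<zeta>))\<^sup>2) \<le> B\<^sup>2" for N
    using AE_haar_norm
  proof eventually_elim
    case (elim \<zeta>)
    then show ?case using power_mono[OF Sb[OF elim, of N], of 2] by simp
  qed
  have sm: "(\<lambda>\<zeta>. (cmod (S N \<zeta>))\<^sup>2) \<in> borel_measurable circle_haar" for N by measurable
  have int: "integrable circle_haar (\<lambda>\<zeta>. jw \<delta> (w * \<zeta>))"
    and conv: "(\<lambda>N. LINT \<zeta>|circle_haar. (cmod (S N \<zeta>))\<^sup>2) \<longlonglongrightarrow> (LINT \<zeta>|circle_haar. jw \<delta> (w * \<zeta>))"
    using integrable_dominated_convergence[OF fm sm _ lim bound]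
      integral_dominated_convergence[OF fm sm _ lim bound] by auto
  have "(\<lambda>k. (cmod (c k))\<^sup>2) sums (LINT \<zeta>|circle_haar. jw \<delta> (w * \<zeta>))"
    using conv unfolding IS sums_def .
  then have "(\<Sum>k. ennreal ((cmod (c k))\<^sup>2)) = ennreal (LINT \<zeta>|circle_haar. jw \<delta> (w * \<zeta>))"
    by (intro sums_unique[symmetric]) (simp add: sums_ennreal)
  also have "\<dots> = (\<integral>\<^sup>+\<zeta>. ennreal (jw \<delta> (w * \<zeta>)) \<partial>circle_haar)"
    by (rule nn_integral_eq_integral[symmetric, OF int]) simp
  finally show ?thesis
    by (simp add: c_def norm_mult norm_power power_mult_distrib mult.commute flip: power_mult)
qed

text \<open>The disc of radius sqrt t has area pi * t, so both distribution functions agree. This is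
  the polar-coordinates step, in the only form needed: functions of |z|^2.\<close>

lemma disc_radial:
  "distr (uniform_measure lborel (ball 0 1)) borel (\<lambda>z :: complex. (cmod z)\<^sup>2) = uniform_measure lborel {0..1}"
proof (rule cdf_unique)
  let ?U = "uniform_measure lborel (ball (0::complex) 1)"
  have vol: "emeasure lborel (ball (0::complex) r) = ennreal (pi * r\<^sup>2)" if "0 \<le> r" for r
    using that by (simp add: emeasure_ball unit_ball_vol_2)
  have volc: "emeasure lborel (cball (0::complex) r) = ennreal (pi * r\<^sup>2)" if "0 \<le> r" for r
    using that by (simp add: emeasure_cball unit_ball_vol_2)
  have m: "(\<lambda>z :: complex. (cmod z)\<^sup>2) \<in> borel_measurable lborel" by measurable
  have pU: "prob_space ?U" using vol[of 1] by (intro prob_space_uniform_measure) auto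
  have pV: "prob_space (uniform_measure lborel {0..1::real})" by (intro prob_space_uniform_measure) auto
  show "real_distribution (distr ?U borel (\<lambda>z. (cmod z)\<^sup>2))"
    unfolding real_distribution_def real_distribution_axioms_def
    using prob_space.prob_space_distr[OF pU, of "\<lambda>z. (cmod z)\<^sup>2" borel] m by (simp add: uniform_measure_def)
  show "real_distribution (uniform_measure lborel {0..1::real})"
    unfolding real_distribution_def real_distribution_axioms_def using pV by simp
  show "cdf (distr ?U borel (\<lambda>z. (cmod z)\<^sup>2)) = cdf (uniform_measure lborel {0..1})"
  proof
    fix t :: real
    have "emeasure (distr ?U borel (\<lambda>z. (cmod z)\<^sup>2)) {..t} = emeasure ?U {z. (cmod z)\<^sup>2 \<le> t}"
      using m by (subst emeasure_distr) (auto simp: uniform_measure_def vimage_def)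
    also have "\<dots> = emeasure lborel (ball 0 1 \<inter> {z::complex. (cmod z)\<^sup>2 \<le> t}) / ennreal pi"
      using vol[of 1] m by (subst emeasure_uniform_measure) auto
    also have "\<dots> = emeasure lborel ({0..1} \<inter> {..t})"
    proof (cases "t < 0")
      case True
      then have "ball 0 1 \<inter> {z::complex. (cmod z)\<^sup>2 \<le> t} = {}" "{0..1} \<inter> {..t} = {}"
        using zero_le_power2 by (auto simp: not_le intro: less_le_trans) (meson not_less order.trans zero_le_power2)
      then show ?thesis by simp
    next
      case False
      show ?thesis
      proof (cases "t < 1")
        case True
        have "ball 0 1 \<inter> {z::complex. (cmod z)\<^sup>2 \<le> t} = cball 0 (sqrt t)"
        proof safe
          fix z :: complex assume "(cmod z)\<^sup>2 \<le> t"
          then show "z \<in> cball 0 (sqrt t)" by (simp add: real_le_rsqrt)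
        next
          fix z :: complex assume z: "z \<in> cball 0 (sqrt t)"
          then have "cmod z \<le> sqrt t" by simp
          moreover have "sqrt t < 1" using True by (simp add: real_sqrt_lt_1_iff)
          ultimately have "cmod z < 1" by linarith
          then show "z \<in> ball 0 1" by simp
          show "(cmod z)\<^sup>2 \<le> t" using power_mono[OF \<open>cmod z \<le> sqrt t\<close>, of 2] False by simp
        qed
        then have "emeasure lborel (ball 0 1 \<inter> {z::complex. (cmod z)\<^sup>2 \<le> t}) = ennreal (pi * t)"
          using volc[of "sqrt t"] False by simp
        moreover have "{0..1} \<inter> {..t} = {0..t}" using True by auto
        ultimately show ?thesis using False by (simp add: divide_ennreal)
      next
        case F2: False
        have "ball 0 1 \<inter> {z::complex. (cmod z)\<^sup>2 \<le> t} = ball 0 1"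
        proof safe
          fix z :: complex assume "z \<in> ball 0 1"
          then show "(cmod z)\<^sup>2 \<le> t" using power_le_one[of "cmod z" 2] F2 by simp
        qed
        moreover have "{0..1} \<inter> {..t} = {0..1}" using F2 by auto
        ultimately show ?thesis using vol[of 1] by (simp add: divide_ennreal)
      qed
    qed
    also have "\<dots> = emeasure (uniform_measure lborel {0..1}) {..t}"
      by (subst emeasure_uniform_measure) (auto simp: divide_ennreal_def)
    finally show "cdf (distr ?U borel (\<lambda>z. (cmod z)\<^sup>2)) t = cdf (uniform_measure lborel {0..1}) t"
      by (simp add: cdf_def measure_def)
  qed
qed

lemma nn_integral_disc_radial:
  assumes [measurable]: "f \<in> borel_measurable borel"
  shows "(\<integral>\<^sup>+z. f ((cmod z)\<^sup>2) * indicator (ball 0 1) z \<partial>lborel) = ennreal pi * (\<integral>\<^sup>+t. f t * indicator {0..1} t \<partial>lborel)"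
proof -
  have vol: "emeasure lborel (ball (0::complex) 1) = ennreal pi"
    by (simp add: emeasure_ball unit_ball_vol_2)
  have "(\<integral>\<^sup>+z. f ((cmod z)\<^sup>2) * indicator (ball 0 1) z \<partial>lborel) / ennreal pi =
      (\<integral>\<^sup>+z. f ((cmod z)\<^sup>2) \<partial>uniform_measure lborel (ball (0::complex) 1))"
    by (subst nn_integral_uniform_measure) (auto simp: vol)
  also have "\<dots> = (\<integral>\<^sup>+t. f t \<partial>distr (uniform_measure lborel (ball 0 1)) borel (\<lambda>z :: complex. (cmod z)\<^sup>2))"
    by (subst nn_integral_distr) (auto simp: uniform_measure_def)
  also have "\<dots> = (\<integral>\<^sup>+t. f t * indicator {0..1} t \<partial>lborel)"
    unfolding disc_radial by (subst nn_integral_uniform_measure) (auto simp: divide_ennreal_def)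
  finally have e: "(\<integral>\<^sup>+z. f ((cmod z)\<^sup>2) * indicator (ball 0 1) z \<partial>lborel) / ennreal pi =
      (\<integral>\<^sup>+t. f t * indicator {0..1} t \<partial>lborel)" .
  have "ennreal pi * (\<integral>\<^sup>+t. f t * indicator {0..1} t \<partial>lborel) =
      (\<integral>\<^sup>+z. f ((cmod z)\<^sup>2) * indicator (ball 0 1) z \<partial>lborel) * (ennreal pi / ennreal pi)"
    unfolding e[symmetric] by (simp add: divide_ennreal_def mult_ac)
  also have "ennreal pi / ennreal pi = 1" by (simp add: ennreal_divide_self)
  finally show ?thesis by simp
qed

lemma nn_integral_beta:
  assumes a: "0 < a" and b: "0 < b"
  shows "(\<integral>\<^sup>+t. ennreal (t powr (a - 1) * (1 - t) powr (b - 1)) * indicator {0..1} t \<partial>lborel) = ennreal (Beta a b)"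
proof -
  have "(\<integral>\<^sup>+t. ennreal (t powr (a - 1) * (1 - t) powr (b - 1)) * indicator {0..1} t \<partial>lborel) =
     (\<integral>\<^sup>+t. ennreal (indicator {0..1} t * (t powr (a - 1) * (1 - t) powr (b - 1))) \<partial>lborel)"
    by (intro nn_integral_cong) (auto simp: indicator_def)
  also have "\<dots> = ennreal (Beta a b)"
  proof (rule nn_integral_has_integral_lborel)
    show "((\<lambda>t. indicator {0..1} t * (t powr (a - 1) * (1 - t) powr (b - 1))) has_integral Beta a b) UNIV"
    proof -
      have "(\<lambda>t. indicator {0..1} t * (t powr (a - 1) * (1 - t) powr (b - 1))) =
          (\<lambda>t. if t \<in> {0..1} then t powr (a - 1) * (1 - t) powr (b - 1) else 0)"
        by (auto simp: indicator_def)
      then show ?thesis using has_integral_Beta_real[OF a b]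
        by (simp only: has_integral_restrict_UNIV)
    qed
  qed auto
  finally show ?thesis .
qed

text \<open>With s = 2a + 1 the exponent (s - 3) / 2 is a - 1, and the substitution t = |z|^2 yields
  a times Beta(k + 1, a). The case \<open>k = 0\<close> shows that \<open>nu\<close> has mass
  1.\<close>

lemma nn_integral_nu_power:
  assumes a: "0 < a"
  shows "(\<integral>\<^sup>+z. ennreal ((cmod z) ^ (2 * k)) \<partial>nu (2 * a + 1)) = ennreal (fact k / pochhammer (a + 1) k)"
proof -
  have "(\<integral>\<^sup>+z. ennreal ((cmod z) ^ (2 * k)) \<partial>nu (2 * a + 1)) =
      (\<integral>\<^sup>+z. nu_dens (2 * a + 1) z * ennreal ((cmod z) ^ (2 * k)) \<partial>lborel)"
    using a by (subst nu_eq_density, simp) (subst nn_integral_density, auto)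
  also have "\<dots> = (\<integral>\<^sup>+z. ennreal (a / pi * (((cmod z)\<^sup>2) ^ k * (1 - (cmod z)\<^sup>2) powr (a - 1))) * indicator (ball 0 1) z \<partial>lborel)"
  proof (rule nn_integral_cong)
    fix z :: complex
    have "cmod z ^ (2 * k) = ((cmod z)\<^sup>2) ^ k" "(2 * a + 1 - 3) / 2 = a - 1" "(2 * a + 1 - 1) / (2 * pi) = a / pi"
      by (simp_all add: power_mult)
    then show "nu_dens (2 * a + 1) z * ennreal ((cmod z) ^ (2 * k)) =
        ennreal (a / pi * (((cmod z)\<^sup>2) ^ k * (1 - (cmod z)\<^sup>2) powr (a - 1))) * indicator (ball 0 1) z"
      using a by (simp only: nu_dens_def) (cases "z \<in> ball 0 1", simp_all add: mult_ac flip: ennreal_mult)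
  qed
  also have "\<dots> = ennreal pi * (\<integral>\<^sup>+t. ennreal (a / pi * (t ^ k * (1 - t) powr (a - 1))) * indicator {0..1} t \<partial>lborel)"
    by (rule nn_integral_disc_radial) measurable
  also have "(\<integral>\<^sup>+t. ennreal (a / pi * (t ^ k * (1 - t) powr (a - 1))) * indicator {0..1} t \<partial>lborel) =
      (\<integral>\<^sup>+t. ennreal (a / pi) * (ennreal (t powr (real k + 1 - 1) * (1 - t) powr (a - 1)) * indicator {0..1} t) \<partial>lborel)"
  proof (rule nn_integral_cong_AE)
    have "AE t in lborel. (t::real) \<noteq> 0" by (rule AE_lborel_singleton)
    then show "AE t in lborel. ennreal (a / pi * (t ^ k * (1 - t) powr (a - 1))) * indicator {0..1} t =
        ennreal (a / pi) * (ennreal (t powr (real k + 1 - 1) * (1 - t) powr (a - 1)) * indicator {0..1} t)"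
    proof eventually_elim
      case (elim t)
      show ?case
      proof (cases "t \<in> {0..1}")
        case True
        then have "t powr real k = t ^ k" using elim by (intro powr_realpow) auto
        then show ?thesis using True a by (simp flip: ennreal_mult')
      qed simp
    qed
  qed
  also have "\<dots> = ennreal (a / pi) * ennreal (Beta (real k + 1) a)"
    by (subst nn_integral_cmult, simp) (subst nn_integral_beta, use a in auto)
  also have "ennreal pi * (ennreal (a / pi) * ennreal (Beta (real k + 1) a)) = ennreal (a * Beta (real k + 1) a)"
  proof -
    have "0 \<le> Beta (real k + 1) a" using a by (auto simp: Beta_def intro!: divide_nonneg_nonneg mult_nonneg_nonneg less_imp_le[OF Gamma_real_pos])
    then show ?thesis using a by (simp flip: ennreal_mult mult.assoc)
  qed
  also have "a * Beta (real k + 1) a = fact k / pochhammer (a + 1) k"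
  proof -
    have "Gamma (a + 1 + real k) = pochhammer (a + 1) k * Gamma (a + 1)"
    proof -
      have "a + 1 \<notin> \<int>\<^sub>\<le>\<^sub>0" using a by (auto simp: nonpos_Ints_def)
      moreover have "0 < Gamma (a + 1)" using a by (intro Gamma_real_pos) simp
      ultimately show ?thesis by (simp add: pochhammer_Gamma)
    qed
    moreover have "Gamma (a + 1) = a * Gamma a" using a by (intro Gamma_plus1) (auto simp: nonpos_Ints_def)
    moreover have "Gamma (real k + 1) = fact k" by (simp add: Gamma_fact add.commute)
    moreover have "real k + 1 + a = a + 1 + real k" by simp
    ultimately have "Beta (real k + 1) a = fact k * Gamma a / (pochhammer (a + 1) k * (a * Gamma a))"
      by (simp only: Beta_def)
    moreover have "Gamma a \<noteq> 0" using Gamma_real_pos[OF a] by simp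
    ultimately show ?thesis using a by simp
  qed
  finally show ?thesis .
qed

lemma prob_space_nu:
  assumes "0 \<le> a"
  shows "prob_space (nu (2 * a + 1))"
proof (cases "a = 0")
  case True
  then show ?thesis using prob_space_circle_haar by (simp add: nu_def)
next
  case False
  then have "emeasure (nu (2 * a + 1)) UNIV = 1"
    using nn_integral_nu_power[of a 0] assms by simp
  then show ?thesis by (intro prob_spaceI) simp
qed

text \<open>The expectation of \<open>jw \<delta>\<close> under \<open>nu (2 * a + 1)\<close>, see
  \<open>nn_integral_jw\<close>. The formula is Gauss's theorem at x = -delta, c = a + 1.\<close>

definition jconst :: "complex \<Rightarrow> real \<Rightarrow> real" where
  "jconst \<delta> a = Gamma (a + 1) * Gamma (a + 1 + 2 * Re \<delta>) / (cmod (Gamma (of_real a + 1 + \<delta>)))\<^sup>2"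

lemma jconst_eq_suminf:
  assumes "0 \<le> a" "- 1 / 2 < Re \<delta>"
  shows "summable (gterm (- \<delta>) (a + 1))" "suminf (gterm (- \<delta>) (a + 1)) = jconst \<delta> a"
proof -
  have s: "2 * Re \<delta> = - 2 * Re (- \<delta>)" by simp
  show "summable (gterm (- \<delta>) (a + 1))" using assms by (intro gterm_summable(1)[OF _ s]) auto
  show "suminf (gterm (- \<delta>) (a + 1)) = jconst \<delta> a"
    using assms by (subst gauss_sum[OF _ s]) (auto simp: jconst_def)
qed

lemma jconst_pos:
  assumes "0 \<le> a" "- 1 / 2 < Re \<delta>"
  shows "0 < jconst \<delta> a"
proof -
  have "1 \<le> suminf (gterm (- \<delta>) (a + 1))"
  proof -
    have "(\<Sum>k<1. gterm (- \<delta>) (a + 1) k) \<le> suminf (gterm (- \<delta>) (a + 1))"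
      using jconst_eq_suminf(1)[OF assms] assms by (intro sum_le_suminf gterm_nonneg) auto
    then show ?thesis by (simp add: gterm_def)
  qed
  then show ?thesis using jconst_eq_suminf(2)[OF assms] by simp
qed

lemma bcoef_gterm: "(cmod (bcoef \<delta> k))\<^sup>2 * (fact k / pochhammer (a + 1) k) = gterm (- \<delta>) (a + 1) k"
  unfolding cmod_bcoef gterm_def by (simp add: power2_eq_square)

lemma suminf_ennreal_gterm:
  assumes "0 \<le> a" "- 1 / 2 < Re \<delta>"
  shows "(\<Sum>k. ennreal (gterm (- \<delta>) (a + 1) k)) = ennreal (jconst \<delta> a)"
proof -
  have "(\<Sum>k. ennreal (gterm (- \<delta>) (a + 1) k)) = ennreal (suminf (gterm (- \<delta>) (a + 1)))"
    using assms gterm_nonneg[of "a + 1"] jconst_eq_suminf(1)[OF assms] by (intro suminf_ennreal2) auto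
  then show ?thesis using jconst_eq_suminf(2)[OF assms] by simp
qed

lemma AE_nu_disc:
  assumes "s \<noteq> 1"
  shows "AE z in nu s. cmod z < 1"
  unfolding nu_eq_density[OF assms] by (subst AE_density) (auto simp: nu_dens_def indicator_def)

text \<open>By rotation invariance \<open>z\<close> may be replaced by its average over the circle
  through it. Parseval on that circle leaves a power series in |z|^2, and the moments of
  \<open>nu\<close> turn it into the series summed in \<open>gauss_sum\<close>.\<close>

lemma nn_integral_nu_jw:
  assumes a: "0 < a" and \<delta>: "- 1 / 2 < Re \<delta>"
  shows "(\<integral>\<^sup>+z. ennreal (jw \<delta> z) \<partial>nu (2 * a + 1)) = ennreal (jconst \<delta> a)"
proof -
  let ?N = "nu (2 * a + 1)"
  interpret H: prob_space circle_haar by (rule prob_space_circle_haar)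
  interpret N: prob_space ?N using a by (intro prob_space_nu) simp
  interpret P: pair_sigma_finite circle_haar ?N ..
  have AEn: "AE z in ?N. cmod z < 1" using a by (intro AE_nu_disc) simp
  have m: "(\<lambda>(\<zeta>, z). ennreal (jw \<delta> (\<zeta> * z))) \<in> borel_measurable (circle_haar \<Otimes>\<^sub>M ?N)"
    by measurable
  have "(\<integral>\<^sup>+z. ennreal (jw \<delta> z) \<partial>?N) = (\<integral>\<^sup>+\<zeta>. (\<integral>\<^sup>+z. ennreal (jw \<delta> z) \<partial>?N) \<partial>circle_haar)"
    by (simp add: H.emeasure_space_1[simplified])
  also have "\<dots> = (\<integral>\<^sup>+\<zeta>. (\<integral>\<^sup>+z. ennreal (jw \<delta> (\<zeta> * z)) \<partial>?N) \<partial>circle_haar)"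
  proof (rule nn_integral_cong_AE)
    show "AE \<zeta> in circle_haar. (\<integral>\<^sup>+z. ennreal (jw \<delta> z) \<partial>?N) = (\<integral>\<^sup>+z. ennreal (jw \<delta> (\<zeta> * z)) \<partial>?N)"
      using AE_haar_norm by eventually_elim (rule nn_integral_nu_rotate[symmetric], simp_all)
  qed
  also have "\<dots> = (\<integral>\<^sup>+z. (\<integral>\<^sup>+\<zeta>. ennreal (jw \<delta> (\<zeta> * z)) \<partial>circle_haar) \<partial>?N)"
    using P.Fubini'[OF m] by simp
  also have "\<dots> = (\<integral>\<^sup>+z. (\<Sum>k. ennreal ((cmod (bcoef \<delta> k))\<^sup>2 * (cmod z) ^ (2 * k))) \<partial>?N)"
  proof (rule nn_integral_cong_AE)
    show "AE z in ?N. (\<integral>\<^sup>+\<zeta>. ennreal (jw \<delta> (\<zeta> * z)) \<partial>circle_haar) = (\<Sum>k. ennreal ((cmod (bcoef \<delta> k))\<^sup>2 * (cmod z) ^ (2 * k)))"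
      using AEn by eventually_elim (subst haar_parseval[symmetric], simp_all add: mult.commute)
  qed
  also have "\<dots> = (\<Sum>k. (\<integral>\<^sup>+z. ennreal ((cmod (bcoef \<delta> k))\<^sup>2 * (cmod z) ^ (2 * k)) \<partial>?N))"
    by (rule nn_integral_suminf) measurable
  also have "\<dots> = (\<Sum>k. ennreal (gterm (- \<delta>) (a + 1) k))"
  proof (rule suminf_cong)
    fix k
    have "(\<integral>\<^sup>+z. ennreal ((cmod (bcoef \<delta> k))\<^sup>2 * (cmod z) ^ (2 * k)) \<partial>?N) =
        (\<integral>\<^sup>+z. ennreal ((cmod (bcoef \<delta> k))\<^sup>2) * ennreal ((cmod z) ^ (2 * k)) \<partial>?N)"
      by (simp add: ennreal_mult)
    also have "\<dots> = ennreal ((cmod (bcoef \<delta> k))\<^sup>2) * ennreal (fact k / pochhammer (a + 1) k)"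
      using nn_integral_nu_power[OF a, of k] by (subst nn_integral_cmult) auto
    also have "\<dots> = ennreal (gterm (- \<delta>) (a + 1) k)"
      unfolding bcoef_gterm[symmetric] using a pochhammer_pos[of "a + 1" k] by (intro ennreal_mult[symmetric]) auto
    finally show "(\<integral>\<^sup>+z. ennreal ((cmod (bcoef \<delta> k))\<^sup>2 * (cmod z) ^ (2 * k)) \<partial>?N) = ennreal (gterm (- \<delta>) (a + 1) k)" .
  qed
  also have "\<dots> = ennreal (jconst \<delta> a)" using a \<delta> by (intro suminf_ennreal_gterm) auto
  finally show ?thesis .
qed

text \<open>\<open>jw\<close> is |1 - z|^(2 Re delta) times exp(2 Im delta * arg(1 - z)). The
  argument has modulus at most pi, so the second factor lies between 1/K and K.\<close>

lemma jw_bounds: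
  fixes z \<delta> :: complex
  assumes "z \<noteq> 1"
  defines "m \<equiv> exp (2 * Re \<delta> * ln (cmod (1 - z)))" and "K \<equiv> exp (2 * pi * \<bar>Im \<delta>\<bar>)"
  shows "jw \<delta> z \<le> K * m" "m \<le> K * jw \<delta> z"
proof -
  define A where "A = Im (Ln (1 - z))"
  have nz: "1 - z \<noteq> 0" using assms by simp
  have A: "\<bar>A\<bar> \<le> pi" using mpi_less_Im_Ln[OF nz] Im_Ln_le_pi[OF nz] by (simp add: A_def abs_le_iff)
  have e: "2 * Re (cnj \<delta> * Ln (1 - z)) = 2 * Re \<delta> * ln (cmod (1 - z)) + 2 * (Im \<delta> * A)"
    using nz by (simp add: A_def)
  have b: "\<bar>Im \<delta> * A\<bar> \<le> pi * \<bar>Im \<delta>\<bar>"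
    unfolding abs_mult using A by (simp add: mult.commute mult_right_mono)
  show "jw \<delta> z \<le> K * m"
    unfolding jw_eq_exp[OF assms(1)] e K_def m_def exp_add[symmetric] using b by simp
  show "m \<le> K * jw \<delta> z"
    unfolding jw_eq_exp[OF assms(1)] e K_def m_def exp_add[symmetric] using b by simp
qed

text \<open>The dominating function for the radial limit \<open>r \<rightarrow> 1\<close>: for \<open>Re \<delta> < 0\<close> use
  \<open>\<bar>1 - \<zeta>\<bar> \<le> 2 \<bar>1 - r\<zeta>\<bar>\<close>, otherwise \<open>\<bar>1 - r\<zeta>\<bar> \<le> 2\<close>.\<close>

lemma jw_radial_bound:
  "\<exists>C\<ge>0. \<forall>r \<zeta>. 0 \<le> r \<longrightarrow> r < 1 \<longrightarrow> cmod \<zeta> = 1 \<longrightarrow> \<zeta> \<noteq> 1 \<longrightarrow> jw \<delta> (of_real r * \<zeta>) \<le> C * (1 + jw \<delta> \<zeta>)"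
proof -
  define K where "K = exp (2 * pi * \<bar>Im \<delta>\<bar>)"
  define L where "L = exp (2 * \<bar>Re \<delta>\<bar> * ln 2)"
  have K: "1 \<le> K" "0 < K" by (simp_all add: K_def)
  have L: "0 < L" by (simp add: L_def)
  have "jw \<delta> (of_real r * \<zeta>) \<le> (K * L * K) * (1 + jw \<delta> \<zeta>)"
    if r: "0 \<le> r" "r < 1" and \<zeta>: "cmod \<zeta> = 1" "\<zeta> \<noteq> 1" for r \<zeta>
  proof -
    let ?w = "of_real r * \<zeta>"
    have w: "cmod ?w = r" using r \<zeta> by (simp add: norm_mult)
    then have w1: "?w \<noteq> 1" using r by (metis norm_one less_irrefl)
    have "cmod (1 - \<zeta>) \<le> cmod (1 - ?w) + cmod (?w - \<zeta>)"
      using norm_triangle_ineq[of "1 - ?w" "?w - \<zeta>"] by simp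
    also have "cmod (?w - \<zeta>) = 1 - r"
    proof -
      have "?w - \<zeta> = of_real (r - 1) * \<zeta>" by (simp add: algebra_simps)
      then show ?thesis using r \<zeta> by (simp only: norm_mult norm_of_real) simp
    qed
    also have "1 - r \<le> cmod (1 - ?w)" using norm_triangle_ineq2[of 1 ?w] w by simp
    finally have low: "cmod (1 - \<zeta>) \<le> 2 * cmod (1 - ?w)" by simp
    have up: "cmod (1 - ?w) \<le> 2" using norm_triangle_ineq4[of 1 ?w] w r by simp
    have p: "0 < cmod (1 - \<zeta>)" "0 < cmod (1 - ?w)" using \<zeta> w1 by auto
    have j1: "jw \<delta> ?w \<le> K * exp (2 * Re \<delta> * ln (cmod (1 - ?w)))" unfolding K_def by (rule jw_bounds(1)[OF w1])
    have j2: "exp (2 * Re \<delta> * ln (cmod (1 - \<zeta>))) \<le> K * jw \<delta> \<zeta>" unfolding K_def by (rule jw_bounds(2)[OF \<zeta>(2)])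
    have "exp (2 * Re \<delta> * ln (cmod (1 - ?w))) \<le> L * K * (1 + jw \<delta> \<zeta>)"
    proof (cases "0 \<le> Re \<delta>")
      case True
      have "ln (cmod (1 - ?w)) \<le> ln 2" using up p by simp
      then have "2 * Re \<delta> * ln (cmod (1 - ?w)) \<le> 2 * \<bar>Re \<delta>\<bar> * ln 2"
        using True mult_left_mono[of "ln (cmod (1 - ?w))" "ln 2" "2 * Re \<delta>"] by simp
      then have "exp (2 * Re \<delta> * ln (cmod (1 - ?w))) \<le> L" by (simp add: L_def)
      also have "\<dots> \<le> L * (K * (1 + jw \<delta> \<zeta>))"
        using mult_mono[of 1 K 1 "1 + jw \<delta> \<zeta>"] K L by simp
      finally show ?thesis by (simp only: mult.assoc)
    next
      case False
      have "ln (cmod (1 - \<zeta>)) \<le> ln (2 * cmod (1 - ?w))" using low p by simp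
      also have "\<dots> = ln 2 + ln (cmod (1 - ?w))" using p by (intro ln_mult_pos) auto
      finally have "2 * Re \<delta> * (ln 2 + ln (cmod (1 - ?w))) \<le> 2 * Re \<delta> * ln (cmod (1 - \<zeta>))"
        using False by (intro mult_left_mono_neg) auto
      then have "2 * Re \<delta> * ln (cmod (1 - ?w)) \<le> 2 * \<bar>Re \<delta>\<bar> * ln 2 + 2 * Re \<delta> * ln (cmod (1 - \<zeta>))"
        using False by (simp add: algebra_simps)
      then have "exp (2 * Re \<delta> * ln (cmod (1 - ?w))) \<le> L * exp (2 * Re \<delta> * ln (cmod (1 - \<zeta>)))"
        unfolding L_def exp_add[symmetric] by simp
      also have "\<dots> \<le> L * (K * jw \<delta> \<zeta>)" using j2 L by simp
      also have "\<dots> \<le> L * (K * (1 + jw \<delta> \<zeta>))" using K L by simp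
      finally show ?thesis by (simp only: mult.assoc)
    qed
    then have "K * exp (2 * Re \<delta> * ln (cmod (1 - ?w))) \<le> K * (L * K * (1 + jw \<delta> \<zeta>))"
      using K by (intro mult_left_mono) auto
    then show ?thesis using j1 by (simp only: mult.assoc)
  qed
  then show ?thesis using K L by (intro exI[of _ "K * L * K"]) auto
qed

lemma AE_haar_neq: "AE \<zeta> in circle_haar. \<zeta> \<noteq> 1"
proof -
  have "AE t in lborel. t \<in> {0..2 * pi} \<longrightarrow> cis t \<noteq> 1"
  proof -
    have "AE t in lborel. t \<noteq> 0 \<and> t \<noteq> 2 * pi"
      using AE_lborel_singleton[of 0] AE_lborel_singleton[of "2 * pi"] by auto
    then show ?thesis
    proof eventually_elim
      case (elim t)
      show ?case
      proof
        assume t: "t \<in> {0..2 * pi}"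
        show "cis t \<noteq> 1"
        proof
          assume "cis t = 1"
          then have "cos t = 1" by (simp add: complex_eq_iff)
          then obtain k :: int where "t = of_int k * 2 * pi" using cos_one_2pi_int[of t] by auto
          then have k: "t = 2 * pi * of_int k" by simp
          have "0 < t" "t < 2 * pi * 1" using t elim by auto
          then have "0 < real_of_int k" "real_of_int k < 1"
            unfolding k by (simp_all add: zero_less_mult_iff)
          then have "0 < k" "k < 1" by simp_all
          then show False by simp
        qed
      qed
    qed
  qed
  then have "AE t in uniform_measure lborel {0..2 * pi}. cis t \<noteq> 1"
    by (intro AE_uniform_measureI) auto
  then show ?thesis
    unfolding circle_haar_def by (subst AE_distr_iff) (auto simp: uniform_measure_def)
qed

text \<open>Parseval at radii below 1 gives integrals tending to the claimed value, but letting the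
  radius tend to 1 requires an integrable majorant. Fatou's lemma first shows that \<open>jw\<close>
  itself is integrable; the bound C * (1 + jw) is then admissible for dominated convergence.\<close>

lemma nn_integral_haar_jw:
  assumes \<delta>: "- 1 / 2 < Re \<delta>"
  shows "(\<integral>\<^sup>+\<zeta>. ennreal (jw \<delta> \<zeta>) \<partial>circle_haar) = ennreal (jconst \<delta> 0)"
proof -
  interpret prob_space circle_haar by (rule prob_space_circle_haar)
  define r where "r n = 1 - 1 / (real n + 2)" for n
  have r: "0 \<le> r n" "r n < 1" for n by (auto simp: r_def field_simps)
  have rl: "r \<longlonglongrightarrow> 1" unfolding r_def[abs_def] by real_asymp
  let ?J = "\<lambda>n \<zeta>. ennreal (jw \<delta> (of_real (r n) * \<zeta>))"
  have Jm: "?J n \<in> borel_measurable circle_haar" for n by measurable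
  have J1m: "(\<lambda>\<zeta>. ennreal (jw \<delta> \<zeta>)) \<in> borel_measurable circle_haar" by measurable
  have ptw: "AE \<zeta> in circle_haar. (\<lambda>n. ?J n \<zeta>) \<longlonglongrightarrow> ennreal (jw \<delta> \<zeta>)"
    using AE_haar_norm AE_haar_neq
  proof eventually_elim
    case (elim \<zeta>)
    have "0 < Re (1 - \<zeta>)" using elim by (intro Re_pos_of_unit_disc) auto
    then have sl: "1 - \<zeta> \<notin> \<real>\<^sub>\<le>\<^sub>0" by (auto simp: complex_nonpos_Reals_iff)
    have "(\<lambda>n. 1 - of_real (r n) * \<zeta>) \<longlonglongrightarrow> 1 - of_real 1 * \<zeta>" by (intro tendsto_intros rl)
    then have l: "(\<lambda>n. 1 - of_real (r n) * \<zeta>) \<longlonglongrightarrow> 1 - \<zeta>" by simp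
    have "(\<lambda>n. (1 - of_real (r n) * \<zeta>) powr cnj \<delta>) \<longlonglongrightarrow> (1 - \<zeta>) powr cnj \<delta>"
      by (intro tendsto_powr_complex l tendsto_const sl)
    then show ?case unfolding jw_def by (intro tendsto_ennrealI tendsto_power tendsto_norm)
  qed
  have val: "(\<integral>\<^sup>+\<zeta>. ?J n \<zeta> \<partial>circle_haar) = (\<Sum>k. ennreal ((cmod (bcoef \<delta> k))\<^sup>2 * r n ^ (2 * k)))" for n
  proof -
    have c: "cmod (complex_of_real (r n)) = r n" using r[of n] by simp
    have "cmod (complex_of_real (r n)) < 1" unfolding c by (rule r)
    from haar_parseval[OF this, of \<delta>] show ?thesis unfolding c .
  qed
  have fin: "(\<Sum>k. ennreal ((cmod (bcoef \<delta> k))\<^sup>2)) = ennreal (jconst \<delta> 0)"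
  proof -
    have "(cmod (bcoef \<delta> k))\<^sup>2 = gterm (- \<delta>) (0 + 1) k" for k
    proof -
      have p: "pochhammer (0 + 1) k = (fact k :: real)" by (simp add: pochhammer_fact)
      show ?thesis unfolding bcoef_gterm[symmetric] p by simp
    qed
    then show ?thesis using suminf_ennreal_gterm[OF order_refl \<delta>] by (simp only:)
  qed
  have conv: "(\<lambda>n. \<integral>\<^sup>+\<zeta>. ?J n \<zeta> \<partial>circle_haar) \<longlonglongrightarrow> ennreal (jconst \<delta> 0)"
  proof -
    have "(\<lambda>n. \<integral>\<^sup>+k. ennreal ((cmod (bcoef \<delta> k))\<^sup>2 * r n ^ (2 * k)) \<partial>count_space UNIV) \<longlonglongrightarrow>
        (\<integral>\<^sup>+k. ennreal ((cmod (bcoef \<delta> k))\<^sup>2) \<partial>count_space UNIV)"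
    proof (rule nn_integral_dominated_convergence[where w = "\<lambda>k. ennreal ((cmod (bcoef \<delta> k))\<^sup>2)"])
      show "AE k in count_space UNIV. ennreal ((cmod (bcoef \<delta> k))\<^sup>2 * r j ^ (2 * k)) \<le> ennreal ((cmod (bcoef \<delta> k))\<^sup>2)" for j
        using r[of j] by (auto intro!: ennreal_leI mult_left_le power_le_one)
      show "(\<integral>\<^sup>+k. ennreal ((cmod (bcoef \<delta> k))\<^sup>2) \<partial>count_space UNIV) < \<infinity>"
        unfolding nn_integral_count_space_nat fin by simp
      show "AE k in count_space UNIV. (\<lambda>n. ennreal ((cmod (bcoef \<delta> k))\<^sup>2 * r n ^ (2 * k))) \<longlonglongrightarrow> ennreal ((cmod (bcoef \<delta> k))\<^sup>2)"
      proof (rule AE_I2)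
        fix k
        have "(\<lambda>n. (cmod (bcoef \<delta> k))\<^sup>2 * r n ^ (2 * k)) \<longlonglongrightarrow> (cmod (bcoef \<delta> k))\<^sup>2 * 1 ^ (2 * k)"
          by (intro tendsto_intros rl)
        then show "(\<lambda>n. ennreal ((cmod (bcoef \<delta> k))\<^sup>2 * r n ^ (2 * k))) \<longlonglongrightarrow> ennreal ((cmod (bcoef \<delta> k))\<^sup>2)"
          by (intro tendsto_ennrealI) simp
      qed
    qed auto
    then show ?thesis unfolding nn_integral_count_space_nat val fin .
  qed
  have le: "(\<integral>\<^sup>+\<zeta>. ennreal (jw \<delta> \<zeta>) \<partial>circle_haar) \<le> ennreal (jconst \<delta> 0)"
  proof -
    have "(\<integral>\<^sup>+\<zeta>. ennreal (jw \<delta> \<zeta>) \<partial>circle_haar) = (\<integral>\<^sup>+\<zeta>. liminf (\<lambda>n. ?J n \<zeta>) \<partial>circle_haar)"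
    proof (rule nn_integral_cong_AE)
      show "AE \<zeta> in circle_haar. ennreal (jw \<delta> \<zeta>) = liminf (\<lambda>n. ?J n \<zeta>)"
        using ptw
      proof eventually_elim
        case (elim \<zeta>)
        show ?case by (rule lim_imp_Liminf[OF _ elim, symmetric]) simp
      qed
    qed
    also have "\<dots> \<le> liminf (\<lambda>n. \<integral>\<^sup>+\<zeta>. ?J n \<zeta> \<partial>circle_haar)" by (rule nn_integral_liminf[OF Jm])
    also have "\<dots> = ennreal (jconst \<delta> 0)" using conv by (simp add: lim_imp_Liminf)
    finally show ?thesis .
  qed
  obtain C where C: "0 \<le> C" "\<And>r \<zeta>. \<lbrakk>0 \<le> r; r < 1; cmod \<zeta> = 1; \<zeta> \<noteq> 1\<rbrakk> \<Longrightarrow> jw \<delta> (of_real r * \<zeta>) \<le> C * (1 + jw \<delta> \<zeta>)"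
    using jw_radial_bound[of \<delta>] by blast
  have "(\<lambda>n. \<integral>\<^sup>+\<zeta>. ?J n \<zeta> \<partial>circle_haar) \<longlonglongrightarrow> (\<integral>\<^sup>+\<zeta>. ennreal (jw \<delta> \<zeta>) \<partial>circle_haar)"
  proof (rule nn_integral_dominated_convergence[OF Jm J1m _ _ _ ptw, where w = "\<lambda>\<zeta>. ennreal (C * (1 + jw \<delta> \<zeta>))"])
    show "AE \<zeta> in circle_haar. ?J j \<zeta> \<le> ennreal (C * (1 + jw \<delta> \<zeta>))" for j
      using AE_haar_norm AE_haar_neq by eventually_elim (intro ennreal_leI C(2) r)
    have "(\<integral>\<^sup>+\<zeta>. ennreal (C * (1 + jw \<delta> \<zeta>)) \<partial>circle_haar) = ennreal C * (\<integral>\<^sup>+\<zeta>. 1 + ennreal (jw \<delta> \<zeta>) \<partial>circle_haar)"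
      using C(1) by (subst nn_integral_cmult[symmetric]) (auto simp: ennreal_mult ennreal_plus simp flip: ennreal_1)
    also have "\<dots> = ennreal C * (1 + (\<integral>\<^sup>+\<zeta>. ennreal (jw \<delta> \<zeta>) \<partial>circle_haar))"
      by (subst nn_integral_add) (auto simp: emeasure_space_1[simplified])
    also have "\<dots> \<le> ennreal C * (1 + ennreal (jconst \<delta> 0))"
      by (intro mult_left_mono add_left_mono le) auto
    also have "\<dots> < \<infinity>" by (simp add: ennreal_mult_less_top)
    finally show "(\<integral>\<^sup>+\<zeta>. ennreal (C * (1 + jw \<delta> \<zeta>)) \<partial>circle_haar) < \<infinity>" .
  qed measurable
  then show ?thesis using conv LIMSEQ_unique by blast
qed

lemma nn_integral_jw:
  assumes "0 \<le> a" and \<delta>: "- 1 / 2 < Re \<delta>"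
  shows "(\<integral>\<^sup>+z. ennreal (jw \<delta> z) \<partial>nu (2 * a + 1)) = ennreal (jconst \<delta> a)"
  using nn_integral_nu_jw[of a \<delta>] nn_integral_haar_jw[OF \<delta>] assms by (cases "a = 0") (auto simp: nu_def)

section \<open>The law of the deformed coefficients\<close>

text \<open>The default 1 keeps the modulus equal to 1 for every sequence, so that reflection
  invariance applies pointwise, without excluding a null set.\<close>

definition uphase :: "(nat \<Rightarrow> complex) \<Rightarrow> nat \<Rightarrow> complex" where
  "uphase \<alpha> k = (if poly (szego \<alpha> k) 1 = 0 then 1 else cnj (poly (szego \<alpha> k) 1) / poly (szego \<alpha> k) 1)"

definition dmap :: "nat \<Rightarrow> (nat \<Rightarrow> complex) \<Rightarrow> nat \<Rightarrow> complex" where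
  "dmap m \<alpha> = (\<lambda>k\<in>{..<m}. uphase \<alpha> k * cnj (\<alpha> k))"

lemma cmod_uphase [simp]: "cmod (uphase \<alpha> k) = 1"
  by (simp add: uphase_def norm_divide)

lemma deformed_eq_uphase:
  assumes "\<alpha> \<in> verb_range n" "k < n"
  shows "deformed \<alpha> k = uphase \<alpha> k * cnj (\<alpha> k)"
proof -
  have "poly (szego \<alpha> k) 1 \<noteq> 0" using assms by (intro szego_at_1_nonzero) (auto simp: verb_range_def)
  then show ?thesis by (simp add: deformed_eq uphase_def)
qed

lemma uphase_cong: "(\<And>j. j < k \<Longrightarrow> \<alpha> j = \<alpha>' j) \<Longrightarrow> uphase \<alpha> k = uphase \<alpha>' k"
  unfolding uphase_def using szego_cong[of k \<alpha> \<alpha>'] by simp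

lemma measurable_uphase:
  assumes "\<And>j. j < k \<Longrightarrow> (\<lambda>\<alpha>. \<alpha> j) \<in> borel_measurable N"
  shows "(\<lambda>\<alpha>. uphase \<alpha> k) \<in> borel_measurable N"
proof -
  have p: "(\<lambda>\<alpha>. poly (szego \<alpha> k) 1) \<in> borel_measurable N"
    using measurable_szego_coeff[OF assms] by (simp add: poly_altdef)
  have "{\<alpha> \<in> space N. poly (szego \<alpha> k) 1 = 0} = (\<lambda>\<alpha>. poly (szego \<alpha> k) 1) -` {0} \<inter> space N" by auto
  also have "\<dots> \<in> sets N" by (rule measurable_sets[OF p]) simp
  finally show ?thesis unfolding uphase_def
    using p by (intro measurable_If borel_measurable_divide measurable_cnj) auto
qed

locale nu_product =
  fixes s :: "nat \<Rightarrow> real"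
  assumes prob_nu: "\<And>k. prob_space (nu (s k))"
begin

abbreviation nus :: "nat \<Rightarrow> complex measure" where "nus k \<equiv> nu (s k)"

sublocale product_prob_space nus
  by (rule product_prob_spaceI) (rule prob_nu)

lemma measurable_comp: "k \<in> I \<Longrightarrow> (\<lambda>\<alpha>. \<alpha> k) \<in> borel_measurable (Pi\<^sub>M I nus)"
  using measurable_component_singleton[of k I nus] by (simp cong: measurable_cong_sets)

lemma measurable_dmap: "dmap m \<in> Pi\<^sub>M {..<m} nus \<rightarrow>\<^sub>M Pi\<^sub>M {..<m} nus"
  unfolding dmap_def
proof (rule measurable_restrict)
  fix k assume "k \<in> {..<m}"
  then have "(\<lambda>\<alpha>. uphase \<alpha> k * cnj (\<alpha> k)) \<in> borel_measurable (Pi\<^sub>M {..<m} nus)"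
    by (intro borel_measurable_times measurable_uphase measurable_cnj measurable_comp) auto
  then show "(\<lambda>\<alpha>. uphase \<alpha> k * cnj (\<alpha> k)) \<in> Pi\<^sub>M {..<m} nus \<rightarrow>\<^sub>M nus k"
    by (simp cong: measurable_cong_sets)
qed

lemma dmap_upd:
  assumes "\<alpha> \<in> space (Pi\<^sub>M {..<m} nus)"
  shows "dmap (Suc m) (\<alpha>(m := y)) = (dmap m \<alpha>)(m := uphase \<alpha> m * cnj y)"
proof
  fix k
  have u: "uphase (\<alpha>(m := y)) k = uphase \<alpha> k" if "k \<le> m" using that by (intro uphase_cong) auto
  show "dmap (Suc m) (\<alpha>(m := y)) k = ((dmap m \<alpha>)(m := uphase \<alpha> m * cnj y)) k"
    using u by (cases k m rule: linorder_cases) (auto simp: dmap_def)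
qed

text \<open>The phase at index m depends on earlier coordinates only. With those fixed, the last
  coordinate undergoes a reflection that preserves its law; after it is integrated out, the
  induction hypothesis handles the others.\<close>

lemma nn_integral_dmap:
  assumes "f \<in> borel_measurable (Pi\<^sub>M {..<m} nus)"
  shows "(\<integral>\<^sup>+\<alpha>. f (dmap m \<alpha>) \<partial>Pi\<^sub>M {..<m} nus) = (\<integral>\<^sup>+\<alpha>. f \<alpha> \<partial>Pi\<^sub>M {..<m} nus)"
  using assms
proof (induction m arbitrary: f)
  case 0
  have "dmap 0 \<alpha> = \<alpha>" if "\<alpha> \<in> space (Pi\<^sub>M {..<0} nus)" for \<alpha>
    using that by (auto simp: dmap_def space_PiM)
  then show ?case by (intro nn_integral_cong) simp
next
  case (Suc m)
  have ins: "{..<Suc m} = insert m {..<m}" by auto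
  have f: "f \<in> borel_measurable (Pi\<^sub>M (insert m {..<m}) nus)" using Suc.prems by (simp add: ins)
  have fT: "(\<lambda>\<alpha>. f (dmap (Suc m) \<alpha>)) \<in> borel_measurable (Pi\<^sub>M (insert m {..<m}) nus)"
    using measurable_compose[OF measurable_dmap[of "Suc m"] Suc.prems] by (simp add: ins)
  define F where "F x = (\<integral>\<^sup>+y. f (x(m := y)) \<partial>nus m)" for x
  have upd: "(\<lambda>(x, y). f (x(m := y))) \<in> borel_measurable (Pi\<^sub>M {..<m} nus \<Otimes>\<^sub>M nus m)"
    using measurable_compose[OF measurable_add_dim f] by (simp add: case_prod_beta')
  have F: "F \<in> borel_measurable (Pi\<^sub>M {..<m} nus)"
    unfolding F_def by (rule sigma_finite_measure.borel_measurable_nn_integral[OF prob_space_imp_sigma_finite[OF prob_nu] upd])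
  have fy: "(\<lambda>y. f (x(m := y))) \<in> borel_measurable borel" if "x \<in> space (Pi\<^sub>M {..<m} nus)" for x
  proof -
    have "(\<lambda>y. case (x, y) of (x, y) \<Rightarrow> f (x(m := y))) \<in> borel_measurable (nus m)"
      by (rule measurable_compose[OF measurable_Pair1'[OF that] upd])
    then show ?thesis by (simp cong: measurable_cong_sets)
  qed
  have "(\<integral>\<^sup>+\<alpha>. f (dmap (Suc m) \<alpha>) \<partial>Pi\<^sub>M {..<Suc m} nus) =
      (\<integral>\<^sup>+\<alpha>. \<integral>\<^sup>+y. f (dmap (Suc m) (\<alpha>(m := y))) \<partial>nus m \<partial>Pi\<^sub>M {..<m} nus)"
    unfolding ins by (rule product_nn_integral_insert[OF _ _ fT]) auto
  also have "\<dots> = (\<integral>\<^sup>+\<alpha>. F (dmap m \<alpha>) \<partial>Pi\<^sub>M {..<m} nus)"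
  proof (rule nn_integral_cong)
    fix \<alpha> assume \<alpha>: "\<alpha> \<in> space (Pi\<^sub>M {..<m} nus)"
    have "(\<integral>\<^sup>+y. f (dmap (Suc m) (\<alpha>(m := y))) \<partial>nus m) = (\<integral>\<^sup>+y. f ((dmap m \<alpha>)(m := uphase \<alpha> m * cnj y)) \<partial>nus m)"
      unfolding dmap_upd[OF \<alpha>] ..
    also have "\<dots> = F (dmap m \<alpha>)"
      unfolding F_def
      by (rule nn_integral_nu_refl[OF _ fy]) (use measurable_space[OF measurable_dmap \<alpha>] in auto)
    finally show "(\<integral>\<^sup>+y. f (dmap (Suc m) (\<alpha>(m := y))) \<partial>nus m) = F (dmap m \<alpha>)" .
  qed
  also have "\<dots> = (\<integral>\<^sup>+\<alpha>. F \<alpha> \<partial>Pi\<^sub>M {..<m} nus)" by (rule Suc.IH[OF F])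
  also have "\<dots> = (\<integral>\<^sup>+\<alpha>. f \<alpha> \<partial>Pi\<^sub>M {..<Suc m} nus)"
    unfolding ins F_def by (rule product_nn_integral_insert[OF _ _ f, symmetric]) auto
  finally show ?case .
qed

text \<open>This is where reweighting keeps independence. Each factor is normalised on its own
  coordinate, so the reweighted marginals are probability measures, and on rectangles the integral
  factorises.\<close>

lemma density_prod_eq_PiM:
  assumes I: "finite I" and w: "\<And>k. w k \<in> borel_measurable borel"
    and w1: "\<And>k. (\<integral>\<^sup>+z. w k z \<partial>nus k) = 1"
  shows "density (Pi\<^sub>M I nus) (\<lambda>x. \<Prod>k\<in>I. w k (x k)) = Pi\<^sub>M I (\<lambda>k. density (nus k) (w k))"
proof -
  have wN: "w k \<in> borel_measurable (nus k)" for k using w by (simp cong: measurable_cong_sets)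
  have pr: "prob_space (density (nus k) (w k))" for k
    using w1[of k] wN[of k] by (intro prob_spaceI) (simp add: emeasure_density)
  interpret D: product_prob_space "\<lambda>k. density (nus k) (w k)"
    by (rule product_prob_spaceI) (rule pr)
  have wm: "(\<lambda>x. \<Prod>k\<in>I. w k (x k)) \<in> borel_measurable (Pi\<^sub>M I nus)"
    by (intro borel_measurable_prod_ennreal measurable_compose[OF measurable_comp w])
  show ?thesis
  proof (rule D.PiM_eqI[OF I])
    show "sets (density (Pi\<^sub>M I nus) (\<lambda>x. \<Prod>k\<in>I. w k (x k))) = sets (Pi\<^sub>M I (\<lambda>k. density (nus k) (w k)))"
      unfolding sets_density by (rule sets_PiM_cong) auto
    fix A assume A: "\<And>i. i \<in> I \<Longrightarrow> A i \<in> sets (density (nus i) (w i))"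
    then have A': "\<And>i. i \<in> I \<Longrightarrow> A i \<in> sets (nus i)" by simp
    have "emeasure (density (Pi\<^sub>M I nus) (\<lambda>x. \<Prod>k\<in>I. w k (x k))) (Pi\<^sub>E I A) =
        (\<integral>\<^sup>+x. (\<Prod>k\<in>I. w k (x k)) * indicator (Pi\<^sub>E I A) x \<partial>Pi\<^sub>M I nus)"
      by (rule emeasure_density[OF wm]) (rule sets_PiM_I_finite[OF I A'])
    also have "\<dots> = (\<integral>\<^sup>+x. (\<Prod>k\<in>I. w k (x k) * indicator (A k) (x k)) \<partial>Pi\<^sub>M I nus)"
    proof (rule nn_integral_cong)
      fix x assume x: "x \<in> space (Pi\<^sub>M I nus)"
      have "indicator (Pi\<^sub>E I A) x = (\<Prod>k\<in>I. indicator (A k) (x k) :: ennreal)"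
      proof (cases "x \<in> Pi\<^sub>E I A")
        case True
        then show ?thesis by (auto simp: indicator_def PiE_def Pi_def intro!: prod.neutral)
      next
        case False
        then obtain k where "k \<in> I" "x k \<notin> A k" using x by (auto simp: space_PiM PiE_def Pi_def)
        then show ?thesis using False I by (auto simp: indicator_def intro!: prod_zero[symmetric])
      qed
      then show "(\<Prod>k\<in>I. w k (x k)) * indicator (Pi\<^sub>E I A) x = (\<Prod>k\<in>I. w k (x k) * indicator (A k) (x k))"
        by (simp add: prod.distrib)
    qed
    also have "\<dots> = (\<Prod>k\<in>I. \<integral>\<^sup>+z. w k z * indicator (A k) z \<partial>nus k)"
      using wN A' by (intro product_nn_integral_prod[OF I]) auto
    also have "\<dots> = (\<Prod>k\<in>I. emeasure (density (nus k) (w k)) (A k))"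
      using wN A' by (intro prod.cong refl emeasure_density[symmetric]) auto
    finally show "emeasure (density (Pi\<^sub>M I nus) (\<lambda>x. \<Prod>k\<in>I. w k (x k))) (Pi\<^sub>E I A) =
        (\<Prod>k\<in>I. emeasure (density (nus k) (w k)) (A k))" .
  qed
qed

end

text \<open>The parameter a with law \<open>nu (2 * a + 1)\<close> at index \<open>k\<close>. For
  \<open>k < n\<close> and beta > 0 it is 0 exactly at \<open>k = n - 1\<close>, where
  \<open>nu\<close> becomes Haar measure.\<close>

definition cjs :: "nat \<Rightarrow> real \<Rightarrow> nat \<Rightarrow> real" where
  "cjs n \<beta> k = \<beta> / 2 * real (n - k - 1)"

lemma cjs_nu: "\<beta> * real (n - k - 1) + 1 = 2 * cjs n \<beta> k + 1"
  by (simp add: cjs_def)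

lemma density_cong_AE:
  assumes "AE x in M. f x = g x"
  shows "density M f = density M g"
proof -
  have "(\<lambda>A. \<integral>\<^sup>+x. f x * indicator A x \<partial>M) = (\<lambda>A. \<integral>\<^sup>+x. g x * indicator A x \<partial>M)"
    using assms by (intro ext nn_integral_cong_AE) auto
  then show ?thesis by (simp only: density_def)
qed

definition jfactor :: "nat \<Rightarrow> complex \<Rightarrow> real \<Rightarrow> nat \<Rightarrow> complex \<Rightarrow> ennreal" where
  "jfactor n \<delta> \<beta> k z = ennreal (jw \<delta> z / jconst \<delta> (cjs n \<beta> k))"

lemma measurable_jfactor [measurable]: "jfactor n \<delta> \<beta> k \<in> borel_measurable borel"
  unfolding jfactor_def by measurable

lemma nn_integral_jfactor:
  assumes \<delta>: "Re \<delta> > - 1 / 2" and \<beta>: "\<beta> > 0"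
  shows "(\<integral>\<^sup>+z. jfactor n \<delta> \<beta> k z \<partial>nu (2 * cjs n \<beta> k + 1)) = 1"
proof -
  have a0: "0 \<le> cjs n \<beta> k" using \<beta> by (simp add: cjs_def)
  have jp: "0 < jconst \<delta> (cjs n \<beta> k)" by (rule jconst_pos[OF a0 \<delta>])
  have "(\<integral>\<^sup>+z. jfactor n \<delta> \<beta> k z \<partial>nu (2 * cjs n \<beta> k + 1)) =
      (\<integral>\<^sup>+z. ennreal (jw \<delta> z) / ennreal (jconst \<delta> (cjs n \<beta> k)) \<partial>nu (2 * cjs n \<beta> k + 1))"
    unfolding jfactor_def using jp by (intro nn_integral_cong) (simp add: divide_ennreal)
  also have "\<dots> = ennreal (jconst \<delta> (cjs n \<beta> k)) / ennreal (jconst \<delta> (cjs n \<beta> k))"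
    unfolding nn_integral_jw[OF a0 \<delta>, symmetric] by (rule nn_integral_divide) (simp cong: measurable_cong_sets)
  also have "\<dots> = 1" using jp by (simp add: divide_ennreal)
  finally show ?thesis .
qed

text \<open>Almost surely the determinant, like the tested quantity, depends on the matrix only
  through the tuple \<open>g A\<close> of its deformed coefficients. The single change of variables
  \<open>int\<close> therefore yields both the normalising constant and the reweighted
  integral.\<close>

lemma law_gcoef:
  assumes n1: "1 \<le> n" and \<delta>: "Re \<delta> > - 1 / 2" and \<beta>: "\<beta> > 0"
    and f: "f \<in> borel_measurable (Pi\<^sub>M {..<n} (\<lambda>_. borel))"
  defines "N \<equiv> \<lambda>k. nu (2 * cjs n \<beta> k + 1)"
  shows "(\<integral>\<^sup>+A. f (\<lambda>k\<in>{..<n}. gcoef n A k) \<partial>CJ n \<delta> \<beta>) =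
    (\<integral>\<^sup>+x. f x \<partial>Pi\<^sub>M {..<n} (\<lambda>k. density (N k) (jfactor n \<delta> \<beta> k)))"
proof -
  have a0: "0 \<le> cjs n \<beta> k" for k using \<beta> by (simp add: cjs_def)
  interpret nu_product "\<lambda>k. 2 * cjs n \<beta> k + 1"
    by (rule nu_product.intro) (rule prob_space_nu[OF a0])
  let ?P = "Pi\<^sub>M {..<n} N"
  have PN: "Pi\<^sub>M {..<n} (\<lambda>k. nu (2 * cjs n \<beta> k + 1)) = ?P" by (simp add: N_def)
  have C0: "CJ0 n \<beta> = distr ?P (mat_borel n) (ggt n)"
    unfolding CJ0_def cjs_nu N_def ..
  have comp: "(\<lambda>\<alpha>. \<alpha> k) \<in> borel_measurable ?P" if "k < n" for k
    using measurable_comp[of k "{..<n}"] that by (simp add: PN)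
  have Gm: "ggt n \<in> ?P \<rightarrow>\<^sub>M mat_borel n" by (rule measurable_ggt[OF comp n1])
  have fP: "f \<in> borel_measurable ?P"
    using f by (subst measurable_cong_sets[OF sets_PiM_cong refl]) (auto simp: N_def)
  have AEv: "AE \<alpha> in ?P. \<alpha> \<in> verb_range n"
  proof -
    have "AE \<alpha> in ?P. if k = n - 1 then cmod (\<alpha> k) = 1 else cmod (\<alpha> k) < 1" if k: "k < n" for k
    proof -
      have "AE z in N k. if k = n - 1 then cmod z = 1 else cmod z < 1"
      proof (cases "k = n - 1")
        case True
        then have "cjs n \<beta> k = 0" using n1 by (simp add: cjs_def)
        then have "N k = circle_haar" by (simp add: N_def nu_def)
        then show ?thesis using AE_haar_norm unfolding if_P[OF True] by (simp only:)
      next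
        case False
        then have pos: "0 < cjs n \<beta> k" using k \<beta> by (simp add: cjs_def)
        have "AE z in N k. cmod z < 1" unfolding N_def using pos by (intro AE_nu_disc) simp
        then show ?thesis using False by (simp only: if_False)
      qed
      then show ?thesis
        using k prob_nu by (intro AE_PiM_component[where P = "\<lambda>z. if k = n - 1 then cmod z = 1 else cmod z < 1"]) (auto simp: N_def)
    qed
    then have "AE \<alpha> in ?P. \<forall>k\<in>{..<n}. if k = n - 1 then cmod (\<alpha> k) = 1 else cmod (\<alpha> k) < 1"
      by (subst AE_finite_all) auto
    then show ?thesis
    proof eventually_elim
      case (elim \<alpha>)
      show ?case unfolding verb_range_def
      proof (intro CollectI conjI allI impI)
        show "cmod (\<alpha> k) < 1" if "k < n - 1" for k using elim[rule_format, of k] that by auto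
        show "cmod (\<alpha> (n - 1)) = 1" using elim[rule_format, of "n - 1"] n1 by auto
      qed
    qed
  qed
  define w where "w x = (\<Prod>k<n. ennreal (jw \<delta> (x k)))" for x :: "nat \<Rightarrow> complex"
  have wm: "w \<in> borel_measurable ?P"
    unfolding w_def by (intro borel_measurable_prod_ennreal measurable_compose[OF comp]) auto
  define g where "g A = (\<lambda>k\<in>{..<n}. gcoef n A k)" for A
  have gm: "g \<in> mat_borel n \<rightarrow>\<^sub>M ?P"
    unfolding g_def
  proof (rule measurable_restrict)
    fix k assume "k \<in> {..<n}"
    then show "(\<lambda>A. gcoef n A k) \<in> mat_borel n \<rightarrow>\<^sub>M N k"
      using measurable_gcoef[OF n1, of k] by (simp add: N_def cong: measurable_cong_sets)
  qed
  \<comment> \<open>The deformed coefficients of a good matrix lie in the closed disc, where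
    \<open>jweight\<close> and the nonnegative \<open>jw\<close> coincide; so taking real parts
    loses nothing.\<close>
  have ggood: "ennreal (Re (det_delta \<delta> A)) = w (g A)" if A: "A \<in> good_mats n" for A
  proof -
    have "jweight \<delta> (deformed (galph n A) k) = of_real (jw \<delta> (g A k))" if k: "k < n" for k
    proof -
      have "cmod (deformed (galph n A) k) = cmod (galph n A k)"
        by (rule deformed_bounds[OF galph_in_range[OF A n1] k])
      also have "\<dots> \<le> 1"
        using galph_in_range[OF A n1] k by (cases "k = n - 1") (auto simp: verb_range_def intro: less_imp_le)
      finally show ?thesis
        using deformed_spectral_good[OF A n1 k] k by (simp add: jweight_eq_jw g_def gcoef_def)
    qed
    then have det: "det_delta \<delta> A = of_real (\<Prod>k<n. jw \<delta> (g A k))"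
      unfolding det_delta_good[OF A n1] by simp
    show ?thesis unfolding det Re_complex_of_real w_def by (rule prod_ennreal[symmetric]) simp
  qed
  have gg: "g (ggt n \<alpha>) = dmap n \<alpha>" if \<alpha>: "\<alpha> \<in> verb_range n" for \<alpha>
  proof
    fix k
    show "g (ggt n \<alpha>) k = dmap n \<alpha> k"
      using deformed_ggt[OF \<alpha> n1, of k] deformed_eq_uphase[OF \<alpha>, of k] by (auto simp: g_def dmap_def gcoef_def)
  qed
  have AEg: "AE A in CJ0 n \<beta>. A \<in> good_mats n"
  proof -
    have "AE \<alpha> in ?P. ggt n \<alpha> \<in> good_mats n"
      using AEv by eventually_elim (rule ggt_good(1)[OF _ n1])
    moreover have "{A \<in> space (mat_borel n). A \<in> good_mats n} = good_mats n"
      by (auto simp: space_mat_borel good_mats_def unitary_mat_def)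
    then have "{A \<in> space (mat_borel n). A \<in> good_mats n} \<in> sets (mat_borel n)" by (simp add: sets_good_mats)
    ultimately show ?thesis unfolding C0 by (subst AE_distr_iff[OF Gm]) auto
  qed
  have int: "(\<integral>\<^sup>+A. h (g A) \<partial>CJ0 n \<beta>) = (\<integral>\<^sup>+x. h x \<partial>?P)" if h: "h \<in> borel_measurable ?P" for h
  proof -
    have "(\<integral>\<^sup>+A. h (g A) \<partial>CJ0 n \<beta>) = (\<integral>\<^sup>+\<alpha>. h (g (ggt n \<alpha>)) \<partial>?P)"
      unfolding C0 using measurable_compose[OF gm h] by (subst nn_integral_distr[OF Gm]) auto
    also have "\<dots> = (\<integral>\<^sup>+\<alpha>. h (dmap n \<alpha>) \<partial>?P)"
    proof (rule nn_integral_cong_AE)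
      show "AE \<alpha> in ?P. h (g (ggt n \<alpha>)) = h (dmap n \<alpha>)"
        using AEv by eventually_elim (simp add: gg)
    qed
    also have "\<dots> = (\<integral>\<^sup>+x. h x \<partial>?P)" using nn_integral_dmap[of h n] h by (simp add: PN)
    finally show ?thesis .
  qed
  define Z where "Z = (\<Prod>k<n. jconst \<delta> (cjs n \<beta> k))"
  have Zp: "0 < Z" unfolding Z_def using jconst_pos[OF a0 \<delta>] by (intro prod_pos) auto
  have Zint: "(\<integral>\<^sup>+V. ennreal (Re (det_delta \<delta> V)) \<partial>CJ0 n \<beta>) = ennreal Z"
  proof -
    have "(\<integral>\<^sup>+V. ennreal (Re (det_delta \<delta> V)) \<partial>CJ0 n \<beta>) = (\<integral>\<^sup>+V. w (g V) \<partial>CJ0 n \<beta>)"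
      using AEg by (intro nn_integral_cong_AE) (auto simp: ggood)
    also have "\<dots> = (\<integral>\<^sup>+x. w x \<partial>?P)" by (rule int[OF wm])
    also have "\<dots> = (\<Prod>k<n. \<integral>\<^sup>+z. ennreal (jw \<delta> z) \<partial>N k)"
      unfolding w_def PN[symmetric] N_def
      by (rule product_nn_integral_prod) (auto cong: measurable_cong_sets)
    also have "\<dots> = (\<Prod>k<n. ennreal (jconst \<delta> (cjs n \<beta> k)))"
      unfolding N_def using nn_integral_jw[OF a0 \<delta>] by simp
    also have "\<dots> = ennreal Z"
      unfolding Z_def using jconst_pos[OF a0 \<delta>] by (intro prod_ennreal) (simp add: less_imp_le)
    finally show ?thesis .
  qed
  have wZ: "w x / ennreal Z = (\<Prod>k<n. jfactor n \<delta> \<beta> k (x k))" for x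
  proof -
    have "w x / ennreal Z = ennreal ((\<Prod>k<n. jw \<delta> (x k)) / Z)"
      unfolding w_def using Zp by (simp add: prod_ennreal prod_nonneg divide_ennreal)
    also have "(\<Prod>k<n. jw \<delta> (x k)) / Z = (\<Prod>k<n. jw \<delta> (x k) / jconst \<delta> (cjs n \<beta> k))"
      unfolding Z_def by (rule prod_dividef[symmetric])
    also have "ennreal \<dots> = (\<Prod>k<n. jfactor n \<delta> \<beta> k (x k))"
      unfolding jfactor_def using jconst_pos[OF a0 \<delta>]
      by (intro prod_ennreal[symmetric]) (simp add: less_imp_le)
    finally show ?thesis .
  qed
  have CJ: "CJ n \<delta> \<beta> = density (CJ0 n \<beta>) (\<lambda>A. w (g A) / ennreal Z)"
    unfolding CJ_def Zint using AEg by (intro density_cong_AE) (auto simp: ggood)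
  have gC: "g \<in> CJ0 n \<beta> \<rightarrow>\<^sub>M ?P" using gm by (simp add: C0 cong: measurable_cong_sets)
  have wZm: "(\<lambda>x. w x / ennreal Z) \<in> borel_measurable ?P" using wm by measurable
  have "(\<integral>\<^sup>+A. f (g A) \<partial>CJ n \<delta> \<beta>) = (\<integral>\<^sup>+A. (w (g A) / ennreal Z) * f (g A) \<partial>CJ0 n \<beta>)"
    unfolding CJ by (rule nn_integral_density[OF measurable_compose[OF gC wZm] measurable_compose[OF gC fP]])
  also have "\<dots> = (\<integral>\<^sup>+x. (w x / ennreal Z) * f x \<partial>?P)"
    by (rule int) (intro borel_measurable_times_ennreal wZm fP)
  also have "\<dots> = (\<integral>\<^sup>+x. f x \<partial>density ?P (\<lambda>x. w x / ennreal Z))"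
    by (rule nn_integral_density[OF wZm fP, symmetric])
  also have "density ?P (\<lambda>x. w x / ennreal Z) = Pi\<^sub>M {..<n} (\<lambda>k. density (N k) (jfactor n \<delta> \<beta> k))"
    unfolding wZ N_def
  proof (rule density_prod_eq_PiM)
    fix k
    show "(\<integral>\<^sup>+z. jfactor n \<delta> \<beta> k z \<partial>nu (2 * cjs n \<beta> k + 1)) = 1"
      by (rule nn_integral_jfactor[OF \<delta> \<beta>])
  qed auto
  finally show ?thesis by (simp only: g_def)
qed

section \<open>Identification of the densities\<close>

lemma Gamma_cnj_mult: "Gamma z * Gamma (cnj z) = of_real ((cmod (Gamma z))\<^sup>2)"
  by (simp only: complex_norm_square cnj_Gamma)

lemma add_cnj_of_real: "of_real a + 1 + \<delta> + cnj \<delta> = complex_of_real (a + 1 + 2 * Re \<delta>)"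
  by (simp add: complex_eq_iff)

text \<open>The stated constant is the constant a / pi of \<open>nu (2 * a + 1)\<close> divided by
  the expectation of the weight; Gamma(a + 1) = a Gamma(a) absorbs the factor a.\<close>

lemma jacobi_const_eq:
  assumes "0 < a" "a = \<beta>' * real (n - k - 1)"
  shows "jacobi_const k n \<beta>' \<delta> = of_real (a / pi / jconst \<delta> a)"
proof -
  have c: "of_real a + 1 + cnj \<delta> = cnj (of_real a + 1 + \<delta>)" by simp
  have "jacobi_const k n \<beta>' \<delta> = of_real ((cmod (Gamma (of_real a + 1 + \<delta>)))\<^sup>2 / (pi * Gamma a * Gamma (a + 1 + 2 * Re \<delta>)))"
    unfolding jacobi_const_def Let_def assms(2)[symmetric] add_cnj_of_real c Gamma_cnj_mult Gamma_complex_of_real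
    by simp
  also have "(cmod (Gamma (of_real a + 1 + \<delta>)))\<^sup>2 / (pi * Gamma a * Gamma (a + 1 + 2 * Re \<delta>)) = a / pi / jconst \<delta> a"
  proof -
    have "Gamma (a + 1) = a * Gamma a" using assms(1) by (intro Gamma_plus1) (auto simp: nonpos_Ints_def)
    then show ?thesis using assms(1) by (simp add: jconst_def)
  qed
  finally show ?thesis .
qed

lemma jconst_0_eq: "Gamma (1 + \<delta>) * Gamma (1 + cnj \<delta>) / Gamma (1 + \<delta> + cnj \<delta>) = of_real (1 / jconst \<delta> 0)"
proof -
  have c: "1 + cnj \<delta> = cnj (1 + \<delta>)" by simp
  have d: "1 + \<delta> + cnj \<delta> = complex_of_real (1 + 2 * Re \<delta>)" by (simp add: complex_eq_iff)
  show ?thesis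
    unfolding d c Gamma_cnj_mult Gamma_complex_of_real by (simp add: jconst_def)
qed

lemma measurable_jweight [measurable]: "jweight \<delta> \<in> borel_measurable borel"
proof -
  have "(\<lambda>z. (1 - cnj z) powr \<delta>) \<in> borel_measurable borel"
    using measurable_compose[OF borel_measurable_refl[of 1] measurable_powr_complex] by simp
  then show ?thesis unfolding jweight_def by measurable
qed

lemma distributed_discI:
  assumes \<delta>: "- 1 / 2 < Re \<delta>" and a: "0 < a" "a = \<beta>' * real (n - k - 1)"
    and X: "X \<in> borel_measurable M"
    and law: "distr M borel X = density (nu (2 * a + 1)) (\<lambda>z. ennreal (jw \<delta> z / jconst \<delta> a))"
  shows "has_density M lborel X (\<lambda>z. jacobi_const k n \<beta>' \<delta> *
    of_real ((1 - (cmod z)\<^sup>2) powr (\<beta>' * real (n - k - 1) - 1)) *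
    (1 - z) powr cnj \<delta> * (1 - cnj z) powr \<delta> * indicator (ball 0 1) z)"
proof -
  define \<phi> where "\<phi> z = a / pi / jconst \<delta> a * ((1 - (cmod z)\<^sup>2) powr (a - 1) * jw \<delta> z * indicator (ball 0 1) z)" for z
  have jc: "0 < jconst \<delta> a" using a(1) \<delta> by (intro jconst_pos) auto
  have \<phi>0: "0 \<le> \<phi> z" for z
    unfolding \<phi>_def using a(1) jc by (intro mult_nonneg_nonneg divide_nonneg_nonneg) auto
  have eq: "(\<lambda>z. jacobi_const k n \<beta>' \<delta> *
    of_real ((1 - (cmod z)\<^sup>2) powr (\<beta>' * real (n - k - 1) - 1)) *
    (1 - z) powr cnj \<delta> * (1 - cnj z) powr \<delta> * indicator (ball 0 1) z) = (\<lambda>z. complex_of_real (\<phi> z))"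
  proof
    fix z :: complex
    have "(1 - z) powr cnj \<delta> * (1 - cnj z) powr \<delta> = of_real (jw \<delta> z)" if "cmod z < 1"
      using jweight_eq_jw[of z \<delta>] that by (simp add: jweight_def)
    then show "jacobi_const k n \<beta>' \<delta> * of_real ((1 - (cmod z)\<^sup>2) powr (\<beta>' * real (n - k - 1) - 1)) *
      (1 - z) powr cnj \<delta> * (1 - cnj z) powr \<delta> * indicator (ball 0 1) z = complex_of_real (\<phi> z)"
      unfolding jacobi_const_eq[OF a] \<phi>_def a(2)[symmetric]
      by (cases "z \<in> ball 0 1") (simp_all add: mult.assoc)
  qed
  have [measurable]: "ball 0 1 \<in> sets (borel :: complex measure)" by simp
  have \<phi>m [measurable]: "\<phi> \<in> borel_measurable borel" unfolding \<phi>_def[abs_def] by measurable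
  have "distr M lborel X = distr M borel X" by (rule distr_cong) auto
  also have "\<dots> = density (density lborel (nu_dens (2 * a + 1))) (\<lambda>z. ennreal (jw \<delta> z / jconst \<delta> a))"
    unfolding law using a(1) by (subst nu_eq_density) auto
  also have "\<dots> = density lborel (\<lambda>z. nu_dens (2 * a + 1) z * ennreal (jw \<delta> z / jconst \<delta> a))"
    by (rule density_density_eq) auto
  also have "(\<lambda>z. nu_dens (2 * a + 1) z * ennreal (jw \<delta> z / jconst \<delta> a)) = (\<lambda>z. ennreal (\<phi> z))"
  proof
    fix z :: complex
    have e: "(2 * a + 1 - 3) / 2 = a - 1" "(2 * a + 1 - 1) / (2 * pi) = a / pi" by simp_all
    show "nu_dens (2 * a + 1) z * ennreal (jw \<delta> z / jconst \<delta> a) = ennreal (\<phi> z)"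
    proof (cases "z \<in> ball 0 1")
      case True
      have "nu_dens (2 * a + 1) z * ennreal (jw \<delta> z / jconst \<delta> a) =
          ennreal (a / pi * (1 - (cmod z)\<^sup>2) powr (a - 1)) * ennreal (jw \<delta> z / jconst \<delta> a)"
        using True unfolding nu_dens_def e by simp
      also have "\<dots> = ennreal (a / pi * (1 - (cmod z)\<^sup>2) powr (a - 1) * (jw \<delta> z / jconst \<delta> a))"
        using a(1) jc by (intro ennreal_mult[symmetric]) auto
      also have "a / pi * (1 - (cmod z)\<^sup>2) powr (a - 1) * (jw \<delta> z / jconst \<delta> a) = \<phi> z"
        using True by (simp add: \<phi>_def)
      finally show ?thesis .
    qed (simp add: nu_dens_def \<phi>_def)
  qed
  finally have "distr M lborel X = density lborel (\<lambda>z. ennreal (\<phi> z))" .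
  then show ?thesis
    unfolding eq has_density_def distributed_def using X \<phi>0
    by (auto simp: complex_nonneg_Reals_iff)
qed

lemma distributed_circleI:
  assumes \<delta>: "- 1 / 2 < Re \<delta>" and X: "X \<in> borel_measurable M"
    and law: "distr M borel X = density circle_haar (\<lambda>z. ennreal (jw \<delta> z / jconst \<delta> 0))"
  shows "has_density M circle_haar X (\<lambda>\<zeta>.
    Gamma (1 + \<delta>) * Gamma (1 + cnj \<delta>) / Gamma (1 + \<delta> + cnj \<delta>) * (1 - \<zeta>) powr cnj \<delta> * (1 - cnj \<zeta>) powr \<delta>)"
proof -
  let ?f = "\<lambda>\<zeta>. Gamma (1 + \<delta>) * Gamma (1 + cnj \<delta>) / Gamma (1 + \<delta> + cnj \<delta>) * (1 - \<zeta>) powr cnj \<delta> * (1 - cnj \<zeta>) powr \<delta>"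
  have jc: "0 < jconst \<delta> 0" using \<delta> by (intro jconst_pos) auto
  have f: "?f = (\<lambda>\<zeta>. of_real (1 / jconst \<delta> 0) * jweight \<delta> \<zeta>)"
    unfolding jconst_0_eq by (simp add: jweight_def mult.assoc)
  have fm: "?f \<in> borel_measurable circle_haar" unfolding f by measurable
  \<comment> \<open>The complex formula is matched with the real weight only in the closed disc,
    which suffices because Haar measure is carried by the circle.\<close>
  have ae: "AE \<zeta> in circle_haar. ?f \<zeta> = of_real (jw \<delta> \<zeta> / jconst \<delta> 0)"
    unfolding fun_cong[OF f] using AE_haar_norm by eventually_elim (simp add: jweight_eq_jw)
  have "distr M circle_haar X = distr M borel X" by (rule distr_cong) auto
  also have "\<dots> = density circle_haar (\<lambda>\<zeta>. ennreal (Re (?f \<zeta>)))"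
    unfolding law
  proof (rule density_cong_AE)
    show "AE \<zeta> in circle_haar. ennreal (jw \<delta> \<zeta> / jconst \<delta> 0) = ennreal (Re (?f \<zeta>))"
      using ae by eventually_elim (simp only: Re_complex_of_real)
  qed
  finally have "distr M circle_haar X = density circle_haar (\<lambda>\<zeta>. ennreal (Re (?f \<zeta>)))" .
  moreover have "AE \<zeta> in circle_haar. ?f \<zeta> \<in> \<real>\<^sub>\<ge>\<^sub>0"
    using ae
  proof eventually_elim
    case (elim \<zeta>)
    show ?case unfolding elim using jc by (simp add: complex_nonneg_Reals_iff)
  qed
  moreover have "(\<lambda>\<zeta>. ennreal (Re (?f \<zeta>))) \<in> borel_measurable circle_haar"
  proof -
    have "(\<lambda>\<zeta>. Re (?f \<zeta>)) \<in> borel_measurable circle_haar" by (rule measurable_compose[OF fm]) measurable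
    then show ?thesis by (rule measurable_compose[OF _ measurable_ennreal])
  qed
  moreover have "X \<in> M \<rightarrow>\<^sub>M circle_haar" using X by (simp cong: measurable_cong_sets)
  ultimately show ?thesis unfolding has_density_def distributed_def by blast
qed

theorem theorem3p2:
  fixes n :: nat and \<delta> :: complex and \<beta> \<beta>' :: real
    and M :: "'a measure"
    and U :: "'a \<Rightarrow> complex Matrix.mat"
    and \<gamma> :: "nat \<Rightarrow> 'a \<Rightarrow> complex"
  assumes "n \<ge> 1"
    and "Re \<delta> > -1/2"
    and "\<beta> > 0"
    and "\<beta>' = \<beta> / 2"
    and "prob_space M"
    and "U \<in> M \<rightarrow>\<^sub>M mat_borel n"
    and "distr M (mat_borel n) U = CJ n \<delta> \<beta>"
    and "\<And>k \<omega>. k < n \<Longrightarrow> \<omega> \<in> space M \<Longrightarrow>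
           \<gamma> k \<omega> = deformed_verblunsky (spectral_measure n (U \<omega>) (unit_vec n 0)) k"
  shows "prob_space.indep_vars M (\<lambda>_. borel) \<gamma> {..<n}
    \<and> (\<forall>k. k < n - 1 \<longrightarrow>
         has_density M lborel (\<gamma> k) (\<lambda>z.
           jacobi_const k n \<beta>' \<delta> *
           of_real ((1 - (cmod z)\<^sup>2) powr (\<beta>' * real (n - k - 1) - 1)) *
           (1 - z) powr cnj \<delta> * (1 - cnj z) powr \<delta> * indicator (ball 0 1) z))
    \<and> has_density M circle_haar (\<gamma> (n - 1)) (\<lambda>\<zeta>.
         Gamma (1 + \<delta>) * Gamma (1 + cnj \<delta>) / Gamma (1 + \<delta> + cnj \<delta>) *
         (1 - \<zeta>) powr cnj \<delta> * (1 - cnj \<zeta>) powr \<delta>)"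
proof -
  note n1 = assms(1) and \<delta> = assms(2) and \<beta> = assms(3) and U = assms(6) and law = assms(7)
  interpret M: prob_space M by fact
  have \<gamma>: "\<gamma> k \<omega> = gcoef n (U \<omega>) k" if "k < n" "\<omega> \<in> space M" for k \<omega>
    using assms(8)[OF that] by (simp add: gcoef_def)
  define Q where "Q k = density (nu (2 * cjs n \<beta> k + 1)) (jfactor n \<delta> \<beta> k)" for k
  have setsQ: "sets (Q k) = sets borel" for k by (simp add: Q_def)
  have \<gamma>m: "\<gamma> k \<in> borel_measurable M" if k: "k < n" for k
  proof -
    have "(\<lambda>\<omega>. gcoef n (U \<omega>) k) \<in> borel_measurable M"
      by (rule measurable_compose[OF U measurable_gcoef[OF n1 k]])
    then show ?thesis using \<gamma>[OF k] by (simp cong: measurable_cong)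
  qed
  let ?B = "Pi\<^sub>M {..<n} (\<lambda>_. borel :: complex measure)"
  let ?X = "\<lambda>\<omega>. \<lambda>k\<in>{..<n}. \<gamma> k \<omega>"
  have Xm: "?X \<in> M \<rightarrow>\<^sub>M ?B" using \<gamma>m by (intro measurable_restrict) auto
  have gm: "(\<lambda>A. \<lambda>k\<in>{..<n}. gcoef n A k) \<in> mat_borel n \<rightarrow>\<^sub>M ?B"
    using measurable_gcoef[OF n1] by (intro measurable_restrict) auto
  \<comment> \<open>Everything is read off from this identity: its coordinates give the marginal
    laws, and its product form gives independence.\<close>
  have joint: "distr M ?B ?X = Pi\<^sub>M {..<n} Q"
  proof (rule measure_eqI)
    show "sets (distr M ?B ?X) = sets (Pi\<^sub>M {..<n} Q)"
      unfolding sets_distr by (rule sets_PiM_cong) (auto simp: setsQ)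
    fix A assume "A \<in> sets (distr M ?B ?X)"
    then have A: "A \<in> sets ?B" by simp
    then have f: "indicator A \<in> borel_measurable ?B" by (rule borel_measurable_indicator)
    have A': "A \<in> sets (Pi\<^sub>M {..<n} Q)"
      using A by (subst sets_PiM_cong[OF refl, of _ _ "\<lambda>_. borel"]) (auto simp: setsQ)
    have "emeasure (distr M ?B ?X) A = (\<integral>\<^sup>+x. indicator A x \<partial>distr M ?B ?X)" using A by simp
    also have "\<dots> = (\<integral>\<^sup>+\<omega>. indicator A (?X \<omega>) \<partial>M)"
      using f by (subst nn_integral_distr[OF Xm]) auto
    also have "\<dots> = (\<integral>\<^sup>+\<omega>. indicator A (\<lambda>k\<in>{..<n}. gcoef n (U \<omega>) k) \<partial>M)"
    proof (rule nn_integral_cong)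
      fix \<omega> assume "\<omega> \<in> space M"
      then have "?X \<omega> = (\<lambda>k\<in>{..<n}. gcoef n (U \<omega>) k)" using \<gamma> by (intro restrict_ext) auto
      then show "indicator A (?X \<omega>) = (indicator A (\<lambda>k\<in>{..<n}. gcoef n (U \<omega>) k) :: ennreal)" by simp
    qed
    also have "\<dots> = (\<integral>\<^sup>+V. indicator A (\<lambda>k\<in>{..<n}. gcoef n V k) \<partial>distr M (mat_borel n) U)"
      using measurable_compose[OF gm f] by (subst nn_integral_distr[OF U]) auto
    also have "\<dots> = (\<integral>\<^sup>+x. indicator A x \<partial>Pi\<^sub>M {..<n} Q)"
      unfolding law Q_def by (rule law_gcoef[OF n1 _ \<beta> f]) (use \<delta> in simp)
    also have "\<dots> = emeasure (Pi\<^sub>M {..<n} Q) A" using A' by simp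
    finally show "emeasure (distr M ?B ?X) A = emeasure (Pi\<^sub>M {..<n} Q) A" .
  qed
  have prQ: "prob_space (Q k)" if k: "k < n" for k
  proof -
    have "emeasure (Q k) UNIV = (\<integral>\<^sup>+z. jfactor n \<delta> \<beta> k z \<partial>nu (2 * cjs n \<beta> k + 1))"
      unfolding Q_def by (subst emeasure_density) (auto cong: measurable_cong_sets)
    also have "\<dots> = 1" using nn_integral_jfactor[OF _ \<beta>] \<delta> by simp
    finally show ?thesis by (intro prob_spaceI) (simp add: Q_def)
  qed
  have marg: "distr M borel (\<gamma> k) = Q k" if k: "k < n" for k
  proof -
    have "Q k = distr (Pi\<^sub>M {..<n} Q) (Q k) (\<lambda>x. x k)"
      using prQ k by (intro distr_PiM_component[symmetric]) auto
    also have "\<dots> = distr (distr M ?B ?X) borel (\<lambda>x. x k)"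
      unfolding joint by (rule distr_cong) (auto simp: setsQ)
    also have "\<dots> = distr M borel ((\<lambda>x. x k) \<circ> ?X)"
      by (rule distr_distr[OF _ Xm]) (use k in \<open>auto intro: measurable_component_singleton\<close>)
    also have "\<dots> = distr M borel (\<gamma> k)"
      using k by (intro distr_cong) auto
    finally show ?thesis by simp
  qed
  have "M.indep_vars (\<lambda>_. borel) \<gamma> {..<n}"
  proof (subst M.indep_vars_iff_distr_eq_PiM')
    show "distr M ?B ?X = Pi\<^sub>M {..<n} (\<lambda>i. distr M borel (\<gamma> i))"
      unfolding joint using marg by (intro PiM_cong) auto
    have "0 \<in> {..<n}" using n1 by simp
    then show "{..<n} \<noteq> {}" by blast
  qed (use \<gamma>m in auto)
  moreover have "has_density M lborel (\<gamma> k) (\<lambda>z.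
           jacobi_const k n \<beta>' \<delta> *
           of_real ((1 - (cmod z)\<^sup>2) powr (\<beta>' * real (n - k - 1) - 1)) *
           (1 - z) powr cnj \<delta> * (1 - cnj z) powr \<delta> * indicator (ball 0 1) z)" if k: "k < n - 1" for k
  proof (rule distributed_discI)
    show "0 < cjs n \<beta> k" using \<beta> k by (simp add: cjs_def)
    show "cjs n \<beta> k = \<beta>' * real (n - k - 1)" by (simp add: cjs_def assms(4))
    show "\<gamma> k \<in> borel_measurable M" using \<gamma>m k by simp
    show "distr M borel (\<gamma> k) = density (nu (2 * cjs n \<beta> k + 1)) (\<lambda>z. ennreal (jw \<delta> z / jconst \<delta> (cjs n \<beta> k)))"
      using marg[of k] k by (simp add: Q_def jfactor_def[abs_def])
  qed (use \<delta> in simp)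
  moreover have "has_density M circle_haar (\<gamma> (n - 1)) (\<lambda>\<zeta>.
         Gamma (1 + \<delta>) * Gamma (1 + cnj \<delta>) / Gamma (1 + \<delta> + cnj \<delta>) *
         (1 - \<zeta>) powr cnj \<delta> * (1 - cnj \<zeta>) powr \<delta>)"
  proof (rule distributed_circleI)
    show "\<gamma> (n - 1) \<in> borel_measurable M" using \<gamma>m n1 by simp
    \<comment> \<open>At the last index the parameter is 0, so the reference law is Haar measure
      instead of a density on the disc.\<close>
    have c: "cjs n \<beta> (n - 1) = 0" using n1 by (simp add: cjs_def)
    have "nu (2 * cjs n \<beta> (n - 1) + 1) = circle_haar" unfolding c by (simp add: nu_def)
    then show "distr M borel (\<gamma> (n - 1)) = density circle_haar (\<lambda>z. ennreal (jw \<delta> z / jconst \<delta> 0))"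
      using marg[of "n - 1"] n1 unfolding Q_def jfactor_def[abs_def] c by simp
  qed (use \<delta> in simp)
  ultimately show ?thesis by blast
qed

end
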